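(* Let $\Omega \subset \mathbb{R}^d$ be a bounded domain with a Lipschitz boundary. Then the following holds true: (i) The set $\{ v \in L^\infty(\Omega) \mid -1 \le v \le 1 \ \mathcal{L}^d\text{-a.e. in } \Omega \}$ is non-polyhedric in the dual space $H^{-s}(\Omega)$ of the space $H_0^s(\Omega) := \operatorname{cl}_{\|\cdot\|_{H^s}}(C_c^\infty(\Omega))$ for all $s \in (0,1]$. (ii) The set $\{ v \in L^\infty(\partial\Omega) \mid -1 \le v \le 1 \ \mathcal{S}^{d-1}\text{-a.e. on } \partial\Omega \}$ is non-polyhedric in the dual space $H^{-1/2}(\partial\Omega)$ of the space $H^{1/2}(\partial\Omega)$.
   Context: $\mathcal{L}^d$ is the $d$-dimensional Lebesgue measure and $\mathcal{S}^{d-1}$ the surface measure on $\partial\Omega$. All function spaces are real; $H^s$ for non-integer $s$ denotes the Sobolev–Slobodeckij space. A function $v \in L^\infty(\Omega)$ is identified with the functional $u \mapsto \int_\Omega v\,u\,\mathrm{d}\mathcal{L}^d$ on $H_0^s(\Omega)$, and $v \in L^\infty(\partial\Omega)$ with $u \mapsto \int_{\partial\Omega} v\,u\,\mathrm{d}\mathcal{S}^{d-1}$ on $H^{1/2}(\partial\Omega)$. Polyhedricity: for a closed, convex, non-empty subset $K$ of a Banach space $W$ and $w \in K$, let $\mathcal{R}_K(w) := \mathbb{R}^+(K - w)$, $\mathcal{T}_K(w) := \overline{\mathcal{R}_K(w)}$ (closure in $W$) and $\mathcal{N}_K(w) := \mathcal{T}_K(w)^\circ = \{\eta \in W^\star \mid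 \langle \eta, h\rangle \le 0 \ \forall h \in \mathcal{T}_K(w)\}$. For $\eta \in W^\star$ let $\eta^\perp \subset W$ denote the kernel of $\eta$. $K$ is polyhedric at $w \in K$ with respect to $\eta \in \mathcal{N}_K(w)$ if $\mathcal{T}_K(w) \cap \eta^\perp = \overline{\mathcal{R}_K(w) \cap \eta^\perp}$. $K$ is called polyhedric if it is polyhedric at every $w \in K$ with respect to all $\eta \in \mathcal{N}_K(w)$, and non-polyhedric otherwise. Here $W$ is the respective dual space.
   Formalization: Part (ii) is stated only for d ≥ 2; for d = 1 the boundary is two points, the set is the square [-1,1]² in ℝ², which is polyhedric, so the claim fails there. *)

theory Defs
  imports "HOL-Analysis.Analysis" "HOL-Library.Function_Algebras"
begin

section \<open>Normed spaces given by a carrier and a norm\<close>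

text \<open>
  The Sobolev spaces below depend on a set and on a real exponent, so they are not types.
  A (semi)normed space is therefore a linear subspace \<open>V\<close> of a real vector space together with a
  function \<open>N\<close> that is a (semi)norm on \<open>V\<close>. Functions carry the pointwise vector space structure.
\<close>

instantiation "fun" :: (type, real_vector) real_vector
begin

definition scaleR_fun :: "real \<Rightarrow> ('a \<Rightarrow> 'b) \<Rightarrow> 'a \<Rightarrow> 'b" where
  "scaleR_fun c f = (\<lambda>x. c *\<^sub>R f x)"

instance
  by standard (auto simp: scaleR_fun_def fun_eq_iff scaleR_add_right scaleR_add_left)

end

definition norm_closure :: "'w::real_vector set \<Rightarrow> ('w \<Rightarrow> real) \<Rightarrow> 'w set \<Rightarrow> 'w set" where
  "norm_closure W N A = {x \<in> W. \<forall>e>0. \<exists>a\<in>A. N (x - a) < e}"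

text \<open>
  Functionals are normalised to vanish outside the carrier, so that two elements of the dual are
  equal iff they agree on \<open>V\<close>. If \<open>N\<close> is only a seminorm, boundedness forces a functional to respect
  equality up to \<open>N\<close>-null vectors; hence this is also the dual of the quotient normed space.
\<close>

definition dual_space :: "'w::real_vector set \<Rightarrow> ('w \<Rightarrow> real) \<Rightarrow> ('w \<Rightarrow> real) set" where
  "dual_space V N = {f.
     (\<forall>x\<in>V. \<forall>y\<in>V. f (x + y) = f x + f y) \<and>
     (\<forall>c. \<forall>x\<in>V. f (c *\<^sub>R x) = c * f x) \<and>
     (\<exists>C. \<forall>x\<in>V. \<bar>f x\<bar> \<le> C * N x) \<and>
     (\<forall>x. x \<notin> V \<longrightarrow> f x = 0)}"

definition dual_norm :: "'w::real_vector set \<Rightarrow> ('w \<Rightarrow> real) \<Rightarrow> ('w \<Rightarrow> real) \<Rightarrow> real" where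
  "dual_norm V N f = (SUP x\<in>{x \<in> V. N x \<le> 1}. \<bar>f x\<bar>)"


section \<open>Polyhedricity\<close>

definition radial_cone :: "'w::real_vector set \<Rightarrow> 'w \<Rightarrow> 'w set" where
  "radial_cone K w = {c *\<^sub>R (v - w) | c v. c > 0 \<and> v \<in> K}"

definition tangent_cone :: "'w::real_vector set \<Rightarrow> ('w \<Rightarrow> real) \<Rightarrow> 'w set \<Rightarrow> 'w \<Rightarrow> 'w set" where
  "tangent_cone W N K w = norm_closure W N (radial_cone K w)"

definition normal_cone ::
    "'w::real_vector set \<Rightarrow> ('w \<Rightarrow> real) \<Rightarrow> 'w set \<Rightarrow> 'w \<Rightarrow> ('w \<Rightarrow> real) set" where
  "normal_cone W N K w = {\<eta> \<in> dual_space W N. \<forall>h\<in>tangent_cone W N K w. \<eta> h \<le> 0}"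

definition kernel_on :: "'w set \<Rightarrow> ('w \<Rightarrow> real) \<Rightarrow> 'w set" where
  "kernel_on W \<eta> = {h \<in> W. \<eta> h = 0}"

definition polyhedric_at ::
    "'w::real_vector set \<Rightarrow> ('w \<Rightarrow> real) \<Rightarrow> 'w set \<Rightarrow> 'w \<Rightarrow> ('w \<Rightarrow> real) \<Rightarrow> bool" where
  "polyhedric_at W N K w \<eta> \<longleftrightarrow>
     tangent_cone W N K w \<inter> kernel_on W \<eta> = norm_closure W N (radial_cone K w \<inter> kernel_on W \<eta>)"

definition polyhedric :: "'w::real_vector set \<Rightarrow> ('w \<Rightarrow> real) \<Rightarrow> 'w set \<Rightarrow> bool" where
  "polyhedric W N K \<longleftrightarrow> (\<forall>w\<in>K. \<forall>\<eta>\<in>normal_cone W N K w. polyhedric_at W N K w \<eta>)"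

text \<open>
  Polyhedricity is a notion for closed, convex, non-empty subsets of \<open>W\<close>. These requirements are
  part of being non-polyhedric, so a set cannot be non-polyhedric merely for violating them.
\<close>

definition non_polyhedric :: "'w::real_vector set \<Rightarrow> ('w \<Rightarrow> real) \<Rightarrow> 'w set \<Rightarrow> bool" where
  "non_polyhedric W N K \<longleftrightarrow>
     K \<subseteq> W \<and> norm_closure W N K = K \<and> convex K \<and> K \<noteq> {} \<and> \<not> polyhedric W N K"


section \<open>Lipschitz domains and surface measure\<close>

text \<open>
  Near each boundary point, \<open>\<Omega>\<close> is the part strictly above the graph of a Lipschitz function \<open>\<gamma>\<close>
  over the hyperplane orthogonal to a unit vector \<open>e\<close>.
\<close>

definition lipschitz_boundary :: "'a::euclidean_space set \<Rightarrow> bool" where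
  "lipschitz_boundary \<Omega> \<longleftrightarrow>
     (\<forall>p\<in>frontier \<Omega>. \<exists>e r L. \<exists>\<gamma> :: 'a \<Rightarrow> real.
        norm e = 1 \<and> r > 0 \<and> L-lipschitz_on {z. z \<bullet> e = 0} \<gamma> \<and>
        \<Omega> \<inter> ball p r = {y \<in> ball p r. y \<bullet> e > \<gamma> (y - (y \<bullet> e) *\<^sub>R e)})"

text \<open>
  Hausdorff measure of integer dimension \<open>m\<close>, normalised so that it is \<open>m\<close>-dimensional surface
  measure. Boundedness of the covering sets is required because \<^const>\<open>diameter\<close> is meaningful only
  for bounded sets; the empty set is treated separately because of \<open>0 ^ 0 = 1\<close>.
\<close>

definition hausdorff_content :: "nat \<Rightarrow> 'a::euclidean_space set \<Rightarrow> ennreal" where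
  "hausdorff_content m S =
     (if S = {} then 0 else ennreal (unit_ball_vol (real m) * (diameter S / 2) ^ m))"

definition hausdorff_outer :: "nat \<Rightarrow> 'a::euclidean_space set \<Rightarrow> ennreal" where
  "hausdorff_outer m A =
     (SUP \<delta>\<in>{0<..}. INF C\<in>{C :: nat \<Rightarrow> 'a set.
        A \<subseteq> (\<Union>i. C i) \<and> (\<forall>i. bounded (C i) \<and> diameter (C i) \<le> \<delta>)}.
        \<Sum>i. hausdorff_content m (C i))"

definition hausdorff_measure :: "nat \<Rightarrow> 'a::euclidean_space measure" where
  "hausdorff_measure m = measure_of UNIV (sets borel) (hausdorff_outer m)"

text \<open>
  The Lebesgue measure is taken on Borel sets. Since every Lebesgue measurable function is almost
  everywhere equal to a Borel function, the resulting function spaces are the usual ones.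
\<close>

definition domain_measure :: "'a::euclidean_space set \<Rightarrow> 'a measure" where
  "domain_measure \<Omega> = restrict_space lborel \<Omega>"

definition surface_measure :: "'a::euclidean_space set \<Rightarrow> 'a measure" where
  "surface_measure \<Omega> = restrict_space (hausdorff_measure (DIM('a) - 1)) (frontier \<Omega>)"


section \<open>Sobolev and Sobolev--Slobodeckij spaces\<close>

text \<open>
  Elements of the function spaces are representatives \<open>'a \<Rightarrow> real\<close>, of which only the values on
  the underlying set matter; the norms are accordingly seminorms. Squared norms take values in
  \<^typ>\<open>ennreal\<close> and are infinite outside the space.
\<close>

definition L2_sq :: "'a measure \<Rightarrow> ('a \<Rightarrow> real) \<Rightarrow> ennreal" where
  "L2_sq M u = (\<integral>\<^sup>+x. ennreal ((u x)\<^sup>2) \<partial>M)"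

definition slobodeckij_sq ::
    "real \<Rightarrow> real \<Rightarrow> 'a::euclidean_space measure \<Rightarrow> ('a \<Rightarrow> real) \<Rightarrow> ennreal" where
  "slobodeckij_sq m s M u =
     (\<integral>\<^sup>+x. \<integral>\<^sup>+y. ennreal ((u x - u y)\<^sup>2 / dist x y powr (m + 2 * s)) \<partial>M \<partial>M)"

primrec C_k :: "nat \<Rightarrow> ('a::euclidean_space \<Rightarrow> real) \<Rightarrow> bool" where
  "C_k 0 f \<longleftrightarrow> continuous_on UNIV f"
| "C_k (Suc k) f \<longleftrightarrow> (\<forall>x. f differentiable (at x)) \<and>
     (\<forall>i\<in>Basis. C_k k (\<lambda>x. frechet_derivative f (at x) i))"

definition test_functions :: "'a::euclidean_space set \<Rightarrow> ('a \<Rightarrow> real) set" where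
  "test_functions \<Omega> = {\<phi>. (\<forall>k. C_k k \<phi>) \<and>
     compact (closure {x. \<phi> x \<noteq> 0}) \<and> closure {x. \<phi> x \<noteq> 0} \<subseteq> \<Omega>}"

definition weak_gradient ::
    "'a::euclidean_space set \<Rightarrow> ('a \<Rightarrow> real) \<Rightarrow> ('a \<Rightarrow> 'a) \<Rightarrow> bool" where
  "weak_gradient \<Omega> u g \<longleftrightarrow> g \<in> borel_measurable (domain_measure \<Omega>) \<and>
     (\<forall>\<phi>\<in>test_functions \<Omega>. \<forall>i\<in>Basis.
        integrable (domain_measure \<Omega>) (\<lambda>x. u x * frechet_derivative \<phi> (at x) i) \<and>
        integrable (domain_measure \<Omega>) (\<lambda>x. (g x \<bullet> i) * \<phi> x) \<and>
        (\<integral>x. u x * frechet_derivative \<phi> (at x) i \<partial>domain_measure \<Omega>) =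
          - (\<integral>x. (g x \<bullet> i) * \<phi> x \<partial>domain_measure \<Omega>))"

text \<open>
  Weak gradients are unique up to null sets, so all members of the following infimum coincide;
  it is infinite if there is no weak gradient.
\<close>

definition dirichlet_sq :: "'a::euclidean_space set \<Rightarrow> ('a \<Rightarrow> real) \<Rightarrow> ennreal" where
  "dirichlet_sq \<Omega> u =
     (INF g\<in>{g. weak_gradient \<Omega> u g}. \<integral>\<^sup>+x. ennreal ((norm (g x))\<^sup>2) \<partial>domain_measure \<Omega>)"

text \<open>The exponent \<open>s\<close> is meant to range over \<open>(0,1]\<close>.\<close>

definition Hs_sq :: "real \<Rightarrow> 'a::euclidean_space set \<Rightarrow> ('a \<Rightarrow> real) \<Rightarrow> ennreal" where
  "Hs_sq s \<Omega> u = L2_sq (domain_measure \<Omega>) u +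
     (if s = 1 then dirichlet_sq \<Omega> u
      else slobodeckij_sq (real DIM('a)) s (domain_measure \<Omega>) u)"

definition Hs :: "real \<Rightarrow> 'a::euclidean_space set \<Rightarrow> ('a \<Rightarrow> real) set" where
  "Hs s \<Omega> = {u \<in> borel_measurable (domain_measure \<Omega>). Hs_sq s \<Omega> u < \<infinity>}"

definition Hs_norm :: "real \<Rightarrow> 'a::euclidean_space set \<Rightarrow> ('a \<Rightarrow> real) \<Rightarrow> real" where
  "Hs_norm s \<Omega> u = sqrt (enn2real (Hs_sq s \<Omega> u))"

definition Hs0 :: "real \<Rightarrow> 'a::euclidean_space set \<Rightarrow> ('a \<Rightarrow> real) set" where
  "Hs0 s \<Omega> = norm_closure (Hs s \<Omega>) (Hs_norm s \<Omega>) (test_functions \<Omega>)"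

text \<open>\<open>\<partial>\<Omega>\<close> has dimension \<open>DIM('a) - 1\<close>, so the kernel exponent is \<open>DIM('a) - 1 + 2 * (1/2)\<close>.\<close>

definition trace_sq :: "'a::euclidean_space set \<Rightarrow> ('a \<Rightarrow> real) \<Rightarrow> ennreal" where
  "trace_sq \<Omega> u = L2_sq (surface_measure \<Omega>) u +
     slobodeckij_sq (real DIM('a) - 1) (1 / 2) (surface_measure \<Omega>) u"

definition H_half_boundary :: "'a::euclidean_space set \<Rightarrow> ('a \<Rightarrow> real) set" where
  "H_half_boundary \<Omega> = {u \<in> borel_measurable (surface_measure \<Omega>). trace_sq \<Omega> u < \<infinity>}"

definition H_half_boundary_norm :: "'a::euclidean_space set \<Rightarrow> ('a \<Rightarrow> real) \<Rightarrow> real" where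
  "H_half_boundary_norm \<Omega> u = sqrt (enn2real (trace_sq \<Omega> u))"


section \<open>Essentially bounded functions as functionals\<close>

definition L_infinity :: "'a measure \<Rightarrow> ('a \<Rightarrow> real) set" where
  "L_infinity M = {v \<in> borel_measurable M. \<exists>C. AE x in M. \<bar>v x\<bar> \<le> C}"

definition functional_of ::
    "'a measure \<Rightarrow> ('a \<Rightarrow> real) set \<Rightarrow> ('a \<Rightarrow> real) \<Rightarrow> ('a \<Rightarrow> real) \<Rightarrow> real" where
  "functional_of M V v = (\<lambda>u. if u \<in> V then (\<integral>x. v x * u x \<partial>M) else 0)"

definition bounded_by_one :: "'a measure \<Rightarrow> ('a \<Rightarrow> real) set" where
  "bounded_by_one M = {v \<in> L_infinity M. AE x in M. - 1 \<le> v x \<and> v x \<le> 1}"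

end

theory Submission
  imports Defs
begin

text \<open>
  Polyhedricity fails at \<open>w = 1\<close>. Choose a compact null set \<open>F\<close> of positive capacity and a function
  \<open>u > 0\<close> almost everywhere in the predual that vanishes exactly on \<open>F\<close>. Evaluation at \<open>u\<close> is a normal
  functional, and a radial direction in its kernel is \<open>\<le> 0\<close> almost everywhere with \<open>\<integral> v u = 0\<close>,
  hence zero. On the other hand, a nonzero measure on \<open>F\<close> of finite energy lies in the dual space,
  annihilates \<open>u\<close> and is, up to sign, a limit of negative bounded densities, hence a tangent direction.

  Capacities are avoided: the set \<open>F\<close> and the densities \<open>g n\<close> are built together. In each step the mass
  of \<open>g n\<close> is moved, inside small balls, onto a set of half the measure. For \<open>z\<close> in the unit ball of the
  predual this changes \<open>\<integral> g z\<close> by at most a power of the radius, because the mean oscillation of \<open>z\<close> on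
  balls of radius \<open>d\<close> decays like \<open>d ^ s\<close>. So \<open>g n\<close> is Cauchy in the dual norm, while its supports shrink
  to a null set. The measure only enters through two-sided bounds \<open>\<mu> (ball x R) \<approx> R ^ m\<close>, which
  hold for the Lebesgue measure near a compact subset of \<open>\<Omega>\<close> and for the surface measure of a Lipschitz graph.
\<close>

text \<open>The order of choices lets every \<open>s > 0\<close> work without computing a dimension
  of \<open>F\<close>: a step raises the height bound of the density from \<open>B\<close> to
  \<open>4 * B\<close>, and its radius is chosen only after \<open>B\<close> is known, so small that
  \<open>B\<close> times the power \<open>s\<close> of the radius is negligible. The price is that
  \<open>F\<close> is known only in the limit. Hence \<open>u\<close> is requested for arbitrary
  compact zero sets and must be continuous: the densities live on compact sets decreasing to
  \<open>F\<close>, where \<open>u\<close> becomes uniformly small, so the limit annihilates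
  \<open>u\<close> without ever being represented as a measure. That the limit is nonzero is tested
  against one fixed \<open>p\<close> bounded below on the initial set. The other obstacle is the
  oscillation bound. For \<open>s < 1\<close>, and on the boundary, it is read off the Slobodeckij
  kernel. For \<open>s = 1\<close> there is no kernel and segments may leave \<Omega>, so it is
  proved for test functions on the whole space and carried to \<open>Hs0\<close> by density. Being
  non-polyhedric also includes closedness of the unit ball in the dual norm, which takes an argument
  of its own.\<close>

lemma scaleR_fun_apply [simp]: "(c *\<^sub>R f) x = c *\<^sub>R f x"
  by (simp add: scaleR_fun_def)

text \<open>Young's inequality with a free weight \<open>t\<close>. It replaces Cauchy-Schwarz for
  integrals: a suitable \<open>t\<close> turns square bounds into first-power bounds.\<close>

lemma abs_le_weighted_square:
  fixes a t :: real
  assumes "t > 0"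
  shows "\<bar>a\<bar> \<le> (t * a\<^sup>2 + 1 / t) / 2"
proof -
  have "0 \<le> (t * \<bar>a\<bar> - 1)\<^sup>2" by simp
  then have "2 * t * \<bar>a\<bar> \<le> t * (t * a\<^sup>2 + 1 / t)"
    using assms by (simp add: power2_eq_square algebra_simps)
  then have "t * (2 * \<bar>a\<bar>) \<le> t * (t * a\<^sup>2 + 1 / t)" by (simp add: algebra_simps)
  then show ?thesis using assms by (subst (asm) mult_le_cancel_left_pos) auto
qed


section \<open>Dual spaces of seminormed carriers\<close>

text \<open>Homogeneity and sign of \<open>N\<close> are what bounds for functionals use. Instances
  can then be built from squared energies with a quasi-triangle inequality, without
  Minkowski.\<close>

locale seminormed_carrier =
  fixes V :: "'w::real_vector set" and N :: "'w \<Rightarrow> real"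
  assumes zero_mem: "0 \<in> V"
    and add_mem: "\<And>x y. x \<in> V \<Longrightarrow> y \<in> V \<Longrightarrow> x + y \<in> V"
    and scale_mem: "\<And>c x. x \<in> V \<Longrightarrow> c *\<^sub>R x \<in> V"
    and N_nonneg: "\<And>x. x \<in> V \<Longrightarrow> 0 \<le> N x"
    and N_scale: "\<And>c x. x \<in> V \<Longrightarrow> N (c *\<^sub>R x) = \<bar>c\<bar> * N x"
begin

lemma N_zero: "N 0 = 0"
  using N_scale[OF zero_mem, of 0] by simp

text \<open>Lets estimates be proved only for \<open>N x \<le> 1\<close>, where non-homogeneous
  inequalities such as \<open>abs_le_weighted_square\<close> are available; scaling restores the
  factor \<open>N x\<close>.\<close>

lemma homogeneous_bound:
  assumes hom: "\<And>c x. x \<in> V \<Longrightarrow> f (c *\<^sub>R x) = c * f x"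
    and bnd: "\<And>x. x \<in> V \<Longrightarrow> N x \<le> 1 \<Longrightarrow> \<bar>f x\<bar> \<le> B"
    and x: "x \<in> V"
  shows "\<bar>f x\<bar> \<le> B * N x"
proof (cases "N x = 0")
  case True
  have B: "0 \<le> B" using bnd[OF zero_mem] N_zero by fastforce
  have "f x = 0"
  proof (rule ccontr)
    assume "f x \<noteq> 0"
    \<comment> \<open>All multiples of a null vector stay in the unit ball; this one has the value
      \<open>B + 1\<close>, which is too large.\<close>
    then have "\<bar>f (((B + 1) / \<bar>f x\<bar>) *\<^sub>R x)\<bar> = B + 1"
      using B by (subst hom[OF x]) (simp add: abs_mult)
    moreover have "\<bar>f (((B + 1) / \<bar>f x\<bar>) *\<^sub>R x)\<bar> \<le> B"
      by (rule bnd[OF scale_mem[OF x]]) (simp add: N_scale[OF x] True)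
    ultimately show False by simp
  qed
  then show ?thesis using True by simp
next
  case False
  then have pos: "N x > 0" using N_nonneg[OF x] by simp
  have "\<bar>f ((1 / N x) *\<^sub>R x)\<bar> \<le> B"
    by (rule bnd[OF scale_mem[OF x]]) (use pos in \<open>simp add: N_scale[OF x]\<close>)
  then show ?thesis using pos by (subst (asm) hom[OF x]) (simp add: abs_mult field_simps)
qed

text \<open>The real-valued \<open>SUP\<close> in \<open>dual_norm\<close> carries information only
  for sets bounded above.\<close>

lemma dual_bdd:
  assumes "f \<in> dual_space V N"
  shows "bdd_above ((\<lambda>x. \<bar>f x\<bar>) ` {x \<in> V. N x \<le> 1})"
proof -
  obtain C where C: "\<forall>x\<in>V. \<bar>f x\<bar> \<le> C * N x"
    using assms by (auto simp: dual_space_def)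
  show ?thesis
  proof (rule bdd_aboveI2[where M = "\<bar>C\<bar>"])
    fix x assume x: "x \<in> {x \<in> V. N x \<le> 1}"
    then have "\<bar>f x\<bar> \<le> C * N x" using C by auto
    also have "\<dots> \<le> \<bar>C\<bar> * N x" using x N_nonneg by (intro mult_right_mono) auto
    also have "\<dots> \<le> \<bar>C\<bar>" using x N_nonneg by (simp add: mult_left_le)
    finally show "\<bar>f x\<bar> \<le> \<bar>C\<bar>" .
  qed
qed

lemma dual_norm_bound:
  assumes f: "f \<in> dual_space V N" and x: "x \<in> V"
  shows "\<bar>f x\<bar> \<le> dual_norm V N f * N x"
proof (rule homogeneous_bound[OF _ _ x])
  show "f (c *\<^sub>R x) = c * f x" if "x \<in> V" for c x
    using f that by (auto simp: dual_space_def)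
  show "\<bar>f x\<bar> \<le> dual_norm V N f" if "x \<in> V" "N x \<le> 1" for x
    unfolding dual_norm_def
    by (rule cSUP_upper[OF _ dual_bdd[OF f]]) (use that in auto)
qed

lemma dual_norm_le:
  assumes "\<And>x. x \<in> V \<Longrightarrow> \<bar>f x\<bar> \<le> B * N x" and "0 \<le> B"
  shows "dual_norm V N f \<le> B"
  unfolding dual_norm_def
proof (rule cSUP_least)
  show "{x \<in> V. N x \<le> 1} \<noteq> {}" using zero_mem N_zero by auto
  fix x assume "x \<in> {x \<in> V. N x \<le> 1}"
  then show "\<bar>f x\<bar> \<le> B"
    using assms(1)[of x] mult_left_mono[OF _ assms(2), of "N x" 1] by auto
qed

lemma dual_add:
  assumes "f \<in> dual_space V N" "g \<in> dual_space V N"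
  shows "f + g \<in> dual_space V N"
proof -
  obtain C where C: "\<forall>x\<in>V. \<bar>f x\<bar> \<le> C * N x"
    using assms by (auto simp: dual_space_def)
  obtain D where D: "\<forall>x\<in>V. \<bar>g x\<bar> \<le> D * N x"
    using assms by (auto simp: dual_space_def)
  have "\<forall>x\<in>V. \<bar>f x + g x\<bar> \<le> (C + D) * N x"
    using C D by (auto simp: algebra_simps intro!: order_trans[OF abs_triangle_ineq] add_mono)
  then have "\<exists>C. \<forall>x\<in>V. \<bar>f x + g x\<bar> \<le> C * N x" by blast
  then show ?thesis using assms by (auto simp: dual_space_def distrib_left)
qed

lemma dual_scale:
  assumes "f \<in> dual_space V N"
  shows "c *\<^sub>R f \<in> dual_space V N"
proof -
  obtain C where C: "\<forall>x\<in>V. \<bar>f x\<bar> \<le> C * N x"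
    using assms by (auto simp: dual_space_def)
  have "\<forall>x\<in>V. \<bar>c * f x\<bar> \<le> (\<bar>c\<bar> * C) * N x"
    using C by (auto simp: abs_mult mult.assoc intro!: mult_left_mono)
  then have "\<exists>C. \<forall>x\<in>V. \<bar>c * f x\<bar> \<le> C * N x" by blast
  then show ?thesis using assms by (auto simp: dual_space_def distrib_left)
qed

lemma dual_diff:
  assumes "f \<in> dual_space V N" "g \<in> dual_space V N"
  shows "f - g \<in> dual_space V N"
  using dual_add[OF assms(1) dual_scale[OF assms(2), of "-1"]] by simp

text \<open>Closeness in the dual norm implies closeness at the fixed vector \<open>u\<close>;
  tangent directions and closures of radial directions are tested in this way below.\<close>

lemma evaluation_bound_closure:
  assumes u: "u \<in> V" and A: "A \<subseteq> dual_space V N"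
    and f: "f \<in> norm_closure (dual_space V N) (dual_norm V N) A"
    and "e > 0"
  obtains a where "a \<in> A" "\<bar>f u - a u\<bar> < e"
proof -
  have fV: "f \<in> dual_space V N" using f by (simp add: norm_closure_def)
  \<comment> \<open>Adding 1 keeps the denominator positive when \<open>N u = 0\<close>.\<close>
  obtain a where a: "a \<in> A" "dual_norm V N (f - a) < e / (N u + 1)"
    using f \<open>e > 0\<close> N_nonneg[OF u] unfolding norm_closure_def
    by (auto simp: add_nonneg_pos dest!: spec[of _ "e / (N u + 1)"])
  have "\<bar>f u - a u\<bar> \<le> dual_norm V N (f - a) * N u"
    using dual_norm_bound[OF dual_diff[OF fV] u, of a] a A by auto
  also have "\<dots> \<le> e / (N u + 1) * N u"
    using a N_nonneg[OF u] by (intro mult_right_mono) auto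
  also have "\<dots> < e" using \<open>e > 0\<close> N_nonneg[OF u] by (simp add: field_simps)
  finally show ?thesis using that a by blast
qed

text \<open>The canonical embedding into the bidual, with bound \<open>N u\<close>; the conditional
  meets the convention that functionals vanish off their carrier.\<close>

lemma evaluation_dual:
  assumes u: "u \<in> V"
  shows "(\<lambda>f. if f \<in> dual_space V N then f u else 0)
    \<in> dual_space (dual_space V N) (dual_norm V N)"
  unfolding dual_space_def[of "dual_space V N"]
  using dual_add dual_scale dual_norm_bound[OF _ u]
  by (auto simp: mult.commute[of _ "N u"] intro!: exI[of _ "N u"])

end

section \<open>The unit ball of essentially bounded functions in a dual space\<close>

text \<open>A Gelfand-triple setting: \<open>V\<close> embeds into L2(M) with norm at most one, and
  bounded functions embed into the dual of \<open>V\<close> through the L2 pairing. The domain and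
  the boundary spaces are both instances.\<close>

locale pivot = seminormed_carrier V N + finite_measure M
  for V :: "('a \<Rightarrow> real) set" and N :: "('a \<Rightarrow> real) \<Rightarrow> real" and M :: "'a measure" +
  assumes measurable_carrier: "\<And>z. z \<in> V \<Longrightarrow> z \<in> borel_measurable M"
    and L2_le: "\<And>z. z \<in> V \<Longrightarrow> L2_sq M z \<le> ennreal ((N z)\<^sup>2)"
begin

abbreviation W :: "(('a \<Rightarrow> real) \<Rightarrow> real) set" where "W \<equiv> dual_space V N"
abbreviation dn :: "(('a \<Rightarrow> real) \<Rightarrow> real) \<Rightarrow> real" where "dn \<equiv> dual_norm V N"
abbreviation J :: "('a \<Rightarrow> real) \<Rightarrow> ('a \<Rightarrow> real) \<Rightarrow> real" where "J \<equiv> functional_of M V"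

section \<open>Bounded functions as functionals on the carrier\<close>

lemma L2_integrable:
  assumes "z \<in> V"
  shows "integrable M (\<lambda>x. (z x)\<^sup>2)" "(\<integral>x. (z x)\<^sup>2 \<partial>M) \<le> (N z)\<^sup>2"
proof -
  have m: "(\<lambda>x. (z x)\<^sup>2) \<in> borel_measurable M" using measurable_carrier[OF assms] by measurable
  have le: "(\<integral>\<^sup>+x. ennreal ((z x)\<^sup>2) \<partial>M) \<le> ennreal ((N z)\<^sup>2)"
    using L2_le[OF assms] by (simp add: L2_sq_def)
  then show i: "integrable M (\<lambda>x. (z x)\<^sup>2)"
    using m by (intro integrableI_nonneg) (auto simp: less_top[symmetric] top_unique)
  then show "(\<integral>x. (z x)\<^sup>2 \<partial>M) \<le> (N z)\<^sup>2"
    using le by (subst (asm) nn_integral_eq_integral) auto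
qed

lemma carrier_integrable:
  assumes "z \<in> V"
  shows "integrable M z"
proof (rule Bochner_Integration.integrable_bound)
  show "integrable M (\<lambda>x. ((z x)\<^sup>2 + 1) / 2)" using L2_integrable[OF assms] by simp
  show "z \<in> borel_measurable M" by (rule measurable_carrier[OF assms])
  show "AE x in M. norm (z x) \<le> norm (((z x)\<^sup>2 + 1) / 2)"
    using abs_le_weighted_square[of 1] by auto
qed

text \<open>Bounds the L1 norm on the unit ball of \<open>V\<close>: integrate
  \<open>|z| \<le> (z^2 + 1) / 2\<close>.\<close>

definition L1_const :: real where "L1_const = (1 + measure M (space M)) / 2"

lemma L1_const_pos: "0 < L1_const"
  by (simp add: L1_const_def add_pos_nonneg)

lemma bounded_mult_integrable:
  assumes v: "v \<in> borel_measurable M" and b: "AE x in M. \<bar>v x\<bar> \<le> B" and z: "z \<in> V"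
  shows "integrable M (\<lambda>x. v x * z x)"
proof (rule Bochner_Integration.integrable_bound)
  show "integrable M (\<lambda>x. B * \<bar>z x\<bar>)" using carrier_integrable[OF z] by auto
  show "(\<lambda>x. v x * z x) \<in> borel_measurable M" using v measurable_carrier[OF z] by measurable
  show "AE x in M. norm (v x * z x) \<le> norm (B * \<bar>z x\<bar>)"
    using b by eventually_elim (auto simp: abs_mult intro!: mult_right_mono)
qed

text \<open>On the unit ball the integrand is dominated by \<open>B * (z^2 + 1) / 2\<close>;
  \<open>homogeneous_bound\<close> extends the estimate to all of \<open>V\<close>.\<close>

lemma bounded_mult_le:
  assumes v: "v \<in> borel_measurable M" and b: "AE x in M. \<bar>v x\<bar> \<le> B" and B: "0 \<le> B" and z: "z \<in> V"
  shows "\<bar>\<integral>x. v x * z x \<partial>M\<bar> \<le> (B * L1_const) * N z"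
proof (rule homogeneous_bound[where f = "\<lambda>z. \<integral>x. v x * z x \<partial>M", OF _ _ z])
  show "(\<integral>x. v x * (c *\<^sub>R z) x \<partial>M) = c * (\<integral>x. v x * z x \<partial>M)" if "z \<in> V" for c z
    by (simp add: algebra_simps flip: integral_mult_right_zero)
  fix z assume z: "z \<in> V" "N z \<le> 1"
  have int: "integrable M (\<lambda>x. ((z x)\<^sup>2 + 1) / 2)" using L2_integrable[OF z(1)] by simp
  have "\<bar>\<integral>x. v x * z x \<partial>M\<bar> \<le> (\<integral>x. \<bar>v x * z x\<bar> \<partial>M)"
    by (rule integral_abs_bound)
  also have "\<dots> \<le> (\<integral>x. B * (((z x)\<^sup>2 + 1) / 2) \<partial>M)"
  proof (rule integral_mono_AE)
    show "integrable M (\<lambda>x. \<bar>v x * z x\<bar>)"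
      using bounded_mult_integrable[OF v b z(1)] by auto
    show "integrable M (\<lambda>x. B * (((z x)\<^sup>2 + 1) / 2))" using int by (rule integrable_mult_right)
    show "AE x in M. \<bar>v x * z x\<bar> \<le> B * (((z x)\<^sup>2 + 1) / 2)"
      using b
    proof eventually_elim
      fix x assume "\<bar>v x\<bar> \<le> B"
      then show "\<bar>v x * z x\<bar> \<le> B * (((z x)\<^sup>2 + 1) / 2)"
        using B abs_le_weighted_square[of 1 "z x"] unfolding abs_mult
        by (intro mult_mono) auto
    qed
  qed
  also have "\<dots> = B * (((\<integral>x. (z x)\<^sup>2 \<partial>M) + measure M (space M)) / 2)"
    using L2_integrable[OF z(1)] by simp
  also have "\<dots> \<le> B * L1_const"
  proof -
    have "(N z)\<^sup>2 \<le> 1" using z N_nonneg by (simp add: power_le_one)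
    then show ?thesis using L2_integrable(2)[OF z(1)] B unfolding L1_const_def
      by (intro mult_left_mono) auto
  qed
  finally show "\<bar>\<integral>x. v x * z x \<partial>M\<bar> \<le> B * L1_const" .
qed

lemma J_apply: "z \<in> V \<Longrightarrow> J v z = (\<integral>x. v x * z x \<partial>M)"
  by (simp add: functional_of_def)

lemma J_add:
  assumes "v \<in> L_infinity M" "w \<in> L_infinity M"
  shows "J (v + w) = J v + J w"
proof
  fix z
  show "J (v + w) z = (J v + J w) z"
    using assms bounded_mult_integrable
    by (auto simp: functional_of_def L_infinity_def algebra_simps)
qed

lemma J_scale: "J (c *\<^sub>R v) = c *\<^sub>R J v"
  by (auto simp: functional_of_def fun_eq_iff algebra_simps simp flip: integral_mult_right_zero)

lemma J_dual:
  assumes "v \<in> L_infinity M"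
  shows "J v \<in> W"
proof -
  obtain C where v: "v \<in> borel_measurable M" and C: "AE x in M. \<bar>v x\<bar> \<le> C"
    using assms by (auto simp: L_infinity_def)
  have C': "AE x in M. \<bar>v x\<bar> \<le> \<bar>C\<bar>" using C by eventually_elim auto
  have "\<forall>z\<in>V. \<bar>J v z\<bar> \<le> (\<bar>C\<bar> * L1_const) * N z"
    using bounded_mult_le[OF v C'] by (auto simp: J_apply)
  moreover have "\<forall>x\<in>V. \<forall>y\<in>V. J v (x + y) = J v x + J v y"
    using bounded_mult_integrable[OF v C] add_mem by (auto simp: J_apply algebra_simps)
  moreover have "\<forall>c. \<forall>x\<in>V. J v (c *\<^sub>R x) = c * J v x"
    using scale_mem by (auto simp: J_apply algebra_simps simp flip: integral_mult_right_zero)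
  ultimately show ?thesis by (auto simp: dual_space_def functional_of_def)
qed

section \<open>Convexity of the unit ball and its closedness in the dual norm\<close>

lemma bounded_by_one_iff:
  "v \<in> bounded_by_one M \<longleftrightarrow> v \<in> borel_measurable M \<and> (AE x in M. \<bar>v x\<bar> \<le> 1)"
  by (auto simp: bounded_by_one_def L_infinity_def abs_le_iff minus_le_iff conj_commute)

lemma bounded_by_one_AE: "v \<in> bounded_by_one M \<Longrightarrow> AE x in M. \<bar>v x\<bar> \<le> 1"
  by (simp add: bounded_by_one_iff)

lemma bounded_by_one_L_infinity: "v \<in> bounded_by_one M \<Longrightarrow> v \<in> L_infinity M"
  by (simp add: bounded_by_one_def)

lemma L_infinity_scale: "v \<in> L_infinity M \<Longrightarrow> c *\<^sub>R v \<in> L_infinity M"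
proof -
  assume "v \<in> L_infinity M"
  then obtain C where v: "v \<in> borel_measurable M" and C: "AE x in M. \<bar>v x\<bar> \<le> C"
    by (auto simp: L_infinity_def)
  have "AE x in M. \<bar>c * v x\<bar> \<le> \<bar>c\<bar> * C"
    using C by eventually_elim (auto simp: abs_mult intro: mult_left_mono)
  then show ?thesis using v by (auto simp: L_infinity_def scaleR_fun_def)
qed

lemma bounded_by_one_convex:
  assumes v: "v \<in> bounded_by_one M" and w: "w \<in> bounded_by_one M"
    and ab: "0 \<le> a" "0 \<le> b" "a + b = 1"
  shows "a *\<^sub>R v + b *\<^sub>R w \<in> bounded_by_one M"
proof -
  have "AE x in M. \<bar>a * v x + b * w x\<bar> \<le> 1"
    using bounded_by_one_AE[OF v] bounded_by_one_AE[OF w]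
  proof eventually_elim
    fix x assume "\<bar>v x\<bar> \<le> 1" "\<bar>w x\<bar> \<le> 1"
    then have "a * \<bar>v x\<bar> + b * \<bar>w x\<bar> \<le> a * 1 + b * 1"
      using ab by (intro add_mono mult_left_mono) auto
    then show "\<bar>a * v x + b * w x\<bar> \<le> 1"
      using ab abs_triangle_ineq[of "a * v x" "b * w x"] by (simp add: abs_mult)
  qed
  then show ?thesis using v w unfolding bounded_by_one_iff
    by (auto simp: plus_fun_def scaleR_fun_def)
qed

lemma convex_ball: "convex (J ` bounded_by_one M)"
  unfolding convex_def
proof (intro ballI allI impI)
  fix x y a b assume "x \<in> J ` bounded_by_one M" "y \<in> J ` bounded_by_one M"
    and ab: "0 \<le> a" "0 \<le> b" "a + b = (1::real)"
  then obtain v w where vw: "x = J v" "y = J w" "v \<in> bounded_by_one M" "w \<in> bounded_by_one M"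
    by auto
  then have "a *\<^sub>R x + b *\<^sub>R y = J (a *\<^sub>R v + b *\<^sub>R w)"
    by (simp add: J_add J_scale L_infinity_scale bounded_by_one_L_infinity)
  then show "a *\<^sub>R x + b *\<^sub>R y \<in> J ` bounded_by_one M"
    using bounded_by_one_convex[OF vw(3,4) ab] by blast
qed

lemma one_mem: "(\<lambda>_. 1) \<in> bounded_by_one M"
  by (simp add: bounded_by_one_iff)

lemma bounded_by_one_square:
  assumes v: "v \<in> bounded_by_one M"
  shows "integrable M (\<lambda>x. (v x)\<^sup>2)" "(\<integral>x. (v x)\<^sup>2 \<partial>M) \<le> measure M (space M)"
proof -
  have m: "v \<in> borel_measurable M" and le: "AE x in M. (v x)\<^sup>2 \<le> 1"
    using v by (auto simp: bounded_by_one_iff abs_square_le_1)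
  show i: "integrable M (\<lambda>x. (v x)\<^sup>2)"
    by (rule integrable_const_bound[where B = 1]) (use m le in auto)
  have "(\<integral>x. (v x)\<^sup>2 \<partial>M) \<le> (\<integral>x. 1 \<partial>M)"
    by (rule integral_mono_AE) (use i le in auto)
  then show "(\<integral>x. (v x)\<^sup>2 \<partial>M) \<le> measure M (space M)" by simp
qed

text \<open>Minimising the \<open>L\<^sup>2\<close>-norm over shrinking convex sets produces an \<open>L\<^sup>2\<close>-Cauchy sequence by the
  parallelogram identity; this replaces weak compactness.\<close>

lemma minimising_sequence_cauchy:
  fixes K :: "nat \<Rightarrow> ('a \<Rightarrow> real) set"
  assumes K: "\<And>n. K n \<subseteq> bounded_by_one M" "\<And>n. K n \<noteq> {}" "decseq K"
    and mid: "\<And>n v w. v \<in> K n \<Longrightarrow> w \<in> K n \<Longrightarrow> (1/2) *\<^sub>R v + (1/2) *\<^sub>R w \<in> K n"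
  obtains y e where "\<And>n. y n \<in> K n" "e \<longlonglongrightarrow> 0"
    "\<And>n m. n \<le> m \<Longrightarrow> (\<integral>x. (y n x - y m x)\<^sup>2 \<partial>M) \<le> e n"
proof -
  define q where "q v = (\<integral>x. (v x)\<^sup>2 \<partial>M)" for v :: "'a \<Rightarrow> real"
  define r where "r n = (INF v\<in>K n. q v)" for n
  have qnn: "0 \<le> q v" for v by (simp add: q_def)
  have bdd: "bdd_below (q ` K n)" for n by (rule bdd_belowI2[of _ 0]) (rule qnn)
  have r_le: "r n \<le> q v" if "v \<in> K n" for n v
    unfolding r_def by (rule cINF_lower[OF bdd that])
  have "\<exists>v\<in>K n. q v < r n + 1 / real (Suc n)" for n
    using cInf_lessD[of "q ` K n" "r n + 1 / real (Suc n)"] K(2)[of n] by (auto simp: r_def)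
  then obtain y where y: "\<And>n. y n \<in> K n" "\<And>n. q (y n) < r n + 1 / real (Suc n)" by metis
  have mono: "incseq r"
    unfolding incseq_def r_def
    by (intro allI impI cINF_superset_mono[OF K(2) bdd]) (use K(3) in \<open>auto simp: decseq_def\<close>)
  have r_bd: "r n \<le> measure M (space M)" for n
  proof -
    have "y n \<in> bounded_by_one M" using K(1) y(1) by blast
    then show ?thesis using r_le[OF y(1)[of n]] bounded_by_one_square(2)[of "y n"] by (simp add: q_def)
  qed
  obtain R where R: "r \<longlonglongrightarrow> R" "\<And>n. r n \<le> R"
    using incseq_convergent[OF mono, of "measure M (space M)"] r_bd by blast
  \<comment> \<open>The parallelogram identity gives
    \<open>2 * q (y n) + 2 * q (y m) - 4 * q c\<close>. Near-minimality bounds the first two values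
    of \<open>q\<close> by \<open>r n\<close> and \<open>R\<close> up to \<open>1 / Suc n\<close>,
    and the midpoint \<open>c\<close> has \<open>q c \<ge> r n\<close>.\<close>
  define e where "e n = 2 * (R - r n) + 4 / real (Suc n)" for n
  have "e \<longlonglongrightarrow> 2 * (R - R) + 0"
    unfolding e_def using LIMSEQ_Suc[OF lim_const_over_n[of 4]]
    by (intro tendsto_intros R) simp
  then have e0: "e \<longlonglongrightarrow> 0" by simp
  have "(\<integral>x. (y n x - y m x)\<^sup>2 \<partial>M) \<le> e n" if nm: "n \<le> m" for n m
  proof -
    \<comment> \<open>Monotonicity puts \<open>y m\<close> into the earlier set, so the midpoint
      competes in the infimum \<open>r n\<close>.\<close>
    have ym: "y m \<in> K n" using y(1)[of m] K(3) nm by (auto simp: decseq_def)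
    define c where "c = (1/2) *\<^sub>R y n + (1/2) *\<^sub>R y m"
    have c: "c \<in> K n" unfolding c_def by (rule mid[OF y(1) ym])
    have i: "integrable M (\<lambda>x. (v x)\<^sup>2)" if "v \<in> K n" for v
      using bounded_by_one_square(1) K(1) that by blast
    have "(\<integral>x. (y n x - y m x)\<^sup>2 \<partial>M)
        = (\<integral>x. 2 * (y n x)\<^sup>2 + 2 * (y m x)\<^sup>2 - 4 * (c x)\<^sup>2 \<partial>M)"
      by (rule Bochner_Integration.integral_cong[OF refl])
        (simp add: c_def power2_eq_square field_simps)
    also have "\<dots> = 2 * q (y n) + 2 * q (y m) - 4 * q c"
      using i[OF y(1)] i[OF ym] i[OF c] by (simp add: q_def)
    also have "\<dots> \<le> 2 * (r n + 1 / real (Suc n)) + 2 * (R + 1 / real (Suc n)) - 4 * r n"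
    proof -
      have "1 / real (Suc m) \<le> 1 / real (Suc n)" using nm by (intro divide_left_mono) auto
      moreover have "2 * a + 2 * b - 4 * d \<le> 2 * (r n + t) + 2 * (R + t) - 4 * r n"
        if "a < r n + t" "b < r m + t'" "t' \<le> t" "r n \<le> d" "r m \<le> R" for a b d t t'
        using that by argo
      ultimately show ?thesis using y(2) r_le[OF c] R(2) by blast
    qed
    also have "\<dots> = e n" by (simp add: e_def algebra_simps)
    finally show ?thesis .
  qed
  then show ?thesis using that[OF y(1) e0] by blast
qed

text \<open>Along a subsequence whose squared gaps have integral at most \<open>4 ^ -j\<close>, the
  L1 gaps are of order \<open>2 ^ -j\<close>. The sum of all gaps has finite integral, hence is
  finite almost everywhere, and there the telescoping series converges.\<close>

lemma cauchy_AE_limit: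
  assumes y: "\<And>n. y n \<in> bounded_by_one M" and e: "e \<longlonglongrightarrow> (0::real)"
    and c: "\<And>n m. n \<le> m \<Longrightarrow> (\<integral>x. (y n x - y m x)\<^sup>2 \<partial>M) \<le> e n"
  obtains k v where "strict_mono k" "v \<in> bounded_by_one M"
    "AE x in M. (\<lambda>n. y (k n :: nat) x) \<longlonglongrightarrow> v x"
proof -
  have "\<exists>N0. \<forall>n\<ge>N0. e n < (1/4) ^ j" for j :: nat
    using order_tendstoD(2)[OF e, of "(1/4) ^ j"] by (simp add: eventually_sequentially)
  then obtain N0 where N0: "\<And>j n. N0 j \<le> n \<Longrightarrow> e n < (1/4) ^ j" by metis
  \<comment> \<open>The threshold \<open>N0\<close> secures accuracy \<open>4 ^ -j\<close>; the
    \<open>max\<close> with \<open>Suc kj\<close> makes the subsequence strictly increasing.\<close>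
  define k where "k = rec_nat (N0 0) (\<lambda>j kj. max (Suc kj) (N0 (Suc j)))"
  have k0: "k 0 = N0 0" and kS: "k (Suc j) = max (Suc (k j)) (N0 (Suc j))" for j
    by (simp_all add: k_def)
  have sm: "strict_mono k" by (rule strict_mono_Suc_iff[THEN iffD2]) (auto simp: kS)
  have kN: "N0 j \<le> k j" for j by (cases j) (auto simp: k0 kS)
  have ym: "y n \<in> borel_measurable M" for n using y by (simp add: bounded_by_one_iff)
  define d where "d j x = \<bar>y (k (Suc j)) x - y (k j) x\<bar>" for j x
  have dm: "d j \<in> borel_measurable M" for j unfolding d_def using ym by measurable
  have dint: "(\<integral>\<^sup>+x. ennreal (d j x) \<partial>M) \<le> ennreal ((1/2) ^ j * L1_const)" for j
  proof -
    have AE1: "AE x in M. (y (k j) x - y (k (Suc j)) x)\<^sup>2 \<le> 4"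
      using bounded_by_one_AE[OF y[of "k j"]] bounded_by_one_AE[OF y[of "k (Suc j)"]]
    proof eventually_elim
      fix x assume "\<bar>y (k j) x\<bar> \<le> 1" "\<bar>y (k (Suc j)) x\<bar> \<le> 1"
      then have "\<bar>y (k j) x - y (k (Suc j)) x\<bar> \<le> 2" by linarith
      then have "\<bar>y (k j) x - y (k (Suc j)) x\<bar>\<^sup>2 \<le> 2\<^sup>2" by (intro power_mono) auto
      then show "(y (k j) x - y (k (Suc j)) x)\<^sup>2 \<le> 4" by simp
    qed
    have i: "integrable M (\<lambda>x. (y (k j) x - y (k (Suc j)) x)\<^sup>2)"
      by (rule integrable_const_bound[where B = 4]) (use AE1 ym in auto)
    \<comment> \<open>The weight \<open>2 ^ j\<close> balances a squared gap of
      \<open>4 ^ -j\<close> against the constant \<open>2 ^ -j\<close>.\<close>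
    have "(\<integral>\<^sup>+x. ennreal (d j x) \<partial>M)
        \<le> (\<integral>\<^sup>+x. ennreal ((2 ^ j * (y (k j) x - y (k (Suc j)) x)\<^sup>2 + (1/2) ^ j) / 2) \<partial>M)"
      using abs_le_weighted_square[of "2 ^ j"]
      by (intro nn_integral_mono ennreal_leI)
        (auto simp: d_def power_one_over abs_minus_commute power2_commute)
    also have "\<dots> = ennreal (\<integral>x. (2 ^ j * (y (k j) x - y (k (Suc j)) x)\<^sup>2 + (1/2) ^ j) / 2 \<partial>M)"
      using i by (intro nn_integral_eq_integral) auto
    also have "(\<integral>x. (2 ^ j * (y (k j) x - y (k (Suc j)) x)\<^sup>2 + (1/2) ^ j) / 2 \<partial>M)
        = (2 ^ j * (\<integral>x. (y (k j) x - y (k (Suc j)) x)\<^sup>2 \<partial>M) + (1/2) ^ j * measure M (space M)) / 2"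
      using i by simp
    also have "\<dots> \<le> (2 ^ j * (1/4) ^ j + (1/2) ^ j * measure M (space M)) / 2"
    proof -
      have "(\<integral>x. (y (k j) x - y (k (Suc j)) x)\<^sup>2 \<partial>M) \<le> e (k j)"
        by (rule c) (use sm in \<open>simp add: strict_mono_less_eq\<close>)
      also have "\<dots> \<le> (1/4) ^ j" using N0[OF kN] by (rule less_imp_le)
      finally show ?thesis by (intro divide_right_mono add_right_mono mult_left_mono) auto
    qed
    also have "\<dots> = (1/2) ^ j * L1_const"
      by (simp add: L1_const_def algebra_simps flip: power_mult_distrib)
    finally show ?thesis by (simp add: ennreal_leI)
  qed
  have "(\<integral>\<^sup>+x. (\<Sum>j. ennreal (d j x)) \<partial>M) = (\<Sum>j. \<integral>\<^sup>+x. ennreal (d j x) \<partial>M)"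
    by (rule nn_integral_suminf) (use dm in measurable)
  also have "\<dots> \<le> (\<Sum>j. ennreal ((1/2) ^ j * L1_const))"
    by (intro suminf_le dint) auto
  also have "\<dots> = ennreal (\<Sum>j. (1/2) ^ j * L1_const)"
    using L1_const_pos by (intro suminf_ennreal2) (auto intro!: summable_mult2 summable_geometric)
  also have "\<dots> < \<infinity>" by simp
  finally have "(\<integral>\<^sup>+x. (\<Sum>j. ennreal (d j x)) \<partial>M) \<noteq> \<infinity>" by simp
  then have "AE x in M. (\<Sum>j. ennreal (d j x)) \<noteq> \<infinity>"
    using dm by (intro nn_integral_PInf_AE) auto
  then have conv: "AE x in M. convergent (\<lambda>n. y (k n) x)"
  proof eventually_elim
    fix x assume "(\<Sum>j. ennreal (d j x)) \<noteq> \<infinity>"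
    then have top: "(\<Sum>j. ennreal (d j x)) \<noteq> top" by (simp only: infinity_ennreal_def not_False_eq_True)
    have "summable (\<lambda>j. d j x)"
      by (rule summable_suminf_not_top[OF _ top]) (simp add: d_def)
    then have "summable (\<lambda>j. y (k (Suc j)) x - y (k j) x)"
      unfolding d_def by (rule summable_rabs_cancel)
    then have "convergent (\<lambda>n. \<Sum>j<n. y (k (Suc j)) x - y (k j) x)"
      by (simp add: summable_iff_convergent)
    then have "convergent (\<lambda>n. y (k n) x - y (k 0) x)" 
      by (simp add: sum_lessThan_telescope[of "\<lambda>j. y (k j) x"])
    then have "convergent (\<lambda>n. y (k n) x - y (k 0) x + y (k 0) x)"
      by (intro convergent_add convergent_const)
    then show "convergent (\<lambda>n. y (k n) x)" by simp
  qed
  define v where "v x = lim (\<lambda>n. y (k n) x)" for x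
  have lim: "AE x in M. (\<lambda>n. y (k n) x) \<longlonglongrightarrow> v x"
    using conv by eventually_elim (simp add: v_def convergent_LIMSEQ_iff)
  have vm: "v \<in> borel_measurable M"
    unfolding v_def using ym by measurable
  have "AE x in M. \<forall>n. \<bar>y (k n) x\<bar> \<le> 1"
    using y by (subst AE_all_countable) (auto simp: bounded_by_one_iff)
  with lim have "AE x in M. \<bar>v x\<bar> \<le> 1"
  proof eventually_elim
    fix x assume *: "(\<lambda>n. y (k n) x) \<longlonglongrightarrow> v x" "\<forall>n. \<bar>y (k n) x\<bar> \<le> 1"
    show "\<bar>v x\<bar> \<le> 1" by (rule LIMSEQ_le_const2[OF tendsto_rabs[OF *(1)]]) (use * in auto)
  qed
  then show ?thesis using that[OF sm _ lim] vm by (simp add: bounded_by_one_iff)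
qed

text \<open>The members of the unit ball whose functionals are \<open>1 / Suc n\<close>-close to
  \<open>f\<close> form decreasing, nonempty sets closed under midpoints. An L2-Cauchy choice from
  them has an almost everywhere limit along a subsequence, and dominated convergence with majorant
  \<open>|z|\<close> identifies its functional with \<open>f\<close>.\<close>

lemma closed_ball: "norm_closure W dn (J ` bounded_by_one M) = J ` bounded_by_one M"
proof
  show "J ` bounded_by_one M \<subseteq> norm_closure W dn (J ` bounded_by_one M)"
  proof
    fix f assume f: "f \<in> J ` bounded_by_one M"
    have "dn (f - f) \<le> 0" by (rule dual_norm_le) auto
    then show "f \<in> norm_closure W dn (J ` bounded_by_one M)"
      using f J_dual bounded_by_one_L_infinity unfolding norm_closure_def by force
  qed
  show "norm_closure W dn (J ` bounded_by_one M) \<subseteq> J ` bounded_by_one M"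
  proof
    fix f assume f: "f \<in> norm_closure W dn (J ` bounded_by_one M)"
    then have fW: "f \<in> W" by (simp add: norm_closure_def)
    \<comment> \<open>Accuracy is stated at each \<open>z\<close> relative to \<open>N z\<close>;
      this is the dual-norm distance without its supremum, and stability under midpoints is then
      immediate.\<close>
    define K where "K n = {v \<in> bounded_by_one M.
      \<forall>z\<in>V. \<bar>(\<integral>x. v x * z x \<partial>M) - f z\<bar> \<le> N z / real (Suc n)}" for n
    have int: "integrable M (\<lambda>x. v x * z x)" if "v \<in> bounded_by_one M" "z \<in> V" for v z
      using that bounded_mult_integrable by (auto simp: bounded_by_one_iff)
    have K2: "K n \<noteq> {}" for n
    proof -
      obtain v where v: "v \<in> bounded_by_one M" "dn (f - J v) < 1 / real (Suc n)"
        using f unfolding norm_closure_def by (auto dest!: spec[of _ "1 / real (Suc n)"])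
      have "v \<in> K n" unfolding K_def
      proof (intro CollectI conjI ballI v(1))
        fix z assume z: "z \<in> V"
        have "\<bar>(f - J v) z\<bar> \<le> dn (f - J v) * N z"
          by (rule dual_norm_bound[OF dual_diff[OF fW J_dual] z])
            (rule bounded_by_one_L_infinity[OF v(1)])
        also have "\<dots> \<le> 1 / real (Suc n) * N z"
          using v(2) N_nonneg[OF z] by (intro mult_right_mono) auto
        finally show "\<bar>(\<integral>x. v x * z x \<partial>M) - f z\<bar> \<le> N z / real (Suc n)"
          using z by (simp add: J_apply abs_minus_commute)
      qed
      then show ?thesis by auto
    qed
    have K3: "decseq K"
      unfolding decseq_def K_def
    proof (intro allI impI subsetI CollectI conjI ballI)
      fix m n :: nat and v z assume mn: "m \<le> n" and z: "z \<in> V"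
        and v: "v \<in> {v \<in> bounded_by_one M.
          \<forall>z\<in>V. \<bar>(\<integral>x. v x * z x \<partial>M) - f z\<bar> \<le> N z / real (Suc n)}"
      then have "\<bar>(\<integral>x. v x * z x \<partial>M) - f z\<bar> \<le> N z / real (Suc n)" by auto
      also have "\<dots> \<le> N z / real (Suc m)"
        using mn N_nonneg[OF z] by (intro divide_left_mono) auto
      finally show "\<bar>(\<integral>x. v x * z x \<partial>M) - f z\<bar> \<le> N z / real (Suc m)" .
    qed auto
    have mid: "(1/2) *\<^sub>R v + (1/2) *\<^sub>R w \<in> K n" if vw: "v \<in> K n" "w \<in> K n" for n v w
      unfolding K_def
    proof (intro CollectI conjI ballI)
      show "(1/2) *\<^sub>R v + (1/2) *\<^sub>R w \<in> bounded_by_one M"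
        using vw by (intro bounded_by_one_convex) (auto simp: K_def)
      fix z assume z: "z \<in> V"
      have "(\<integral>x. ((1/2) *\<^sub>R v + (1/2) *\<^sub>R w) x * z x \<partial>M)
          = (\<integral>x. (v x * z x + w x * z x) / 2 \<partial>M)"
        by (rule Bochner_Integration.integral_cong) (auto simp: field_simps)
      also have "\<dots> = ((\<integral>x. v x * z x \<partial>M) + (\<integral>x. w x * z x \<partial>M)) / 2"
        using int vw z by (simp add: K_def)
      finally have *: "(\<integral>x. ((1/2) *\<^sub>R v + (1/2) *\<^sub>R w) x * z x \<partial>M) - f z
        = (((\<integral>x. v x * z x \<partial>M) - f z) + ((\<integral>x. w x * z x \<partial>M) - f z)) / 2" by (simp add: field_simps)
      have "\<bar>(\<integral>x. v x * z x \<partial>M) - f z\<bar> \<le> N z / real (Suc n)"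
        "\<bar>(\<integral>x. w x * z x \<partial>M) - f z\<bar> \<le> N z / real (Suc n)"
        using vw z by (auto simp: K_def)
      moreover have "\<bar>(a + b) / 2\<bar> \<le> t" if "\<bar>a\<bar> \<le> t" "\<bar>b\<bar> \<le> t" for a b t :: real
        using that by argo
      ultimately show "\<bar>(\<integral>x. ((1/2) *\<^sub>R v + (1/2) *\<^sub>R w) x * z x \<partial>M) - f z\<bar> \<le> N z / real (Suc n)"
        unfolding * by blast
    qed
    obtain y e where ye: "\<And>n. y n \<in> K n" "e \<longlonglongrightarrow> 0"
      "\<And>n m. n \<le> m \<Longrightarrow> (\<integral>x. (y n x - y m x)\<^sup>2 \<partial>M) \<le> e n"
      by (rule minimising_sequence_cauchy[of K, OF _ K2 K3 mid]) (auto simp: K_def)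
    have yb: "y n \<in> bounded_by_one M" for n using ye(1)[of n] by (simp add: K_def)
    obtain k v where k: "strict_mono k" and v: "v \<in> bounded_by_one M"
      and lim: "AE x in M. (\<lambda>n. y (k n :: nat) x) \<longlonglongrightarrow> v x"
      by (rule cauchy_AE_limit[OF yb ye(2,3)])
    have "f = J v"
    proof
      fix z
      show "f z = J v z"
      proof (cases "z \<in> V")
        case True
        have "(\<lambda>n. \<integral>x. y (k n) x * z x \<partial>M) \<longlonglongrightarrow> (\<integral>x. v x * z x \<partial>M)"
        proof (rule integral_dominated_convergence[where w = "\<lambda>x. \<bar>z x\<bar>"])
          show "(\<lambda>x. v x * z x) \<in> borel_measurable M"
            using v measurable_carrier[OF True] by (auto simp: bounded_by_one_iff)
          show "(\<lambda>x. y (k n) x * z x) \<in> borel_measurable M" for n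
            using yb[of "k n"] measurable_carrier[OF True] by (auto simp: bounded_by_one_iff)
          show "integrable M (\<lambda>x. \<bar>z x\<bar>)" using carrier_integrable[OF True] by auto
          show "AE x in M. (\<lambda>n. y (k n) x * z x) \<longlonglongrightarrow> v x * z x"
            using lim by eventually_elim (intro tendsto_intros)
          show "AE x in M. norm (y (k n) x * z x) \<le> \<bar>z x\<bar>" for n
            using bounded_by_one_AE[OF yb[of "k n"]]
            by eventually_elim (auto simp: abs_mult mult_left_le_one_le)
        qed
        moreover have "(\<lambda>n. \<integral>x. y (k n) x * z x \<partial>M) \<longlonglongrightarrow> f z"
        proof (rule LIM_zero_cancel, rule Lim_null_comparison)
          show "\<forall>\<^sub>F n in sequentially. norm ((\<integral>x. y (k n) x * z x \<partial>M) - f z) \<le> N z / real (Suc n)"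
          proof (rule always_eventually, rule allI)
            fix n
            have "norm ((\<integral>x. y (k n) x * z x \<partial>M) - f z) \<le> N z / real (Suc (k n))"
              using ye(1)[of "k n"] True by (auto simp: K_def)
            also have "\<dots> \<le> N z / real (Suc n)"
              using seq_suble[OF k, of n] N_nonneg[OF True] by (intro divide_left_mono) auto
            finally show "norm ((\<integral>x. y (k n) x * z x \<partial>M) - f z) \<le> N z / real (Suc n)" .
          qed
          show "(\<lambda>n. N z / real (Suc n)) \<longlonglongrightarrow> 0" by (rule LIMSEQ_Suc[OF lim_const_over_n])
        qed
        ultimately show ?thesis using True LIMSEQ_unique by (auto simp: J_apply)
      next
        case False
        then show ?thesis using fW by (simp add: dual_space_def functional_of_def)
      qed
    qed
    then show "f \<in> J ` bounded_by_one M" using v by blast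
  qed
qed

text \<open>Polyhedricity is violated at \<open>w = 1\<close> with respect to the evaluation at a function \<open>u > 0\<close>:
  the only radial direction in the kernel is \<open>0\<close>, while the limit of \<open>- g n\<close>
  is a nonzero tangent direction in the kernel.\<close>

theorem non_polyhedric_criterion:
  assumes u: "u \<in> V" "AE x in M. u x > 0"
    and g: "\<And>n. g n \<in> borel_measurable M" "\<And>n x. 0 \<le> g n x" "\<And>n x. g n x \<le> B n"
    and cauchy: "\<And>n z. z \<in> V \<Longrightarrow>
      \<bar>(\<integral>x. g (Suc n) x * z x \<partial>M) - (\<integral>x. g n x * z x \<partial>M)\<bar> \<le> (1/2) ^ n * N z"
    and gu: "(\<lambda>n. \<integral>x. g n x * u x \<partial>M) \<longlonglongrightarrow> 0"
    and p: "p \<in> V" "c > 0" "\<And>n. c \<le> (\<integral>x. g n x * p x \<partial>M)"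
  shows "non_polyhedric W dn (J ` bounded_by_one M)"
proof -
  let ?K = "J ` bounded_by_one M" and ?w = "J (\<lambda>_. 1)"
  let ?\<eta> = "\<lambda>f. if f \<in> W then f u else 0"
  have B: "0 \<le> B n" for n using g(2)[of n undefined] g(3)[of n undefined] by linarith
  have gL: "g n \<in> L_infinity M" for n
    using g(1-3)[of n] by (auto simp: L_infinity_def intro!: exI[of _ "B n"])
  have uint: "integrable M (\<lambda>x. v x * u x)" if "v \<in> L_infinity M" for v
    using that bounded_mult_integrable u(1) by (auto simp: L_infinity_def)
  \<comment> \<open>The limit functional is built pointwise; \<open>rate\<close> below shows that
    the convergence is in the dual norm.\<close>
  define h where "h z = (if z \<in> V then lim (\<lambda>n. \<integral>x. g n x * z x \<partial>M) else 0)" for z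
  have conv: "(\<lambda>n. J (g n) z) \<longlonglongrightarrow> h z"
    and rate: "\<bar>h z - J (g n) z\<bar> \<le> (2 * (1/2) ^ n) * N z" if z: "z \<in> V" for z n
  proof -
    have bd: "\<bar>J (g (Suc n)) z - J (g n) z\<bar> \<le> (1/2) ^ n * N z" for n
      using cauchy[OF z] by (simp add: J_apply z)
    have sm: "summable (\<lambda>n. (1/2) ^ n * N z)"
      by (intro summable_mult2 summable_geometric) auto
    have "summable (\<lambda>n. J (g (Suc n)) z - J (g n) z)"
      by (rule summable_rabs_comparison_test[THEN summable_rabs_cancel, OF _ sm]) (use bd in auto)
    then have "convergent (\<lambda>n. \<Sum>j<n. J (g (Suc j)) z - J (g j) z)"
      by (simp add: summable_iff_convergent)
    then have "convergent (\<lambda>n. J (g n) z - J (g 0) z)"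
      using sum_lessThan_telescope[of "\<lambda>j. J (g j) z"] by simp
    then have "convergent (\<lambda>n. J (g n) z - J (g 0) z + J (g 0) z)"
      by (intro convergent_add convergent_const)
    then show lim: "(\<lambda>n. J (g n) z) \<longlonglongrightarrow> h z"
      using z by (simp add: h_def J_apply convergent_LIMSEQ_iff)
    \<comment> \<open>The partial geometric sum is kept in closed form, so that the induction is
      exact.\<close>
    have part: "\<bar>J (g (n + m)) z - J (g n) z\<bar> \<le> (2 * (1/2) ^ n - 2 * (1/2) ^ (n + m)) * N z" for m
    proof (induction m)
      case (Suc m)
      have "\<bar>J (g (n + Suc m)) z - J (g n) z\<bar>
          \<le> \<bar>J (g (n + m)) z - J (g n) z\<bar> + \<bar>J (g (Suc (n + m))) z - J (g (n + m)) z\<bar>" by simp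
      also have "\<dots> \<le> (2 * (1/2) ^ n - 2 * (1/2) ^ (n + m)) * N z + (1/2) ^ (n + m) * N z"
        using Suc bd by (intro add_mono) auto
      also have "\<dots> = (2 * (1/2) ^ n - 2 * (1/2) ^ (n + Suc m)) * N z"
        by (simp add: algebra_simps)
      finally show ?case .
    qed simp
    have lim': "(\<lambda>m. \<bar>J (g (n + m)) z - J (g n) z\<bar>) \<longlonglongrightarrow> \<bar>h z - J (g n) z\<bar>"
      using LIMSEQ_ignore_initial_segment[OF lim, of n]
      by (intro tendsto_intros) (simp add: add.commute)
    show "\<bar>h z - J (g n) z\<bar> \<le> (2 * (1/2) ^ n) * N z"
    proof (rule LIMSEQ_le_const2[OF lim'], intro exI allI impI)
      fix m
      have "(2 * (1/2) ^ n - 2 * (1/2) ^ (n + m)) * N z \<le> (2 * (1/2) ^ n) * N z"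
        using N_nonneg[OF z] by (intro mult_right_mono) auto
      then show "\<bar>J (g (n + m)) z - J (g n) z\<bar> \<le> (2 * (1/2) ^ n) * N z" using part[of m] by linarith
    qed
  qed
  have JW: "J (g n) \<in> W" for n by (rule J_dual[OF gL])
  have hW: "h \<in> W"
  proof -
    obtain C where C: "\<forall>x\<in>V. \<bar>J (g 0) x\<bar> \<le> C * N x" using JW[of 0] by (auto simp: dual_space_def)
    have "\<forall>z\<in>V. \<bar>h z\<bar> \<le> (2 + C) * N z"
      using rate[of _ 0] C by (fastforce simp: algebra_simps)
    moreover have "h (x + y) = h x + h y" if "x \<in> V" "y \<in> V" for x y
    proof (rule LIMSEQ_unique[OF conv])
      show "x + y \<in> V" using that by (rule add_mem)
      have "J (g n) (x + y) = J (g n) x + J (g n) y" for n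
        using JW[of n] that by (simp add: dual_space_def)
      then show "(\<lambda>n. J (g n) (x + y)) \<longlonglongrightarrow> h x + h y"
        using tendsto_add[OF conv[OF that(1)] conv[OF that(2)]] by simp
    qed
    moreover have "h (a *\<^sub>R x) = a * h x" if "x \<in> V" for a x
    proof (rule LIMSEQ_unique[OF conv])
      show "a *\<^sub>R x \<in> V" using that by (rule scale_mem)
      have "J (g n) (a *\<^sub>R x) = a * J (g n) x" for n
        using JW[of n] that by (simp add: dual_space_def)
      then show "(\<lambda>n. J (g n) (a *\<^sub>R x)) \<longlonglongrightarrow> a * h x"
        using tendsto_mult_left[OF conv[OF that(1)]] by simp
    qed
    ultimately show ?thesis by (auto simp: dual_space_def h_def)
  qed
  have radW: "radial_cone ?K ?w \<subseteq> W"
    unfolding radial_cone_def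
    using J_dual one_mem bounded_by_one_L_infinity by (auto intro!: dual_scale dual_diff)
  have rad_form: "\<exists>a v. r = a *\<^sub>R (J v - ?w) \<and> a > 0 \<and> v \<in> bounded_by_one M"
    if "r \<in> radial_cone ?K ?w" for r using that by (auto simp: radial_cone_def)
  have one_int: "integrable M (\<lambda>x. (1 - v x) * u x)" and one_nn: "AE x in M. 0 \<le> (1 - v x) * u x"
    if "v \<in> bounded_by_one M" for v
  proof -
    have "integrable M (\<lambda>x. u x - v x * u x)"
      using uint[OF bounded_by_one_L_infinity[OF that]] carrier_integrable[OF u(1)] by simp
    then show "integrable M (\<lambda>x. (1 - v x) * u x)" by (simp add: algebra_simps)
    have "AE x in M. \<bar>v x\<bar> \<le> 1" using that by (simp add: bounded_by_one_iff)
    with u(2) show "AE x in M. 0 \<le> (1 - v x) * u x" by eventually_elim auto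
  qed
  have rad_u: "(a *\<^sub>R (J v - ?w)) u = - a * (\<integral>x. (1 - v x) * u x \<partial>M)"
    if v: "v \<in> bounded_by_one M" for a v
  proof -
    have "(\<integral>x. (1 - v x) * u x \<partial>M) = (\<integral>x. u x - v x * u x \<partial>M)"
      by (simp add: algebra_simps)
    also have "\<dots> = (\<integral>x. u x \<partial>M) - (\<integral>x. v x * u x \<partial>M)"
      using uint[OF bounded_by_one_L_infinity[OF v]] carrier_integrable[OF u(1)] by simp
    finally have "(\<integral>x. (1 - v x) * u x \<partial>M) = J (\<lambda>_. 1) u - J v u" using u(1) by (simp add: J_apply)
    moreover have "(a *\<^sub>R (J v - ?w)) u = - a * (J (\<lambda>_. 1) u - J v u)"
      by (simp add: right_diff_distrib)
    ultimately show ?thesis by simp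
  qed
  \<comment> \<open>On radial directions the value is \<open>- a\<close> times the integral of
    \<open>(1 - v) * u\<close>, hence nonpositive; approximation at \<open>u\<close> carries the
    sign to the closure.\<close>
  have \<eta>: "?\<eta> \<in> normal_cone W dn ?K ?w"
    unfolding normal_cone_def
  proof (intro CollectI conjI ballI)
    show "?\<eta> \<in> dual_space W dn" by (rule evaluation_dual[OF u(1)])
    fix f assume f: "f \<in> tangent_cone W dn ?K ?w"
    have "f u \<le> 0"
    proof (rule field_le_epsilon)
      fix e :: real assume "e > 0"
      then obtain r where r: "r \<in> radial_cone ?K ?w" "\<bar>f u - r u\<bar> < e"
        using evaluation_bound_closure[OF u(1) radW] f unfolding tangent_cone_def by metis
      obtain a v where "r = a *\<^sub>R (J v - ?w)" "a > 0" and v: "v \<in> bounded_by_one M"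
        using rad_form[OF r(1)] by blast
      then have "r u \<le> 0"
        using rad_u[OF v, of a] integral_nonneg_AE[OF one_nn[OF v]] by (simp add: mult_nonneg_nonneg)
      then show "f u \<le> 0 + e" using r(2) by linarith
    qed
    then show "?\<eta> f \<le> 0" by simp
  qed
  have mh: "- h \<in> W" using dual_scale[OF hW, of "-1"] by simp
  have tang: "- h \<in> tangent_cone W dn ?K ?w"
    unfolding tangent_cone_def norm_closure_def
  proof (intro CollectI conjI allI impI mh)
    fix e :: real assume "e > 0"
    then obtain n where n: "(1/2) ^ n < e / 2"
      using real_arch_pow_inv[of "e/2" "1/2"] by auto
    \<comment> \<open>A small multiple of \<open>g n\<close> subtracted from 1 stays in
      \<open>[0, 1]\<close>, so \<open>- J (g n)\<close> is radial at 1 with factor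
      \<open>B n + 1\<close>; the summand 1 avoids division by zero.\<close>
    define v where "v x = 1 - g n x / (B n + 1)" for x
    have gb: "0 \<le> g n x / (B n + 1)" "g n x / (B n + 1) \<le> 1" for x
      using g(2)[of n x] g(3)[of n x] B[of n] by (auto simp: field_simps)
    have v: "v \<in> bounded_by_one M"
      unfolding bounded_by_one_iff v_def
    proof (intro conjI AE_I2)
      show "(\<lambda>x. 1 - g n x / (B n + 1)) \<in> borel_measurable M" using g(1) by measurable
      show "\<bar>1 - g n x / (B n + 1)\<bar> \<le> 1" for x using gb[of x] by linarith
    qed
    have "- J (g n) = (B n + 1) *\<^sub>R (J v - ?w)"
    proof -
      have veq: "v = (\<lambda>_. 1) + (- 1 / (B n + 1)) *\<^sub>R g n"
        by (simp add: v_def fun_eq_iff)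
      show ?thesis
        unfolding veq using B[of n]
        by (subst J_add[OF bounded_by_one_L_infinity[OF one_mem] L_infinity_scale[OF gL]])
          (simp add: J_scale del: scaleR_minus_left)
    qed
    then have "- J (g n) \<in> radial_cone ?K ?w"
      using v B[of n] unfolding radial_cone_def
      by (auto intro!: exI[of _ "B n + 1"] exI[of _ "J v"])
    moreover have "dn (- h - - J (g n)) \<le> 2 * (1/2) ^ n"
      by (rule dual_norm_le) (use rate[of _ n] in \<open>auto simp: abs_minus_commute\<close>)
    ultimately show "\<exists>a\<in>radial_cone ?K ?w. dn (- h - a) < e" using n by force
  qed
  have hu: "h u = 0" using LIMSEQ_unique[OF conv[OF u(1)]] gu by (simp add: J_apply u(1))
  have ker: "- h \<in> kernel_on W ?\<eta>" using mh hu by (simp add: kernel_on_def)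
  have hp: "c \<le> h p"
    by (rule LIMSEQ_le_const[OF conv[OF p(1)]]) (use p in \<open>auto simp: J_apply\<close>)
  have trivial: "r = 0" if rr: "r \<in> radial_cone ?K ?w \<inter> kernel_on W ?\<eta>" for r
  proof -
    obtain a v where r: "r = a *\<^sub>R (J v - ?w)" "a > 0" and v: "v \<in> bounded_by_one M"
      using rad_form[OF IntD1[OF rr]] by blast
    have "r u = 0" using rr radW by (auto simp: kernel_on_def)
    then have "(\<integral>x. (1 - v x) * u x \<partial>M) = 0" using rad_u[OF v, of a] r by simp
    then have "AE x in M. (1 - v x) * u x = 0"
      using integral_nonneg_eq_0_iff_AE[OF one_int[OF v] one_nn[OF v]] by simp
    with u(2) have eq: "AE x in M. v x = 1" by eventually_elim auto
    have "J v = ?w"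
    proof
      fix z
      have "(\<integral>x. v x * z x \<partial>M) = (\<integral>x. 1 * z x \<partial>M)" if z: "z \<in> V"
      proof (rule integral_cong_AE)
        show "(\<lambda>x. v x * z x) \<in> borel_measurable M" "(\<lambda>x. 1 * z x) \<in> borel_measurable M"
          using v measurable_carrier[OF z] by (auto simp: bounded_by_one_iff)
        show "AE x in M. v x * z x = 1 * z x" using eq by eventually_elim simp
      qed
      then show "J v z = ?w z" by (simp add: functional_of_def)
    qed
    then show ?thesis using r by simp
  qed
  \<comment> \<open>The set whose closure is taken contains at most 0, while \<open>- h\<close> is
    at most \<open>- c\<close> at \<open>p\<close>.\<close>
  have "\<not> polyhedric_at W dn ?K ?w ?\<eta>"
  proof
    assume "polyhedric_at W dn ?K ?w ?\<eta>"
    then have cl: "- h \<in> norm_closure W dn (radial_cone ?K ?w \<inter> kernel_on W ?\<eta>)"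
      using IntI[OF tang ker] unfolding polyhedric_at_def by (rule subst)
    obtain r where "r \<in> radial_cone ?K ?w \<inter> kernel_on W ?\<eta>" "\<bar>(- h) p - r p\<bar> < c"
      by (rule evaluation_bound_closure[OF p(1) le_infI1[OF radW] cl p(2)])
    then show False using trivial[of r] hp p(2) by simp
  qed
  then have "\<not> polyhedric W dn ?K"
  proof (rule contrapos_nn)
    assume "polyhedric W dn ?K"
    then have "\<forall>\<eta>\<in>normal_cone W dn ?K ?w. polyhedric_at W dn ?K ?w \<eta>"
      using imageI[OF one_mem, of J] unfolding polyhedric_def by (rule bspec)
    then show "polyhedric_at W dn ?K ?w ?\<eta>" using \<eta> by (rule bspec)
  qed
  moreover have "?K \<subseteq> W" using J_dual bounded_by_one_L_infinity by blast
  ultimately show ?thesis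
    using closed_ball convex_ball imageI[OF one_mem, of J] unfolding non_polyhedric_def by auto
qed

end

section \<open>Condensing mass on a null set\<close>

text \<open>Indexed by numbers rather than by a finite set, so that balls can be added one at a time
  or made disjoint in order.\<close>

lemma finite_ball_cover:
  fixes F :: "'a::euclidean_space set"
  assumes "compact F" "0 < (d::real)"
  shows "\<exists>(n :: nat) (x :: nat \<Rightarrow> 'a). (\<forall>j<n. x j \<in> F) \<and> F \<subseteq> (\<Union>j<n. ball (x j) d)"
proof -
  obtain D where D: "finite D" "D \<subseteq> F" "F \<subseteq> (\<Union>x\<in>D. ball x d)"
  proof (rule compactE_image[OF assms(1), of F "\<lambda>x. ball x d"])
    show "F \<subseteq> (\<Union>x\<in>F. ball x d)" using assms(2) by auto
  qed auto
  obtain h where h: "bij_betw h {0..<card D} D" using ex_bij_betw_nat_finite[OF D(1)] by blast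
  then have hD: "h ` {..<card D} = D" by (simp add: bij_betw_def lessThan_atLeast0)
  have "F \<subseteq> (\<Union>j<card D. ball (h j) d)"
  proof
    fix y assume "y \<in> F"
    then obtain c where "c \<in> h ` {..<card D}" "y \<in> ball c d" using D(3) unfolding hD by blast
    then show "y \<in> (\<Union>j<card D. ball (h j) d)" by blast
  qed
  then show ?thesis using D(2) hD by (intro exI[of _ "card D"] exI[of _ h]) blast
qed

text \<open>The upper half of Ahlfors regularity in dimension \<open>m\<close>. The measure lives on
  the Borel subsets of a bounded Borel set, a setting that covers both \<Omega> and its
  boundary.\<close>

locale growth_measure = finite_measure M
  for M :: "'a::euclidean_space measure" +
  fixes m :: nat and C :: real
  assumes sets_M: "sets M = sets (restrict_space borel (space M))"
    and space_borel: "space M \<in> sets borel"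
    and space_bounded: "bounded (space M)"
    and m_pos: "0 < m" and C_pos: "0 < C"
    and upper: "\<And>x r. x \<in> space M \<Longrightarrow> 0 < r \<Longrightarrow> measure M (ball x r \<inter> space M) \<le> C * r ^ m"
begin

lemma borel_Int_sets: "A \<in> sets borel \<Longrightarrow> A \<inter> space M \<in> sets M"
  unfolding sets_M sets_restrict_space by (auto simp: Int_commute)

lemma borel_subset_sets: "A \<in> sets borel \<Longrightarrow> A \<subseteq> space M \<Longrightarrow> A \<in> sets M"
  using borel_Int_sets[of A] by (simp add: Int_absorb2)

lemma compact_sets: "compact A \<Longrightarrow> A \<subseteq> space M \<Longrightarrow> A \<in> sets M"
  by (intro borel_subset_sets borel_compact)

lemma sets_imp_borel: "A \<in> sets M \<Longrightarrow> A \<in> sets borel"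
  using space_borel unfolding sets_M sets_restrict_space by auto

lemma measurable_id [measurable]: "(\<lambda>x. x) \<in> measurable M borel"
  unfolding measurable_cong_sets[OF sets_M refl]
  by (rule measurable_restrict_space1) simp

lemma ball_sets [measurable]: "ball x d \<inter> space M \<in> sets M"
  by (rule borel_Int_sets) simp

end

text \<open>What the condensation needs. The lower regularity bound is asked at points of
  \<open>F0\<close>, where all mass will live. In \<open>osc\<close> the factor \<open>d ^ m\<close>
  is the size of a ball and \<open>d powr (2 * s)\<close> the squared gain from smoothness.
  \<open>zero_set\<close> provides \<open>u\<close> once the null set is known, and \<open>p\<close>
  certifies that the limit does not vanish.\<close>

locale regular_pivot = pivot V N M + growth_measure M m C
  for V :: "('a::euclidean_space \<Rightarrow> real) set" and N and M and m and C +
  fixes s c r0 :: real and F0 :: "'a set" and p :: "'a \<Rightarrow> real" and cp :: real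
  assumes s_pos: "0 < s" and c_pos: "0 < c" and r0_pos: "0 < r0"
    and F0: "compact F0" "F0 \<subseteq> space M" "0 < measure M F0"
    and lower: "\<And>x r. x \<in> F0 \<Longrightarrow> 0 < r \<Longrightarrow> r \<le> r0 \<Longrightarrow> c * r ^ m \<le> measure M (ball x r \<inter> space M)"
    and osc: "\<And>z d. z \<in> V \<Longrightarrow> 0 < d \<Longrightarrow> d \<le> 1 \<Longrightarrow>
      (\<integral>\<^sup>+x. \<integral>\<^sup>+y. ennreal ((z x - z y)\<^sup>2) * indicator (ball x d) y \<partial>M \<partial>M)
        \<le> ennreal (C * d ^ m * d powr (2 * s) * (N z)\<^sup>2)"
    and zero_set: "\<And>F. compact F \<Longrightarrow> F \<subseteq> space M \<Longrightarrow>
      \<exists>u\<in>V. continuous_on (space M) u \<and> (\<forall>x\<in>space M. 0 \<le> u x \<and> (u x = 0 \<longleftrightarrow> x \<in> F))"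
    and p: "p \<in> V" "0 < cp" "\<And>x. x \<in> F0 \<Longrightarrow> cp \<le> p x"
begin

text \<open>Inner regularity is a fact about measures on all Borel sets of the ambient space, so
  \<open>M\<close> is transported there by the inclusion map.\<close>

lemma inner_compact:
  assumes A: "A \<in> sets M" and e: "0 < e"
  obtains K where "compact K" "K \<subseteq> A" "measure M A - e \<le> measure M K"
proof -
  define D where "D = distr M borel (\<lambda>x. x)"
  have D: "emeasure D B = emeasure M (B \<inter> space M)" if "B \<in> sets borel" for B
    unfolding D_def using that by (subst emeasure_distr) auto
  have sD: "sets D = sets borel" by (simp add: D_def)
  have Ab: "A \<in> sets borel" and As: "A \<subseteq> space M"
    using sets_imp_borel[OF A] sets.sets_into_space[OF A] by auto
  have "emeasure D A = (SUP K\<in>{K. K \<subseteq> A \<and> compact K}. emeasure D K)"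
    by (rule inner_regular[OF sD _ Ab]) (simp add: D sets_eq_imp_space_eq[OF sD] emeasure_eq_measure)
  moreover have "emeasure D A = emeasure M A" using D[OF Ab] As by (simp add: Int_absorb2)
  ultimately have eq: "ennreal (measure M A) = (SUP K\<in>{K. K \<subseteq> A \<and> compact K}. emeasure D K)"
    by (simp add: emeasure_eq_measure)
  show ?thesis
  proof (cases "measure M A - e < 0")
    case True
    then show ?thesis using that[of "{}"] by simp
  next
    case False
    then have "ennreal (measure M A - e) < ennreal (measure M A)"
      using e by (intro ennreal_lessI) auto
    then obtain K where K: "K \<subseteq> A" "compact K" "ennreal (measure M A - e) < emeasure D K"
      unfolding eq less_SUP_iff by auto
    have "emeasure D K = ennreal (measure M K)"
      using K As D[OF borel_compact[OF K(2)]] by (simp add: Int_absorb2 emeasure_eq_measure)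
    then show ?thesis using that[OF K(2,1)] K(3) False by (simp add: ennreal_less_iff)
  qed
qed

text \<open>A uniform way of having no atoms, from the growth bound with \<open>m > 0\<close>: for
  radius at most 1, \<open>d ^ m \<le> d\<close>.\<close>

lemma small_balls:
  assumes "0 < e"
  obtains d where "0 < d" "\<And>x. x \<in> space M \<Longrightarrow> measure M (ball x d \<inter> space M) \<le> e"
proof -
  define d where "d = min 1 (e / C)"
  have d: "0 < d" "d \<le> 1" "d \<le> e / C" using assms C_pos by (auto simp: d_def)
  then have d3: "C * d \<le> e" using C_pos by (simp add: field_simps)
  have "measure M (ball x d \<inter> space M) \<le> e" if "x \<in> space M" for x
  proof -
    have "d ^ m \<le> d ^ 1" using d m_pos by (intro power_decreasing) auto
    then have "C * d ^ m \<le> C * d" using C_pos by simp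
    then show ?thesis using upper[OF that d(1)] d3 by linarith
  qed
  then show ?thesis using that d(1) by blast
qed

text \<open>Fill \<open>P\<close> ball by ball, each ball adding at most an eighth of the mass of
  \<open>P\<close>. The first union to reach 3/8 is then at most 1/2, and an inner compact set loses
  at most another 1/8, leaving 1/4.\<close>

lemma split_mass:
  assumes P: "P \<in> sets M" "P \<subseteq> F0"
  obtains K where "compact K" "K \<subseteq> P" "measure M P / 4 \<le> measure M K" "measure M K \<le> measure M P / 2"
proof (cases "measure M P = 0")
  case True
  then show ?thesis using that[of "{}"] by simp
next
  case False
  then have pos: "0 < measure M P" by (simp add: less_le)
  obtain d where d: "0 < d" "\<And>x. x \<in> space M \<Longrightarrow> measure M (ball x d \<inter> space M) \<le> measure M P / 8"
    using small_balls[of "measure M P / 8"] pos by auto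
  obtain n :: nat and x where "\<forall>j<n. x j \<in> F0" and "F0 \<subseteq> (\<Union>j<n. ball (x j) d)"
    using finite_ball_cover[OF F0(1) d(1)] by blast
  then have x: "\<And>j. j < n \<Longrightarrow> x j \<in> F0" "F0 \<subseteq> (\<Union>j<n. ball (x j) d)" by auto
  define A where "A i = P \<inter> (\<Union>j<i. ball (x j) d \<inter> space M)" for i
  have A: "A i \<in> sets M" for i
    unfolding A_def by (intro sets.Int P sets.finite_UN ball_sets) auto
  have An: "A n = P" using x(2) P F0(2) unfolding A_def by auto
  define i where "i = (LEAST i. 3 / 8 * measure M P \<le> measure M (A i))"
  have "3 / 8 * measure M P \<le> measure M (A n)" using pos by (simp add: An)
  then have i: "3 / 8 * measure M P \<le> measure M (A i)" and "i \<le> n"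
    unfolding i_def by (rule LeastI, rule Least_le)
  have "i \<noteq> 0" using i pos by (intro notI) (simp add: A_def)
  then obtain k where k: "i = Suc k" by (cases i) auto
  have "measure M (A k) < 3 / 8 * measure M P"
    using not_less_Least[of k "\<lambda>i. 3 / 8 * measure M P \<le> measure M (A i)"] k i_def by auto
  moreover have "A i \<subseteq> A k \<union> (ball (x k) d \<inter> space M)"
    unfolding A_def k by (auto simp: less_Suc_eq)
  then have "measure M (A i) \<le> measure M (A k \<union> (ball (x k) d \<inter> space M))"
    using A by (intro finite_measure_mono) auto
  then have "measure M (A i) \<le> measure M (A k) + measure M (ball (x k) d \<inter> space M)"
    using measure_Un_le[OF A[of k] ball_sets[of "x k" d]] by linarith
  moreover have "measure M (ball (x k) d \<inter> space M) \<le> measure M P / 8"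
    using x(1)[of k] \<open>i \<le> n\<close> k F0 by (intro d(2)) auto
  ultimately have up: "measure M (A i) \<le> measure M P / 2" by linarith
  obtain K where K: "compact K" "K \<subseteq> A i" "measure M (A i) - measure M P / 8 \<le> measure M K"
    using inner_compact[OF A, of "measure M P / 8"] pos by auto
  have "measure M K \<le> measure M (A i)" using K A by (intro finite_measure_mono) auto
  then have "measure M K \<le> measure M P / 2" using up by linarith
  moreover have "measure M P / 4 \<le> measure M K" using K(3) i by linarith
  moreover have "K \<subseteq> P" using K(2) unfolding A_def by blast
  ultimately show ?thesis using that[OF K(1)] by blast
qed

text \<open>Weighted Young with \<open>t = d powr (- s)\<close>: the square term contributes
  \<open>t * d powr (2 * s)\<close> and the constant term \<open>1 / t\<close>, both equal to
  \<open>d powr s\<close>.\<close>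

lemma osc_L1:
  assumes z: "z \<in> V" "N z \<le> 1" and d: "0 < d" "d \<le> 1"
  shows "(\<integral>\<^sup>+x. \<integral>\<^sup>+y. ennreal \<bar>z x - z y\<bar> * indicator (ball x d) y \<partial>M \<partial>M)
    \<le> ennreal (C * L1_const * d ^ m * d powr s)"
proof -
  have zm [measurable]: "z \<in> borel_measurable M" by (rule measurable_carrier[OF z(1)])
  define t where "t = d powr (- s)"
  have t: "0 < t" using d by (simp add: t_def)
  \<comment> \<open>As a function of the pair \<open>(x, y)\<close> the indicator is jointly
    measurable, which the iterated integrals require.\<close>
  have ind: "indicator (ball x d) y = (indicator {w. dist (fst w) (snd w) < d} (x, y) :: ennreal)" for x y
    by (auto simp: indicator_def)
  have [measurable]: "(\<lambda>w. indicator {w. dist (fst w) (snd w) < d} (w :: 'a \<times> 'a) :: ennreal)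
      \<in> borel_measurable (M \<Otimes>\<^sub>M M)"
    by (rule borel_measurable_indicator') measurable
  have "(\<integral>\<^sup>+x. \<integral>\<^sup>+y. ennreal \<bar>z x - z y\<bar> * indicator (ball x d) y \<partial>M \<partial>M)
    \<le> (\<integral>\<^sup>+x. \<integral>\<^sup>+y. ennreal (t / 2) * (ennreal ((z x - z y)\<^sup>2) * indicator (ball x d) y)
        + ennreal (1 / t / 2) * indicator (ball x d) y \<partial>M \<partial>M)"
  proof (intro nn_integral_mono)
    fix x y
    have "ennreal \<bar>z x - z y\<bar> \<le> ennreal (t / 2) * ennreal ((z x - z y)\<^sup>2) + ennreal (1 / t / 2)"
      using abs_le_weighted_square[OF t, of "z x - z y"] t
      by (simp add: ennreal_mult'[symmetric] ennreal_plus[symmetric] add_divide_distrib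
          del: ennreal_plus)
    then show "ennreal \<bar>z x - z y\<bar> * indicator (ball x d) y
      \<le> ennreal (t / 2) * (ennreal ((z x - z y)\<^sup>2) * indicator (ball x d) y)
        + ennreal (1 / t / 2) * indicator (ball x d) y"
      by (auto simp: indicator_def)
  qed
  also have "\<dots> = ennreal (t / 2) * (\<integral>\<^sup>+x. \<integral>\<^sup>+y. ennreal ((z x - z y)\<^sup>2) * indicator (ball x d) y \<partial>M \<partial>M)
      + ennreal (1 / t / 2) * (\<integral>\<^sup>+x. \<integral>\<^sup>+y. indicator (ball x d) y \<partial>M \<partial>M)"
    unfolding ind by (simp add: nn_integral_add nn_integral_cmult)
  also have "\<dots> \<le> ennreal (t / 2) * ennreal (C * d ^ m * d powr (2 * s))
      + ennreal (1 / t / 2) * ennreal (C * d ^ m * measure M (space M))"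
  proof (intro add_mono mult_left_mono)
    have "(N z)\<^sup>2 \<le> 1" using z N_nonneg by (simp add: power_le_one)
    then have "C * d ^ m * d powr (2 * s) * (N z)\<^sup>2 \<le> C * d ^ m * d powr (2 * s)"
      using C_pos d by (simp add: mult_left_le)
    then show "(\<integral>\<^sup>+x. \<integral>\<^sup>+y. ennreal ((z x - z y)\<^sup>2) * indicator (ball x d) y \<partial>M \<partial>M)
        \<le> ennreal (C * d ^ m * d powr (2 * s))"
      using osc[OF z(1) d] by (meson ennreal_leI order_trans)
    have "(\<integral>\<^sup>+x. \<integral>\<^sup>+y. indicator (ball x d) y \<partial>M \<partial>M) \<le> (\<integral>\<^sup>+x. ennreal (C * d ^ m) \<partial>M)"
    proof (rule nn_integral_mono)
      fix x assume x: "x \<in> space M"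
      have "(\<integral>\<^sup>+y. indicator (ball x d) y \<partial>M) = (\<integral>\<^sup>+y. indicator (ball x d \<inter> space M) y \<partial>M)"
        by (rule nn_integral_cong) (auto simp: indicator_def)
      also have "\<dots> = ennreal (measure M (ball x d \<inter> space M))"
        by (subst nn_integral_indicator) (auto simp: emeasure_eq_measure)
      also have "\<dots> \<le> ennreal (C * d ^ m)" by (rule ennreal_leI[OF upper[OF x d(1)]])
      finally show "(\<integral>\<^sup>+y. indicator (ball x d) y \<partial>M) \<le> ennreal (C * d ^ m)" .
    qed
    also have "\<dots> = ennreal (C * d ^ m * measure M (space M))"
      using C_pos d by (simp add: emeasure_eq_measure ennreal_mult)
    finally show "(\<integral>\<^sup>+x. \<integral>\<^sup>+y. indicator (ball x d) y \<partial>M \<partial>M) \<le> ennreal (C * d ^ m * measure M (space M))" .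
  qed auto
  also have "\<dots> = ennreal (t / 2 * (C * d ^ m * d powr (2 * s)) + 1 / t / 2 * (C * d ^ m * measure M (space M)))"
  proof -
    have "0 \<le> C * d ^ m * d powr (2 * s)" "0 \<le> C * d ^ m * measure M (space M)" "0 \<le> t / 2" "0 \<le> 1 / t / 2"
      using t C_pos d by auto
    moreover have "ennreal a * ennreal b + ennreal a' * ennreal b' = ennreal (a * b + a' * b')"
      if "0 \<le> b" "0 \<le> b'" "0 \<le> a" "0 \<le> a'" for a b a' b'
      using that by (simp add: ennreal_mult)
    ultimately show ?thesis by blast
  qed
  also have "t / 2 * (C * d ^ m * d powr (2 * s)) + 1 / t / 2 * (C * d ^ m * measure M (space M))
      = C * L1_const * d ^ m * d powr s"
  proof -
    have 1: "t * d powr (2 * s) = d powr s"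
      unfolding t_def powr_add[symmetric] by simp
    have 2: "1 / t = d powr s" unfolding t_def using d by (simp add: powr_minus divide_inverse)
    have "t / 2 * (C * d ^ m * d powr (2 * s)) + 1 / t / 2 * (C * d ^ m * measure M (space M))
      = C * d ^ m * ((t * d powr (2 * s)) + (1 / t) * measure M (space M)) / 2" by (simp add: field_simps)
    also have "\<dots> = C * L1_const * d ^ m * d powr s" unfolding 1 2 L1_const_def by (simp add: field_simps)
    finally show ?thesis .
  qed
  finally show ?thesis .
qed

text \<open>The average over the ball around \<open>x0\<close> differs from \<open>z x\<close> by at
  most the mean of \<open>|z x - z y|\<close> over that ball. The ball of radius
  \<open>2 * d\<close> around \<open>x\<close> contains it, so the right side no longer involves
  \<open>x0\<close> and can be integrated over all cells at once.\<close>

lemma ball_average: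
  assumes z: "z \<in> V" and x0: "x0 \<in> F0" and d: "0 < d" "d \<le> r0" and x: "dist x0 x < d"
  defines "a \<equiv> (\<integral>y. indicator (ball x0 d) y * z y \<partial>M) / measure M (ball x0 d \<inter> space M)"
  shows "ennreal \<bar>z x - a\<bar>
    \<le> ennreal (1 / (c * d ^ m)) * (\<integral>\<^sup>+y. ennreal \<bar>z x - z y\<bar> * indicator (ball x (2 * d)) y \<partial>M)"
proof -
  let ?B = "ball x0 d \<inter> space M"
  have zm [measurable]: "z \<in> borel_measurable M" by (rule measurable_carrier[OF z])
  have zi: "integrable M z" by (rule carrier_integrable[OF z])
  have cd: "0 < c * d ^ m" using c_pos d by simp
  have low: "c * d ^ m \<le> measure M ?B" by (rule lower[OF x0 d])
  then have pos: "0 < measure M ?B" using cd by linarith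
  have eq: "(\<integral>y. indicator (ball x0 d) y * z y \<partial>M) = (\<integral>y. indicator ?B y * z y \<partial>M)"
    by (rule Bochner_Integration.integral_cong) (auto simp: indicator_def)
  have i1: "integrable M (\<lambda>y. indicator ?B y * z y)"
    using integrable_mult_indicator[OF ball_sets zi] by simp
  have i2: "integrable M (\<lambda>y. indicator ?B y * z x)"
    using integrable_mult_indicator[OF ball_sets, of "\<lambda>y. z x"] by simp
  have i3: "integrable M (\<lambda>y. indicator ?B y * \<bar>z x - z y\<bar>)"
    using integrable_mult_indicator[OF ball_sets, of "\<lambda>y. \<bar>z x - z y\<bar>"] zi by simp
  have "measure M ?B * \<bar>z x - a\<bar> = \<bar>measure M ?B * z x - measure M ?B * a\<bar>"
    by (simp add: abs_mult right_diff_distrib[symmetric])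
  also have "\<dots> = \<bar>\<integral>y. indicator ?B y * z x - indicator ?B y * z y \<partial>M\<bar>"
    using i1 i2 pos by (simp add: a_def eq)
  also have "\<dots> \<le> (\<integral>y. \<bar>indicator ?B y * z x - indicator ?B y * z y\<bar> \<partial>M)"
    by (rule integral_abs_bound)
  also have "\<dots> = (\<integral>y. indicator ?B y * \<bar>z x - z y\<bar> \<partial>M)"
    by (rule Bochner_Integration.integral_cong) (auto simp: indicator_def)
  finally have 1: "measure M ?B * \<bar>z x - a\<bar> \<le> (\<integral>y. indicator ?B y * \<bar>z x - z y\<bar> \<partial>M)" .
  have "c * d ^ m * \<bar>z x - a\<bar> \<le> measure M ?B * \<bar>z x - a\<bar>"
    using low by (intro mult_right_mono) auto
  with 1 have "c * d ^ m * \<bar>z x - a\<bar> \<le> (\<integral>y. indicator ?B y * \<bar>z x - z y\<bar> \<partial>M)" by linarith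
  then have "ennreal \<bar>z x - a\<bar> \<le> ennreal (1 / (c * d ^ m) * (\<integral>y. indicator ?B y * \<bar>z x - z y\<bar> \<partial>M))"
    using cd by (intro ennreal_leI) (simp add: field_simps)
  also have "\<dots> = ennreal (1 / (c * d ^ m)) * ennreal (\<integral>y. indicator ?B y * \<bar>z x - z y\<bar> \<partial>M)"
    using cd by (intro ennreal_mult') simp
  also have "ennreal (\<integral>y. indicator ?B y * \<bar>z x - z y\<bar> \<partial>M)
      = (\<integral>\<^sup>+y. ennreal (indicator ?B y * \<bar>z x - z y\<bar>) \<partial>M)"
    by (rule nn_integral_eq_integral[symmetric, OF i3]) auto
  also have "\<dots> \<le> (\<integral>\<^sup>+y. ennreal \<bar>z x - z y\<bar> * indicator (ball x (2 * d)) y \<partial>M)"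
  proof (rule nn_integral_mono)
    fix y
    have "dist x y < 2 * d" if "dist x0 y < d"
      using that x dist_triangle[of x y x0] by (simp add: dist_commute)
    then show "ennreal (indicator ?B y * \<bar>z x - z y\<bar>) \<le> ennreal \<bar>z x - z y\<bar> * indicator (ball x (2 * d)) y"
      by (auto simp: indicator_def)
  qed
  finally show ?thesis by (simp add: mult_left_mono)
qed

text \<open>Bounds and support conditions hold at every point, so that later estimates involve no
  exceptional sets.\<close>

definition density_on :: "'a set \<Rightarrow> real \<Rightarrow> ('a \<Rightarrow> real) \<Rightarrow> bool" where
  "density_on F B g \<longleftrightarrow> compact F \<and> F \<subseteq> F0 \<and> g \<in> borel_measurable M \<and>
     (\<forall>x. 0 \<le> g x \<and> g x \<le> B) \<and> (\<forall>x. x \<notin> F \<longrightarrow> g x = 0) \<and> (\<integral>x. g x \<partial>M) = 1"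

text \<open>Cut \<open>F\<close> into cells of radius \<open>d\<close>, and in each replace
  \<open>g\<close> by a constant on a compact set with a quarter to a half of the measure of the
  cell, keeping the mass of the cell. The difference \<open>D\<close> has integral 0 over each cell,
  so ball averages may be subtracted from \<open>z\<close>. In the constant, \<open>5 * B\<close>
  bounds \<open>|D|\<close>, \<open>1 / c\<close> is the lower ball bound, \<open>2 ^ m\<close>
  comes from the doubled radius and \<open>C * L1_const\<close> from \<open>osc_L1\<close>.\<close>

lemma redistribute:
  assumes g: "density_on F B g" and d: "0 < d" "d \<le> r0" "d \<le> 1 / 2"
  obtains F' g' where "density_on F' (4 * B) g'" "F' \<subseteq> F" "measure M F' \<le> measure M F / 2"
    "\<forall>z\<in>V. \<bar>(\<integral>x. g' x * z x \<partial>M) - (\<integral>x. g x * z x \<partial>M)\<bar>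
      \<le> 5 * B / c * 2 ^ m * C * L1_const * (2 * d) powr s * N z"
proof -
  have F: "compact F" "F \<subseteq> F0" and gm [measurable]: "g \<in> borel_measurable M"
    and gb: "\<And>x. 0 \<le> g x" "\<And>x. g x \<le> B" and goff: "\<And>x. x \<notin> F \<Longrightarrow> g x = 0"
    and g1: "(\<integral>x. g x \<partial>M) = 1"
    using g by (auto simp: density_on_def)
  have B: "0 \<le> B" using gb[of undefined] by linarith
  have FM: "F \<in> sets M" using compact_sets F F0 by auto
  obtain n :: nat and x where "\<forall>j<n. x j \<in> F" and "F \<subseteq> (\<Union>j<n. ball (x j) d)"
    using finite_ball_cover[OF F(1) d(1)] by blast
  then have x: "\<And>j. j < n \<Longrightarrow> x j \<in> F" "F \<subseteq> (\<Union>j<n. ball (x j) d)" by auto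
  \<comment> \<open>A point of \<open>F\<close> belongs to the cell of the first ball that contains
    it.\<close>
  define P where "P j = F \<inter> (ball (x j) d \<inter> space M) - (\<Union>i<j. ball (x i) d \<inter> space M)" for j :: nat
  have PM: "P j \<in> sets M" for j 
    unfolding P_def by (intro sets.Diff sets.Int FM sets.finite_UN ball_sets) auto
  have PF: "P j \<subseteq> F" "P j \<subseteq> F0" for j using F by (auto simp: P_def)
  have disj: "i = j" if "y \<in> P i" "y \<in> P j" for y i j
    using that by (cases i j rule: linorder_cases) (auto simp: P_def)
  have cover: "\<exists>j<n. y \<in> P j" if y: "y \<in> F" for y
  proof -
    define j where "j = (LEAST j. y \<in> ball (x j) d)"
    obtain k where k: "k < n" "y \<in> ball (x k) d" using x(2) y by auto
    have "j \<le> k" unfolding j_def using k(2) by (rule Least_le)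
    moreover have "y \<in> ball (x j) d" unfolding j_def using k(2) by (rule LeastI)
    moreover have "y \<notin> ball (x i) d" if "i < j" for i
      using not_less_Least[of i "\<lambda>j. y \<in> ball (x j) d"] that unfolding j_def by blast
    moreover have "y \<in> space M" using y F F0 by auto
    ultimately have "y \<in> P j" using y unfolding P_def by auto
    then show ?thesis using \<open>j \<le> k\<close> k(1) by (intro exI[of _ j]) auto
  qed
  have "\<forall>j. \<exists>K. compact K \<and> K \<subseteq> P j \<and> measure M (P j) / 4 \<le> measure M K \<and> measure M K \<le> measure M (P j) / 2"
  proof
    fix j
    obtain K where "compact K" "K \<subseteq> P j" "measure M (P j) / 4 \<le> measure M K" "measure M K \<le> measure M (P j) / 2"
      by (rule split_mass[OF PM PF(2)])
    then show "\<exists>K. compact K \<and> K \<subseteq> P j \<and> measure M (P j) / 4 \<le> measure M K \<and> measure M K \<le> measure M (P j) / 2"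
      by blast
  qed
  then obtain K where K: "\<And>j. compact (K j)" "\<And>j. K j \<subseteq> P j"
    "\<And>j. measure M (P j) / 4 \<le> measure M (K j)" "\<And>j. measure M (K j) \<le> measure M (P j) / 2"
    by metis
  have KM: "K j \<in> sets M" for j using compact_sets[OF K(1)] K(2) sets.sets_into_space[OF PM] by blast
  define gP where "gP j = (\<integral>y. g y * indicator (P j) y \<partial>M)" for j
  have gi: "integrable M g"
    by (rule integrable_const_bound[where B = B]) (use gb in auto)
  have gPi: "integrable M (\<lambda>y. g y * indicator (P j) y)" for j
    by (rule integrable_real_mult_indicator[OF PM gi])
  have gP0: "0 \<le> gP j" for j unfolding gP_def using gb by (intro integral_nonneg_AE) auto
  have gPB: "gP j \<le> B * measure M (P j)" for j
  proof -
    have "gP j \<le> (\<integral>y. B * indicator (P j) y \<partial>M)"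
      unfolding gP_def
    proof (rule integral_mono[OF gPi])
      show "integrable M (\<lambda>y. B * indicator (P j) y)"
        using integrable_mult_indicator[OF PM, of "\<lambda>y. B"] by (simp add: mult.commute)
      show "g y * indicator (P j) y \<le> B * indicator (P j) y" for y
        using gb by (intro mult_right_mono) auto
    qed
    also have "\<dots> = B * measure M (P j)" using PM sets.sets_into_space[OF PM[of j]] by (simp add: Int_absorb2)
    finally show ?thesis .
  qed
  \<comment> \<open>The height that preserves the mass of the cell. If \<open>K j\<close> is null
    the quotient is 0 by convention; then \<open>P j\<close> is null as well and
    \<open>gP j = 0\<close>, so the balance \<open>bK\<close> still holds.\<close>
  define b where "b j = gP j / measure M (K j)" for j
  have b0: "0 \<le> b j" for j using gP0 by (simp add: b_def)
  have bB: "b j \<le> 4 * B" for j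
  proof (cases "measure M (K j) = 0")
    case True then show ?thesis using B by (simp add: b_def)
  next
    case False
    then have "0 < measure M (K j)" by (simp add: less_le)
    moreover have "B * measure M (P j) \<le> B * (4 * measure M (K j))"
      using K(3)[of j] B by (intro mult_left_mono) auto
    ultimately show ?thesis using gPB[of j] by (simp add: b_def field_simps)
  qed
  have bK: "b j * measure M (K j) = gP j" for j
  proof (cases "measure M (K j) = 0")
    case True
    then have "measure M (P j) \<le> 0" using K(3)[of j] by simp
    then have "gP j \<le> 0" using gPB[of j] B mult_nonneg_nonpos[of B "measure M (P j)"] by linarith
    then show ?thesis using gP0[of j] True by simp
  qed (simp add: b_def)
  define g' where "g' y = (\<Sum>j<n. b j * indicator (K j) y)" for y
  define F' where "F' = (\<Union>j<n. K j)"
  have g'm [measurable]: "g' \<in> borel_measurable M"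
    unfolding g'_def using KM by measurable
  have g'P: "g' y = b j * indicator (K j) y" if "y \<in> P j" "j < n" for y j
  proof -
    have "g' y = (\<Sum>i<n. if i = j then b j * indicator (K j) y else 0)"
      unfolding g'_def using K(2) disj[OF that(1)]
      by (intro sum.cong) (auto simp: indicator_def)
    then show ?thesis using that by simp
  qed
  have g'off: "g' y = 0" if "y \<notin> F'" for y
    using that unfolding g'_def F'_def by (intro sum.neutral) (auto simp: indicator_def)
  have F'F: "F' \<subseteq> F" using K(2) PF by (force simp: F'_def)
  have g'b: "0 \<le> g' y" "g' y \<le> 4 * B" for y
  proof -
    show "0 \<le> g' y" unfolding g'_def using b0 by (intro sum_nonneg) auto
    show "g' y \<le> 4 * B"
    proof (cases "y \<in> F'")
      case True
      then obtain j where "j < n" "y \<in> P j" using cover F'F by blast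
      then show ?thesis using g'P[of y j] bB[of j] B by (auto simp: indicator_def)
    qed (use g'off B in simp)
  qed
  have g'i: "integrable M g'"
    by (rule integrable_const_bound[where B = "4 * B"]) (use g'b in auto)
  define D where "D y = g' y - g y" for y
  have Dm [measurable]: "D \<in> borel_measurable M" unfolding D_def by measurable
  have Di: "integrable M D" unfolding D_def using g'i gi by auto
  have Doff: "D y = 0" if "y \<notin> F" for y using that goff g'off F'F by (auto simp: D_def)
  have Db: "\<bar>D y\<bar> \<le> 5 * B" for y using gb[of y] g'b[of y] by (auto simp: D_def abs_le_iff)
  have DPi: "integrable M (\<lambda>y. D y * indicator (P j) y)" for j
    by (rule integrable_real_mult_indicator[OF PM Di])
  have DP: "(\<integral>y. D y * indicator (P j) y \<partial>M) = 0" if j: "j < n" for j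
  proof -
    have "(\<integral>y. D y * indicator (P j) y \<partial>M)
        = (\<integral>y. b j * indicator (K j) y - g y * indicator (P j) y \<partial>M)"
    proof (rule Bochner_Integration.integral_cong[OF refl])
      fix y show "D y * indicator (P j) y = b j * indicator (K j) y - g y * indicator (P j) y"
        using g'P[OF _ j, of y] K(2)[of j] by (auto simp: D_def indicator_def)
    qed
    also have "\<dots> = b j * measure M (K j) - gP j"
      using KM sets.sets_into_space[OF KM[of j]] gPi
      by (subst Bochner_Integration.integral_diff) (auto simp: gP_def Int_absorb2 emeasure_eq_measure)
    finally show ?thesis using bK by simp
  qed
  have Dsplit: "D y = (\<Sum>j<n. D y * indicator (P j) y)" for y
  proof (cases "y \<in> F")
    case True
    then obtain j where j: "j < n" "y \<in> P j" using cover by blast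
    have "y \<in> P i \<longleftrightarrow> i = j" for i using disj j(2) by blast
    then have "(\<Sum>i<n. D y * indicator (P i) y) = (\<Sum>i<n. if i = j then D y else 0)"
      by (intro sum.cong) (simp_all add: indicator_def)
    then show ?thesis using j by simp
  qed (simp add: Doff)
  have "(\<integral>y. D y \<partial>M) = (\<integral>y. (\<Sum>j<n. D y * indicator (P j) y) \<partial>M)"
    using Dsplit by (intro Bochner_Integration.integral_cong) auto
  also have "\<dots> = 0" using DPi DP by (subst Bochner_Integration.integral_sum) auto
  finally have "(\<integral>y. g' y \<partial>M) = 1"
    using g1 gi g'i by (simp add: D_def)
  then have dens: "density_on F' (4 * B) g'"
    unfolding density_on_def
  proof (intro conjI)
    show "compact F'" unfolding F'_def using K(1) by (intro compact_UN) auto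
    show "F' \<subseteq> F0" using F'F F(2) by blast
  qed (use g'b g'off in auto)
  have half: "measure M F' \<le> measure M F / 2"
  proof -
    have "measure M F' \<le> (\<Sum>j<n. measure M (K j))"
      unfolding F'_def using KM by (intro measure_UNION_le) auto
    also have "\<dots> \<le> (\<Sum>j<n. measure M (P j) / 2)" by (intro sum_mono K(4))
    also have "\<dots> = (\<Sum>j<n. measure M (P j)) / 2" by (simp add: sum_divide_distrib)
    also have "(\<Sum>j<n. measure M (P j)) = measure M (\<Union>j<n. P j)"
    proof (rule finite_measure_finite_Union[symmetric])
      show "P ` {..<n} \<subseteq> sets M" using PM by blast
      show "disjoint_family_on P {..<n}" using disj unfolding disjoint_family_on_def by blast
    qed simp
    also have "(\<Union>j<n. P j) = F" using PF(1) cover by blast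
    finally show ?thesis .
  qed
  have est: "\<bar>(\<integral>y. g' y * z y \<partial>M) - (\<integral>y. g y * z y \<partial>M)\<bar>
      \<le> 5 * B / c * 2 ^ m * C * L1_const * (2 * d) powr s * N z" if z: "z \<in> V" for z
  proof (rule homogeneous_bound[OF _ _ z])
    show "(\<integral>y. g' y * (a *\<^sub>R z) y \<partial>M) - (\<integral>y. g y * (a *\<^sub>R z) y \<partial>M)
      = a * ((\<integral>y. g' y * z y \<partial>M) - (\<integral>y. g y * z y \<partial>M))" for a z
      by (simp add: right_diff_distrib mult.left_commute flip: integral_mult_right_zero)
    fix z assume z: "z \<in> V" "N z \<le> 1"
    have zm [measurable]: "z \<in> borel_measurable M" by (rule measurable_carrier[OF z(1)])
    define a where "a j = (\<integral>y. indicator (ball (x j) d) y * z y \<partial>M)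
      / measure M (ball (x j) d \<inter> space M)" for j
    define \<phi> where "\<phi> y = (\<integral>\<^sup>+w. ennreal \<bar>z y - z w\<bar> * indicator (ball y (2 * d)) w \<partial>M)" for y
    \<comment> \<open>Constant on each cell, hence orthogonal to \<open>D\<close>; subtracting it
      from \<open>z\<close> leaves only an oscillation.\<close>
    define A where "A y = (\<Sum>j<n. a j * indicator (P j) y)" for y
    have gz: "integrable M (\<lambda>y. g y * z y)"
      by (rule bounded_mult_integrable[OF gm _ z(1), of B]) (use gb in auto)
    have gz': "integrable M (\<lambda>y. g' y * z y)"
      by (rule bounded_mult_integrable[OF g'm _ z(1), of "4 * B"]) (use g'b in auto)
    have DA: "D y * A y = (\<Sum>j<n. a j * (D y * indicator (P j) y))" for y
      unfolding A_def sum_distrib_left by (intro sum.cong refl mult.left_commute)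
    have DAi: "integrable M (\<lambda>y. D y * A y)" unfolding DA using DPi by auto
    have "(\<integral>y. D y * A y \<partial>M) = 0"
      unfolding DA using DPi DP by (subst Bochner_Integration.integral_sum) auto
    moreover have Dz: "integrable M (\<lambda>y. D y * z y)"
      using gz gz' by (simp add: D_def left_diff_distrib)
    ultimately have "(\<integral>y. D y * z y \<partial>M) = (\<integral>y. D y * (z y - A y) \<partial>M)"
      using DAi by (simp add: right_diff_distrib)
    moreover have "(\<integral>y. D y * z y \<partial>M) = (\<integral>y. g' y * z y \<partial>M) - (\<integral>y. g y * z y \<partial>M)"
      using gz gz' by (simp add: D_def left_diff_distrib)
    ultimately have "ennreal \<bar>(\<integral>y. g' y * z y \<partial>M) - (\<integral>y. g y * z y \<partial>M)\<bar>
      = ennreal (norm (\<integral>y. D y * (z y - A y) \<partial>M))" by simp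
    also have "\<dots> \<le> (\<integral>\<^sup>+y. ennreal (norm (D y * (z y - A y))) \<partial>M)"
      using Dz DAi by (intro integral_norm_bound_ennreal) (simp add: right_diff_distrib)
    also have "\<dots> \<le> (\<integral>\<^sup>+y. ennreal (5 * B / (c * d ^ m)) * \<phi> y \<partial>M)"
    proof (rule nn_integral_mono)
      fix y
      show "ennreal (norm (D y * (z y - A y))) \<le> ennreal (5 * B / (c * d ^ m)) * \<phi> y"
      proof (cases "y \<in> F")
        case True
        then obtain j where j: "j < n" "y \<in> P j" using cover by blast
        have "y \<in> P i \<longleftrightarrow> i = j" for i using disj j(2) by blast
        then have "A y = (\<Sum>i<n. if i = j then a j else 0)"
          unfolding A_def by (intro sum.cong) (simp_all add: indicator_def)
        then have A: "A y = a j" using j by simp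
        have "ennreal (norm (D y * (z y - A y))) \<le> ennreal (5 * B * \<bar>z y - a j\<bar>)"
          using Db[of y] by (intro ennreal_leI) (simp add: abs_mult A mult_right_mono)
        also have "\<dots> = ennreal (5 * B) * ennreal \<bar>z y - a j\<bar>"
          using B by (intro ennreal_mult) auto
        also have "\<dots> \<le> ennreal (5 * B) * (ennreal (1 / (c * d ^ m)) * \<phi> y)"
          unfolding a_def \<phi>_def using x(1)[OF j(1)] j F d
          by (intro mult_left_mono ball_average[OF z(1)]) (auto simp: P_def)
        also have "\<dots> = ennreal (5 * B / (c * d ^ m)) * \<phi> y"
          using B c_pos d by (simp add: mult.assoc[symmetric] ennreal_mult'[symmetric])
        finally show ?thesis .
      qed (simp add: Doff)
    qed
    also have "\<dots> = ennreal (5 * B / (c * d ^ m)) * (\<integral>\<^sup>+y. \<phi> y \<partial>M)"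
    proof (rule nn_integral_cmult)
      have ind: "indicator (ball x (2 * d)) y
          = (indicator {w. dist (fst w) (snd w) < 2 * d} (x, y) :: ennreal)" for x y
        by (auto simp: indicator_def)
      have [measurable]: "(\<lambda>w. indicator {w. dist (fst w) (snd w) < 2 * d} (w :: 'a \<times> 'a) :: ennreal)
          \<in> borel_measurable (M \<Otimes>\<^sub>M M)"
        by (rule borel_measurable_indicator') measurable
      show "\<phi> \<in> borel_measurable M" unfolding \<phi>_def ind by measurable
    qed
    also have "\<dots> \<le> ennreal (5 * B / (c * d ^ m)) * ennreal (C * L1_const * (2 * d) ^ m * (2 * d) powr s)"
      unfolding \<phi>_def using d by (intro mult_left_mono osc_L1[OF z]) auto
    also have "\<dots> = ennreal (5 * B / (c * d ^ m) * (C * L1_const * (2 * d) ^ m * (2 * d) powr s))"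
      using B c_pos d by (intro ennreal_mult'[symmetric]) auto
    also have "5 * B / (c * d ^ m) * (C * L1_const * (2 * d) ^ m * (2 * d) powr s)
      = 5 * B / c * 2 ^ m * C * L1_const * (2 * d) powr s"
      using c_pos d by (simp add: power_mult_distrib field_simps)
    finally show "\<bar>(\<integral>y. g' y * z y \<partial>M) - (\<integral>y. g y * z y \<partial>M)\<bar>
      \<le> 5 * B / c * 2 ^ m * C * L1_const * (2 * d) powr s"
      using B c_pos C_pos L1_const_pos by (subst (asm) ennreal_le_iff) auto
  qed
  show ?thesis using est by (intro that[OF dens F'F half]) blast
qed

text \<open>The height \<open>B\<close> is given before the radius, so \<open>d\<close> can absorb
  it whatever its size. This is where \<open>s > 0\<close> is used.\<close>

lemma redistribute_small:
  assumes g: "density_on F B g" and e: "0 < e"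
  obtains F' g' where "density_on F' (4 * B) g'" "F' \<subseteq> F" "measure M F' \<le> measure M F / 2"
    "\<forall>z\<in>V. \<bar>(\<integral>x. g' x * z x \<partial>M) - (\<integral>x. g x * z x \<partial>M)\<bar> \<le> e * N z"
proof -
  define k where "k = 5 * B / c * 2 ^ m * C * L1_const"
  have B: "0 \<le> B" using g unfolding density_on_def by (meson order_trans)
  then have k: "0 \<le> k" using c_pos C_pos L1_const_pos by (simp add: k_def)
  \<comment> \<open>Solves \<open>(k + 1) * t powr s = e\<close>; a radius with
    \<open>2 * d \<le> t\<close> then costs at most \<open>e\<close>.\<close>
  define t where "t = (e / (k + 1)) powr (1 / s)"
  have t: "0 < t" using e k by (simp add: t_def)
  define d where "d = min (min r0 (1/2)) (t / 2)"
  have d: "0 < d" "d \<le> r0" "d \<le> 1 / 2" "2 * d \<le> t" using t r0_pos by (auto simp: d_def)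
  have "(2 * d) powr s \<le> t powr s" using d s_pos by (intro powr_mono2) auto
  also have "\<dots> = e / (k + 1)" using e k s_pos by (simp add: t_def powr_powr)
  finally have "k * (2 * d) powr s \<le> k * (e / (k + 1))" using k by (rule mult_left_mono)
  also have "\<dots> \<le> e" using e k by (simp add: field_simps)
  finally have ke: "k * (2 * d) powr s \<le> e" .
  obtain F' g' where 1: "density_on F' (4 * B) g'" "F' \<subseteq> F" "measure M F' \<le> measure M F / 2"
    and 2: "\<forall>z\<in>V. \<bar>(\<integral>x. g' x * z x \<partial>M) - (\<integral>x. g x * z x \<partial>M)\<bar> \<le> k * (2 * d) powr s * N z"
    unfolding k_def by (rule redistribute[OF g d(1-3)])
  have "\<bar>(\<integral>x. g' x * z x \<partial>M) - (\<integral>x. g x * z x \<partial>M)\<bar> \<le> e * N z" if "z \<in> V" for z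
    using bspec[OF 2 that] mult_right_mono[OF ke N_nonneg[OF that]] by linarith
  then show ?thesis by (intro that[OF 1]) blast
qed

theorem non_polyhedric_unit_ball: "non_polyhedric W dn (J ` bounded_by_one M)"
proof -
  have F0M: "F0 \<in> sets M" using compact_sets F0 by auto
  \<comment> \<open>The start is the uniform distribution on \<open>F0\<close>.\<close>
  have init: "density_on F0 (1 / measure M F0) (\<lambda>x. indicator F0 x / measure M F0)"
  proof -
    have "(\<integral>x. indicator F0 x / measure M F0 \<partial>M) = 1"
      using F0 F0M by (simp add: Int_absorb2)
    then show ?thesis unfolding density_on_def using F0 F0M
      by (auto simp: divide_right_mono indicator_le_1)
  qed
  \<comment> \<open>A state is a triple of support, height bound and density; step \<open>n\<close>
    has accuracy \<open>(1/2) ^ n\<close>, the rate that the criterion expects.\<close>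
  define Q where "Q n T = (case T of (F, B, g) \<Rightarrow> density_on F B g)" for n :: nat and T
  define R where "R n T T' = (case T of (F, B, g) \<Rightarrow> case T' of (F', B', g') \<Rightarrow>
    F' \<subseteq> F \<and> measure M F' \<le> measure M F / 2 \<and>
    (\<forall>z\<in>V. \<bar>(\<integral>x. g' x * z x \<partial>M) - (\<integral>x. g x * z x \<partial>M)\<bar> \<le> (1/2) ^ n * N z))" for n :: nat
    and T T' :: "'a set \<times> real \<times> ('a \<Rightarrow> real)"
  have "\<exists>f. \<forall>n. Q n (f n) \<and> R n (f n) (f (Suc n))"
  proof (rule dependent_nat_choice)
    show "\<exists>T. Q 0 T" using init by (auto simp: Q_def)
    fix T n assume "Q n T"
    then obtain F B g where T: "T = (F, B, g)" "density_on F B g" by (cases T) (auto simp: Q_def)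
    obtain F' g' where "density_on F' (4 * B) g'" "F' \<subseteq> F" "measure M F' \<le> measure M F / 2"
      "\<forall>z\<in>V. \<bar>(\<integral>x. g' x * z x \<partial>M) - (\<integral>x. g x * z x \<partial>M)\<bar> \<le> (1/2) ^ n * N z"
      by (rule redistribute_small[OF T(2), of "(1/2) ^ n"]) auto
    then show "\<exists>T'. Q (Suc n) T' \<and> R n T T'"
      by (intro exI[of _ "(F', 4 * B, g')"]) (auto simp: Q_def R_def T)
  qed
  then obtain f where f: "\<And>n. Q n (f n)" "\<And>n. R n (f n) (f (Suc n))" by blast
  define F B g where "F n = fst (f n)" and "B n = fst (snd (f n))" and "g n = snd (snd (f n))" for n
  have dens: "density_on (F n) (B n) (g n)" for n
    using f(1)[of n] by (simp add: Q_def F_def B_def g_def case_prod_beta)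
  have step: "F (Suc n) \<subseteq> F n" "measure M (F (Suc n)) \<le> measure M (F n) / 2"
    "\<And>z. z \<in> V \<Longrightarrow> \<bar>(\<integral>x. g (Suc n) x * z x \<partial>M) - (\<integral>x. g n x * z x \<partial>M)\<bar> \<le> (1/2) ^ n * N z" for n
    using f(2)[of n] by (auto simp: R_def F_def g_def case_prod_beta)
  have Fc: "compact (F n)" "F n \<subseteq> F0" and gm: "g n \<in> borel_measurable M"
    and gb: "\<And>x. 0 \<le> g n x" "\<And>x. g n x \<le> B n" and goff: "\<And>x. x \<notin> F n \<Longrightarrow> g n x = 0"
    and g1: "(\<integral>x. g n x \<partial>M) = 1" for n
    using dens[of n] by (auto simp: density_on_def)
  have FM: "F n \<in> sets M" for n using compact_sets Fc F0 by blast
  have gi: "integrable M (g n)" for n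
    by (rule integrable_const_bound[where B = "B n"]) (use gb gm in auto)
  have dec: "decseq F" unfolding decseq_Suc_iff using step(1) by blast
  define E where "E = (\<Inter>n. F n)"
  have E: "compact E" "E \<subseteq> space M"
  proof -
    show "compact E" unfolding E_def using Fc by (intro compact_Inter) auto
    show "E \<subseteq> space M" unfolding E_def using Fc(2)[of 0] F0(2) by blast
  qed
  have meas: "measure M (F n) \<le> (1/2) ^ n * measure M (F 0)" for n
  proof (induction n)
    case (Suc n)
    then show ?case using step(2)[of n] by simp
  qed simp
  have "measure M E = 0"
  proof (rule ccontr)
    assume "measure M E \<noteq> 0"
    then have pos: "0 < measure M E" by (simp add: less_le)
    have "(\<lambda>n. (1/2) ^ n * measure M (F 0)) \<longlonglongrightarrow> 0 * measure M (F 0)"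
      by (intro tendsto_intros LIMSEQ_power_zero) auto
    then obtain n where "(1/2) ^ n * measure M (F 0) < measure M E"
      using order_tendstoD(2)[of _ "0 * measure M (F 0)" sequentially "measure M E"] pos
      by (auto simp: eventually_sequentially)
    moreover have "measure M E \<le> measure M (F n)"
      using FM by (intro finite_measure_mono) (auto simp: E_def)
    ultimately show False using meas[of n] by linarith
  qed
  then have nullE: "E \<in> null_sets M"
    using compact_sets[OF E] by (auto simp: emeasure_eq_measure)
  obtain u where u: "u \<in> V" "continuous_on (space M) u"
    "\<And>x. x \<in> space M \<Longrightarrow> 0 \<le> u x" "\<And>x. x \<in> space M \<Longrightarrow> u x = 0 \<longleftrightarrow> x \<in> E"
    using zero_set[OF E] by blast
  have upos: "AE x in M. 0 < u x"
    using AE_not_in[OF nullE] AE_space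
  proof eventually_elim
    fix x assume "x \<notin> E" "x \<in> space M"
    then show "0 < u x" using u(3,4)[of x] by (simp add: less_le)
  qed
  have limit: "(\<lambda>n. \<integral>x. g n x * u x \<partial>M) \<longlonglongrightarrow> 0"
  proof (rule LIMSEQ_I)
    fix e :: real assume e: "0 < e"
    \<comment> \<open>A Dini-type argument: points of \<open>F n\<close> with
      \<open>u \<ge> e / 2\<close> would accumulate at a point of \<open>E\<close>, where the
      continuous \<open>u\<close> vanishes.\<close>
    have "\<exists>n. \<forall>x\<in>F n. u x < e / 2"
    proof (rule ccontr)
      assume "\<not> ?thesis"
      then have "\<forall>n. \<exists>x\<in>F n. e / 2 \<le> u x" by (simp add: not_less)
      then obtain y where y: "\<And>n. y n \<in> F n" "\<And>n. e / 2 \<le> u (y n)" by metis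
      have Fk: "F n \<subseteq> F k" if "k \<le> n" for k n using dec that by (auto simp: decseq_def)
      obtain l k where l: "l \<in> F 0" "strict_mono k" "(y \<circ> k) \<longlonglongrightarrow> l"
        using Fc(1)[of 0] y(1) Fk[of 0] unfolding compact_def by (metis le0 subset_iff)
      have "l \<in> F n" for n
      proof (rule Lim_in_closed_set[OF compact_imp_closed[OF Fc(1)] _ _ l(3)])
        show "\<forall>\<^sub>F i in sequentially. (y \<circ> k) i \<in> F n"
        proof (rule eventually_sequentiallyI[of n])
          fix i assume "n \<le> i"
          then have "n \<le> k i" using seq_suble[OF l(2), of i] by linarith
          then show "(y \<circ> k) i \<in> F n" using y(1)[of "k i"] Fk by auto
        qed
      qed simp
      then have lE: "l \<in> E" by (simp add: E_def)
      have ls: "l \<in> space M" using lE E by auto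
      have ys: "y (k n) \<in> space M" for n using y(1) Fc(2) F0(2) by blast
      have "(\<lambda>n. u ((y \<circ> k) n)) \<longlonglongrightarrow> u l"
        by (rule continuous_on_tendsto_compose[OF u(2) l(3) ls]) (use ys in auto)
      then have "e / 2 \<le> u l" by (rule LIMSEQ_le_const) (use y(2) in auto)
      then show False using u(4)[OF ls] lE e by simp
    qed
    then obtain n0 where n0: "\<forall>x\<in>F n0. u x < e / 2" by blast
    have "norm ((\<integral>x. g n x * u x \<partial>M) - 0) < e" if n: "n0 \<le> n" for n
    proof -
      have sub: "F n \<subseteq> F n0" using dec n by (auto simp: decseq_def)
      have gu: "integrable M (\<lambda>x. g n x * u x)"
        by (rule bounded_mult_integrable[OF gm _ u(1), of _ "B n"]) (use gb in auto)
      have "0 \<le> (\<integral>x. g n x * u x \<partial>M)"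
        using gb u(3) by (intro integral_nonneg_AE AE_I2) auto
      moreover have "(\<integral>x. g n x * u x \<partial>M) \<le> (\<integral>x. g n x * (e / 2) \<partial>M)"
      proof (rule integral_mono[OF gu])
        show "integrable M (\<lambda>x. g n x * (e / 2))" using gi by simp
        show "g n x * u x \<le> g n x * (e / 2)" for x
        proof (cases "x \<in> F n")
          case True
          then have "u x \<le> e / 2" using n0 sub by (meson less_imp_le subsetD)
          then show ?thesis using gb(1)[of n x] by (rule mult_left_mono)
        qed (simp add: goff)
      qed
      ultimately show ?thesis using e g1[of n] by simp
    qed
    then show "\<exists>no. \<forall>n\<ge>no. norm ((\<integral>x. g n x * u x \<partial>M) - 0) < e" by blast
  qed
  \<comment> \<open>Every density has total mass 1 and is supported in \<open>F0\<close>, where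
    \<open>p \<ge> cp\<close>.\<close>
  have plateau: "cp \<le> (\<integral>x. g n x * p x \<partial>M)" for n
  proof -
    have gp: "integrable M (\<lambda>x. g n x * p x)"
      by (rule bounded_mult_integrable[OF gm _ p(1), of _ "B n"]) (use gb in auto)
    have "(\<integral>x. g n x * cp \<partial>M) \<le> (\<integral>x. g n x * p x \<partial>M)"
    proof (rule integral_mono[OF _ gp])
      show "integrable M (\<lambda>x. g n x * cp)" using gi by simp
      show "g n x * cp \<le> g n x * p x" for x
        using gb(1)[of n x] goff[of x n] p(3)[of x] Fc(2)[of n]
        by (cases "x \<in> F n") (auto intro!: mult_left_mono)
    qed
    then show ?thesis using g1[of n] by simp
  qed
  show ?thesis
  proof (rule non_polyhedric_criterion[where u = u and g = g and B = B and p = p and c = cp])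
    show "\<bar>(\<integral>x. g (Suc n) x * z x \<partial>M) - (\<integral>x. g n x * z x \<partial>M)\<bar> \<le> (1/2) ^ n * N z"
      if "z \<in> V" for n z using that by (rule step(3))
  qed (fact u(1) upos gm gb limit p(1,2) plateau)+
qed

end

section \<open>Quadratic energies\<close>

text \<open>Squared norms with values in \<open>ennreal\<close>, defined on all of \<open>S\<close>.
  The factor 2 is \<open>(a + b)^2 \<le> 2 * a^2 + 2 * b^2\<close> under an integral; it makes the
  vectors of finite energy a subspace.\<close>

locale energy =
  fixes Q :: "'w::real_vector \<Rightarrow> ennreal" and S :: "'w set"
  assumes S_zero: "0 \<in> S"
    and S_add: "\<And>x y. x \<in> S \<Longrightarrow> y \<in> S \<Longrightarrow> x + y \<in> S"
    and S_scale: "\<And>c x. x \<in> S \<Longrightarrow> c *\<^sub>R x \<in> S"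
    and Q_scale: "\<And>c x. x \<in> S \<Longrightarrow> Q (c *\<^sub>R x) = ennreal (c\<^sup>2) * Q x"
    and Q_add: "\<And>x y. x \<in> S \<Longrightarrow> y \<in> S \<Longrightarrow> Q (x + y) \<le> 2 * Q x + 2 * Q y"
begin

definition carrier :: "'w set" where "carrier = {x \<in> S. Q x < \<infinity>}"
definition norm_of :: "'w \<Rightarrow> real" where "norm_of x = sqrt (enn2real (Q x))"

lemma norm_of_square: "x \<in> carrier \<Longrightarrow> ennreal ((norm_of x)\<^sup>2) = Q x"
  by (simp add: norm_of_def carrier_def)

lemma norm_of_nonneg: "0 \<le> norm_of x"
  by (simp add: norm_of_def)

lemma norm_of_scale: "x \<in> S \<Longrightarrow> norm_of (c *\<^sub>R x) = \<bar>c\<bar> * norm_of x"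
  by (simp add: norm_of_def Q_scale enn2real_mult real_sqrt_mult)

lemma carrier_add: "x \<in> carrier \<Longrightarrow> y \<in> carrier \<Longrightarrow> x + y \<in> carrier"
  unfolding carrier_def
  by (auto intro!: S_add le_less_trans[OF Q_add] simp: ennreal_mult_less_top)

lemma carrier_scale: "x \<in> carrier \<Longrightarrow> c *\<^sub>R x \<in> carrier"
  unfolding carrier_def by (auto intro!: S_scale simp: Q_scale ennreal_mult_less_top)

lemma carrier_zero: "0 \<in> carrier"
  using Q_scale[OF S_zero, of 0] by (simp add: carrier_def S_zero)

lemma carrier_diff: "x \<in> carrier \<Longrightarrow> y \<in> carrier \<Longrightarrow> x - y \<in> carrier"
  using carrier_add[of x "(-1) *\<^sub>R y"] carrier_scale[of y "-1"] by simp

lemma norm_of_add: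
  assumes "x \<in> carrier" "y \<in> carrier"
  shows "(norm_of (x + y))\<^sup>2 \<le> 2 * (norm_of x)\<^sup>2 + 2 * (norm_of y)\<^sup>2"
proof -
  have "ennreal ((norm_of (x + y))\<^sup>2) \<le> 2 * ennreal ((norm_of x)\<^sup>2) + 2 * ennreal ((norm_of y)\<^sup>2)"
    using assms carrier_add[OF assms] Q_add[of x y] by (simp add: norm_of_square carrier_def)
  also have "\<dots> = ennreal (2 * (norm_of x)\<^sup>2 + 2 * (norm_of y)\<^sup>2)"
    by (simp add: ennreal_mult)
  finally show ?thesis by (subst (asm) ennreal_le_iff) auto
qed

lemma carrier_seminormed: "seminormed_carrier carrier norm_of"
proof
  show "norm_of (c *\<^sub>R x) = \<bar>c\<bar> * norm_of x" if "x \<in> carrier" for c x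
    using that by (simp add: norm_of_scale carrier_def)
qed (rule carrier_zero norm_of_nonneg | erule (1) carrier_add | erule carrier_scale)+

text \<open>Closures of subspaces stay subspaces. With the quasi-triangle inequality, tolerances
  \<open>e / 3\<close> suffice for sums, because \<open>4 * (e / 3)^2 < e^2\<close>.\<close>

lemma closure_seminormed:
  assumes T: "T \<subseteq> carrier" "0 \<in> T" "\<And>x y. x \<in> T \<Longrightarrow> y \<in> T \<Longrightarrow> x + y \<in> T"
    "\<And>c x. x \<in> T \<Longrightarrow> c *\<^sub>R x \<in> T"
  shows "seminormed_carrier (norm_closure carrier norm_of T) norm_of"
    and "T \<subseteq> norm_closure carrier norm_of T"
proof -
  have N0: "norm_of 0 = 0" using norm_of_scale[OF S_zero, of 0] by simp
  show sub: "T \<subseteq> norm_closure carrier norm_of T"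
    using T(1) N0 by (force simp: norm_closure_def)
  show "seminormed_carrier (norm_closure carrier norm_of T) norm_of"
  proof
    show "0 \<in> norm_closure carrier norm_of T" using sub T(2) by blast
    fix x assume x: "x \<in> norm_closure carrier norm_of T"
    then have xc: "x \<in> carrier" by (simp add: norm_closure_def)
    show "0 \<le> norm_of x" by (rule norm_of_nonneg)
    show "norm_of (c *\<^sub>R x) = \<bar>c\<bar> * norm_of x" for c
      using xc by (simp add: norm_of_scale carrier_def)
    show "c *\<^sub>R x \<in> norm_closure carrier norm_of T" for c
      unfolding norm_closure_def
    proof (intro CollectI conjI allI impI)
      show "c *\<^sub>R x \<in> carrier" by (rule carrier_scale[OF xc])
      fix e :: real assume e: "0 < e"
      then obtain a where a: "a \<in> T" "norm_of (x - a) < e / (\<bar>c\<bar> + 1)"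
        using x by (auto simp: norm_closure_def dest!: spec[of _ "e / (\<bar>c\<bar> + 1)"])
      have "norm_of (c *\<^sub>R x - c *\<^sub>R a) = \<bar>c\<bar> * norm_of (x - a)"
        using carrier_diff[OF xc, of a] T(1) a(1)
        by (subst norm_of_scale[symmetric]) (auto simp: scaleR_diff_right carrier_def)
      also have "\<dots> \<le> \<bar>c\<bar> * (e / (\<bar>c\<bar> + 1))" using a(2) by (intro mult_left_mono) auto
      also have "\<dots> < e" using e by (simp add: field_simps)
      finally show "\<exists>a\<in>T. norm_of (c *\<^sub>R x - a) < e" using T(4)[OF a(1)] by blast
    qed
    fix y assume y: "y \<in> norm_closure carrier norm_of T"
    then have yc: "y \<in> carrier" by (simp add: norm_closure_def)
    show "x + y \<in> norm_closure carrier norm_of T"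
      unfolding norm_closure_def
    proof (intro CollectI conjI allI impI)
      show "x + y \<in> carrier" by (rule carrier_add[OF xc yc])
      fix e :: real assume e: "0 < e"
      obtain a where a: "a \<in> T" "norm_of (x - a) < e / 3"
        using x e by (auto simp: norm_closure_def dest!: spec[of _ "e / 3"])
      obtain b where b: "b \<in> T" "norm_of (y - b) < e / 3"
        using y e by (auto simp: norm_closure_def dest!: spec[of _ "e / 3"])
      have "(norm_of ((x - a) + (y - b)))\<^sup>2 \<le> 2 * (norm_of (x - a))\<^sup>2 + 2 * (norm_of (y - b))\<^sup>2"
        using T(1) a b xc yc by (intro norm_of_add carrier_diff) auto
      also have "\<dots> \<le> 2 * (e / 3)\<^sup>2 + 2 * (e / 3)\<^sup>2"
        using less_imp_le[OF a(2)] less_imp_le[OF b(2)] norm_of_nonneg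
        by (intro add_mono mult_left_mono power_mono) auto
      also have "\<dots> < e\<^sup>2" using e by (simp add: power2_eq_square)
      finally have "norm_of ((x - a) + (y - b)) < e" using e by (intro power_less_imp_less_base[of _ 2 e]) auto
      then have "norm_of (x + y - (a + b)) < e" by (simp add: algebra_simps)
      then show "\<exists>a\<in>T. norm_of (x + y - a) < e" using T(3)[OF a(1) b(1)] by blast
    qed
  qed
qed

end

lemma square_add_le: "(a + b)\<^sup>2 \<le> 2 * a\<^sup>2 + 2 * (b::real)\<^sup>2"
  using sum_squares_bound[of a b] by (simp add: power2_sum)

lemma ennreal_square_add_le:
  fixes a b k :: real
  assumes "0 \<le> k"
  shows "ennreal ((a + b)\<^sup>2 * k) \<le> 2 * ennreal (a\<^sup>2 * k) + 2 * ennreal (b\<^sup>2 * k)"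
proof -
  have "(a + b)\<^sup>2 * k \<le> (2 * a\<^sup>2 + 2 * b\<^sup>2) * k" by (rule mult_right_mono[OF square_add_le assms])
  then have "ennreal ((a + b)\<^sup>2 * k) \<le> ennreal (2 * (a\<^sup>2 * k) + 2 * (b\<^sup>2 * k))"
    by (intro ennreal_leI) (simp add: algebra_simps)
  also have "\<dots> = 2 * ennreal (a\<^sup>2 * k) + 2 * ennreal (b\<^sup>2 * k)"
    using assms by (simp add: ennreal_mult)
  finally show ?thesis .
qed

lemma L2_sq_scale:
  assumes "u \<in> borel_measurable M"
  shows "L2_sq M (c *\<^sub>R u) = ennreal (c\<^sup>2) * L2_sq M u"
  unfolding L2_sq_def using assms
  by (subst nn_integral_cmult[symmetric]) (auto simp: power_mult_distrib ennreal_mult)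

lemma L2_sq_add:
  assumes [measurable]: "u \<in> borel_measurable M" "v \<in> borel_measurable M"
  shows "L2_sq M (u + v) \<le> 2 * L2_sq M u + 2 * L2_sq M v"
proof -
  have "L2_sq M (u + v) \<le> (\<integral>\<^sup>+x. 2 * ennreal ((u x)\<^sup>2) + 2 * ennreal ((v x)\<^sup>2) \<partial>M)"
    unfolding L2_sq_def using ennreal_square_add_le[of 1] by (intro nn_integral_mono) simp
  also have "\<dots> = 2 * L2_sq M u + 2 * L2_sq M v"
    unfolding L2_sq_def by (simp add: nn_integral_add nn_integral_cmult)
  finally show ?thesis .
qed

lemma measurable_space_subspace:
  "0 \<in> borel_measurable M"
  "u \<in> borel_measurable M \<Longrightarrow> v \<in> borel_measurable M \<Longrightarrow> u + v \<in> borel_measurable M"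
  "u \<in> borel_measurable M \<Longrightarrow> c *\<^sub>R u \<in> borel_measurable M"
  for u v :: "'a \<Rightarrow> real"
  by (simp_all add: plus_fun_def scaleR_fun_def zero_fun_def)

lemma ennreal_term_le_suminf: "f j \<le> (\<Sum>k. f k)" for f :: "nat \<Rightarrow> ennreal"
  using sum_le_suminf[of f "{j}"] by simp

section \<open>Slobodeckij energies under a growth bound\<close>

context growth_measure
begin

lemma slobodeckij_scale:
  assumes [measurable]: "u \<in> borel_measurable M"
  shows "slobodeckij_sq a s M (c *\<^sub>R u) = ennreal (c\<^sup>2) * slobodeckij_sq a s M u"
proof -
  have "(c * u x - c * u y)\<^sup>2 / dist x y powr (a + 2 * s) = c\<^sup>2 * ((u x - u y)\<^sup>2 / dist x y powr (a + 2 * s))" for x y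
    by (simp add: right_diff_distrib[symmetric] power_mult_distrib)
  then show ?thesis unfolding slobodeckij_sq_def scaleR_fun_apply real_scaleR_def
    by (simp only: ennreal_mult'[OF zero_le_power2]) (simp add: nn_integral_cmult)
qed

lemma slobodeckij_add:
  assumes [measurable]: "u \<in> borel_measurable M" "v \<in> borel_measurable M"
  shows "slobodeckij_sq a s M (u + v) \<le> 2 * slobodeckij_sq a s M u + 2 * slobodeckij_sq a s M v"
proof -
  have "slobodeckij_sq a s M (u + v)
    \<le> (\<integral>\<^sup>+x. \<integral>\<^sup>+y. 2 * ennreal ((u x - u y)\<^sup>2 / dist x y powr (a + 2 * s))
        + 2 * ennreal ((v x - v y)\<^sup>2 / dist x y powr (a + 2 * s)) \<partial>M \<partial>M)"
    unfolding slobodeckij_sq_def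
  proof (intro nn_integral_mono)
    fix x y
    have eq: "(u + v) x - (u + v) y = (u x - u y) + (v x - v y)" by simp
    show "ennreal (((u + v) x - (u + v) y)\<^sup>2 / dist x y powr (a + 2 * s))
      \<le> 2 * ennreal ((u x - u y)\<^sup>2 / dist x y powr (a + 2 * s))
        + 2 * ennreal ((v x - v y)\<^sup>2 / dist x y powr (a + 2 * s))"
      unfolding eq using ennreal_square_add_le[of "1 / dist x y powr (a + 2 * s)"] by simp
  qed
  also have "\<dots> = 2 * slobodeckij_sq a s M u + 2 * slobodeckij_sq a s M v"
    unfolding slobodeckij_sq_def by (simp add: nn_integral_add nn_integral_cmult)
  finally show ?thesis .
qed

text \<open>For \<open>dist x y < d\<close> off the diagonal the kernel is at least
  \<open>1 / d powr (a + 2 * s)\<close>. On the diagonal both integrands vanish, the quotient being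
  \<open>0 / 0 = 0\<close>.\<close>

lemma slobodeckij_osc:
  assumes [measurable]: "u \<in> borel_measurable M" and d: "0 < d" and a: "0 \<le> a + 2 * s"
  shows "(\<integral>\<^sup>+x. \<integral>\<^sup>+y. ennreal ((u x - u y)\<^sup>2) * indicator (ball x d) y \<partial>M \<partial>M)
    \<le> ennreal (d powr (a + 2 * s)) * slobodeckij_sq a s M u"
proof -
  have "(\<integral>\<^sup>+x. \<integral>\<^sup>+y. ennreal ((u x - u y)\<^sup>2) * indicator (ball x d) y \<partial>M \<partial>M)
    \<le> (\<integral>\<^sup>+x. \<integral>\<^sup>+y. ennreal (d powr (a + 2 * s)) * ennreal ((u x - u y)\<^sup>2 / dist x y powr (a + 2 * s)) \<partial>M \<partial>M)"
  proof (intro nn_integral_mono)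
    fix x y
    show "ennreal ((u x - u y)\<^sup>2) * indicator (ball x d) y
      \<le> ennreal (d powr (a + 2 * s)) * ennreal ((u x - u y)\<^sup>2 / dist x y powr (a + 2 * s))"
    proof (cases "dist x y < d \<and> x \<noteq> y")
      case True
      then have "dist x y powr (a + 2 * s) \<le> d powr (a + 2 * s)" "0 < dist x y powr (a + 2 * s)"
        using a by (auto intro: powr_mono2)
      then have "(u x - u y)\<^sup>2 \<le> d powr (a + 2 * s) * ((u x - u y)\<^sup>2 / dist x y powr (a + 2 * s))"
        by (simp add: pos_le_divide_eq mult.commute mult_left_mono)
      then show ?thesis by (simp add: ennreal_mult'[symmetric] ennreal_leI indicator_def)
    qed (auto simp: indicator_def)
  qed
  also have "\<dots> = ennreal (d powr (a + 2 * s)) * slobodeckij_sq a s M u"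
    unfolding slobodeckij_sq_def by (simp add: nn_integral_cmult)
  finally show ?thesis .
qed

text \<open>The kernel is split over dyadic annuli; the growth bound makes the pieces a geometric series.\<close>

lemma kernel_integral_bounded:
  assumes b: "b < real m"
  shows "\<exists>K. \<forall>x\<in>space M. (\<integral>\<^sup>+y. ennreal (dist x y powr (- b)) \<partial>M) \<le> ennreal K"
proof -
  obtain R where R: "0 < R" "\<And>x y. x \<in> space M \<Longrightarrow> y \<in> space M \<Longrightarrow> dist x y < R"
  proof -
    obtain B where "\<And>x y. x \<in> space M \<Longrightarrow> y \<in> space M \<Longrightarrow> dist x y \<le> B"
      using space_bounded bounded_two_points by metis
    then show ?thesis by (intro that[of "\<bar>B\<bar> + 1"]) force+
  qed
  define r where "r k = R / 2 ^ k" for k :: nat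
  have r: "0 < r k" for k using R by (simp add: r_def)
  \<comment> \<open>Dominates \<open>t powr (- b)\<close> on the annulus for either sign of
    \<open>b\<close>: a decreasing power is largest at the inner radius \<open>r k / 2\<close>, an
    increasing one at \<open>r k\<close>.\<close>
  define c where "c k = 2 powr \<bar>b\<bar> * r k powr (- b)" for k
  have c: "0 \<le> c k" for k by (simp add: c_def)
  have pt: "t powr (- b) \<le> c k" if t: "r (Suc k) \<le> t" "t < r k" for t k
  proof -
    have t0: "0 < t" using t(1) r[of "Suc k"] by linarith
    have half: "r (Suc k) = r k / 2" by (simp add: r_def)
    show ?thesis
    proof (cases "0 \<le> b")
      case True
      have "t powr (- b) \<le> (r k / 2) powr (- b)"
        using t r[of k] True unfolding half by (intro powr_mono2') auto
      also have "\<dots> = c k" using True r[of k] by (simp add: c_def powr_divide powr_minus field_simps)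
      finally show ?thesis .
    next
      case False
      have "t powr (- b) \<le> r k powr (- b)" using t t0 False by (intro powr_mono2) auto
      also have "\<dots> \<le> c k" using ge_one_powr_ge_zero[of 2 "\<bar>b\<bar>"]
        by (simp add: c_def mult_le_cancel_right1)
      finally show ?thesis .
    qed
  qed
  \<comment> \<open>The ratio between consecutive annuli, below 1 because
    \<open>b < m\<close>.\<close>
  define q where "q = 1 / 2 powr (real m - b)"
  have q: "0 < q" "q < 1" using b by (auto simp: q_def)
  have geo: "c k * (C * r k ^ m) = 2 powr \<bar>b\<bar> * C * R powr (real m - b) * q ^ k" for k
  proof -
    have "r k powr (- b) * r k ^ m = r k powr (real m - b)"
      using r[of k] by (simp add: powr_realpow[symmetric] powr_add[symmetric])
    also have "\<dots> = R powr (real m - b) / (2 ^ k) powr (real m - b)"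
      using R by (simp add: r_def powr_divide)
    also have "(2 ^ k) powr (real m - b) = (2 powr (real m - b)) ^ k"
      by (simp add: powr_realpow[symmetric] powr_powr mult.commute)
    finally show ?thesis by (simp add: c_def q_def power_one_over field_simps)
  qed
  define K where "K = 2 powr \<bar>b\<bar> * C * R powr (real m - b) * (1 / (1 - q))"
  have "(\<integral>\<^sup>+y. ennreal (dist x y powr (- b)) \<partial>M) \<le> ennreal K" if x: "x \<in> space M" for x
  proof -
    have "(\<integral>\<^sup>+y. ennreal (dist x y powr (- b)) \<partial>M)
      \<le> (\<integral>\<^sup>+y. (\<Sum>k. ennreal (c k) * indicator (ball x (r k) \<inter> space M) y) \<partial>M)"
    proof (rule nn_integral_mono)
      fix y assume y: "y \<in> space M"
      show "ennreal (dist x y powr (- b)) \<le> (\<Sum>k. ennreal (c k) * indicator (ball x (r k) \<inter> space M) y)"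
      proof (cases "x = y")
        case False
        then have t: "0 < dist x y / R" using R by simp
        have ex: "\<exists>k. r k \<le> dist x y"
        proof -
          obtain k where "(1/2) ^ k < dist x y / R" using real_arch_pow_inv[OF t, of "1/2"] by auto
          then show ?thesis using R by (intro exI[of _ k]) (simp add: r_def power_one_over field_simps)
        qed
        define k where "k = (LEAST k. r k \<le> dist x y)"
        have k: "r k \<le> dist x y" unfolding k_def using ex by (rule LeastI_ex)
        have "k \<noteq> 0" using k R(2)[OF x y] by (intro notI) (simp add: r_def)
        then obtain j where j: "k = Suc j" by (cases k) auto
        have "dist x y < r j" using not_less_Least[of j "\<lambda>k. r k \<le> dist x y"] j k_def by auto
        then have "ennreal (dist x y powr (- b)) \<le> ennreal (c j) * indicator (ball x (r j) \<inter> space M) y"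
          using pt[of j "dist x y"] k j y by (simp add: ennreal_leI)
        also have "\<dots> \<le> (\<Sum>k. ennreal (c k) * indicator (ball x (r k) \<inter> space M) y)"
          by (rule ennreal_term_le_suminf)
        finally show ?thesis .
      qed simp
    qed
    also have "\<dots> = (\<Sum>k. \<integral>\<^sup>+y. ennreal (c k) * indicator (ball x (r k) \<inter> space M) y \<partial>M)"
      by (intro nn_integral_suminf) measurable
    also have "\<dots> = (\<Sum>k. ennreal (c k) * ennreal (measure M (ball x (r k) \<inter> space M)))"
      by (simp add: nn_integral_cmult_indicator emeasure_eq_measure)
    also have "\<dots> \<le> (\<Sum>k. ennreal (2 powr \<bar>b\<bar> * C * R powr (real m - b) * q ^ k))"
    proof (intro suminf_le allI)
      fix k
      have "ennreal (c k) * ennreal (measure M (ball x (r k) \<inter> space M)) \<le> ennreal (c k) * ennreal (C * r k ^ m)"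
        by (intro mult_left_mono ennreal_leI upper[OF x r]) auto
      also have "\<dots> = ennreal (c k * (C * r k ^ m))" using c by (intro ennreal_mult'[symmetric])
      finally show "ennreal (c k) * ennreal (measure M (ball x (r k) \<inter> space M))
        \<le> ennreal (2 powr \<bar>b\<bar> * C * R powr (real m - b) * q ^ k)" unfolding geo .
    qed auto
    also have "\<dots> = ennreal K"
    proof -
      have "(\<lambda>k. 2 powr \<bar>b\<bar> * C * R powr (real m - b) * q ^ k) sums K"
        unfolding K_def using q by (intro sums_mult geometric_sums) auto
      then show ?thesis using C_pos q
        by (subst suminf_ennreal2) (auto simp: sums_iff)
    qed
    finally show ?thesis .
  qed
  then show ?thesis by blast
qed

text \<open>A Lipschitz bound turns the integrand into \<open>L^2 * dist x y powr (- b)\<close> with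
  \<open>b = m + 2 * s - 2\<close>, and \<open>s < 1\<close> means \<open>b < m\<close>. The
  constant is uniform in \<open>u\<close> and \<open>L\<close>, so small Lipschitz constants give
  small energies.\<close>

lemma slobodeckij_lipschitz:
  assumes s: "s < 1"
  shows "\<exists>K\<ge>0. \<forall>L u. 0 \<le> L \<longrightarrow> (\<forall>x\<in>space M. \<forall>y\<in>space M. \<bar>u x - u y\<bar> \<le> L * dist x y) \<longrightarrow>
    slobodeckij_sq (real m) s M u \<le> ennreal (K * L\<^sup>2)"
proof -
  define b where "b = real m + 2 * s - 2"
  obtain K where K: "\<forall>x\<in>space M. (\<integral>\<^sup>+y. ennreal (dist x y powr (- b)) \<partial>M) \<le> ennreal K"
    using kernel_integral_bounded[of b] s by (auto simp: b_def)
  have "slobodeckij_sq (real m) s M u \<le> ennreal (\<bar>K\<bar> * measure M (space M) * L\<^sup>2)"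
    if L: "0 \<le> L" and u: "\<forall>x\<in>space M. \<forall>y\<in>space M. \<bar>u x - u y\<bar> \<le> L * dist x y" for L u
  proof -
    have "slobodeckij_sq (real m) s M u \<le> (\<integral>\<^sup>+x. ennreal (L\<^sup>2) * ennreal \<bar>K\<bar> \<partial>M)"
      unfolding slobodeckij_sq_def
    proof (rule nn_integral_mono)
      fix x assume x: "x \<in> space M"
      have "(\<integral>\<^sup>+y. ennreal ((u x - u y)\<^sup>2 / dist x y powr (real m + 2 * s)) \<partial>M)
        \<le> (\<integral>\<^sup>+y. ennreal (L\<^sup>2) * ennreal (dist x y powr (- b)) \<partial>M)"
      proof (rule nn_integral_mono)
        fix y assume y: "y \<in> space M"
        show "ennreal ((u x - u y)\<^sup>2 / dist x y powr (real m + 2 * s)) \<le> ennreal (L\<^sup>2) * ennreal (dist x y powr (- b))"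
        proof (cases "x = y")
          case False
          have "\<bar>u x - u y\<bar>\<^sup>2 \<le> (L * dist x y)\<^sup>2" using u x y by (intro power_mono) auto
          then have "(u x - u y)\<^sup>2 / dist x y powr (real m + 2 * s) \<le> L\<^sup>2 * dist x y ^ 2 / dist x y powr (real m + 2 * s)"
            by (intro divide_right_mono) (auto simp: power_mult_distrib)
          also have "\<dots> = L\<^sup>2 * dist x y powr (- b)"
          proof -
            have "dist x y ^ 2 / dist x y powr (real m + 2 * s) = dist x y powr (2 - (real m + 2 * s))"
              using False by (simp add: powr_diff)
            also have "2 - (real m + 2 * s) = - b" by (simp add: b_def)
            finally show ?thesis by (simp only: times_divide_eq_right[symmetric])
          qed
          finally show ?thesis by (simp add: ennreal_mult'[symmetric] ennreal_leI)
        qed simp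
      qed
      also have "\<dots> = ennreal (L\<^sup>2) * (\<integral>\<^sup>+y. ennreal (dist x y powr (- b)) \<partial>M)"
        by (intro nn_integral_cmult) measurable
      also have "\<dots> \<le> ennreal (L\<^sup>2) * ennreal \<bar>K\<bar>"
        using bspec[OF K x] by (intro mult_left_mono) (auto intro: order_trans ennreal_leI)
      finally show "(\<integral>\<^sup>+y. ennreal ((u x - u y)\<^sup>2 / dist x y powr (real m + 2 * s)) \<partial>M)
        \<le> ennreal (L\<^sup>2) * ennreal \<bar>K\<bar>" .
    qed
    also have "\<dots> = ennreal (\<bar>K\<bar> * measure M (space M) * L\<^sup>2)"
      by (simp add: emeasure_eq_measure ennreal_mult ac_simps)
    finally show ?thesis .
  qed
  then show ?thesis by (intro exI[of _ "\<bar>K\<bar> * measure M (space M)"]) auto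
qed

lemma L2_sq_bounded:
  assumes "0 \<le> L" "\<And>x. x \<in> space M \<Longrightarrow> \<bar>u x\<bar> \<le> L"
  shows "L2_sq M u \<le> ennreal (measure M (space M) * L\<^sup>2)"
proof -
  have "L2_sq M u \<le> (\<integral>\<^sup>+x. ennreal (L\<^sup>2) \<partial>M)"
    unfolding L2_sq_def
  proof (rule nn_integral_mono, rule ennreal_leI)
    fix x assume "x \<in> space M"
    then have "\<bar>u x\<bar>\<^sup>2 \<le> L\<^sup>2" using assms by (intro power_mono) auto
    then show "(u x)\<^sup>2 \<le> L\<^sup>2" by simp
  qed
  also have "\<dots> = ennreal (measure M (space M) * L\<^sup>2)"
    by (simp add: emeasure_eq_measure ennreal_mult mult.commute)
  finally show ?thesis .
qed

end

section \<open>Hausdorff measure\<close>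

definition hausdorff_covers :: "real \<Rightarrow> 'a::euclidean_space set \<Rightarrow> (nat \<Rightarrow> 'a set) set" where
  "hausdorff_covers d A = {C. A \<subseteq> (\<Union>i. C i) \<and> (\<forall>i. bounded (C i) \<and> diameter (C i) \<le> d)}"

definition hausdorff_pre :: "nat \<Rightarrow> real \<Rightarrow> 'a::euclidean_space set \<Rightarrow> ennreal" where
  "hausdorff_pre m d A = (INF C\<in>hausdorff_covers d A. \<Sum>i. hausdorff_content m (C i))"

lemma hausdorff_outer_eq: "hausdorff_outer m A = (SUP d\<in>{0<..}. hausdorff_pre m d A)"
  by (simp add: hausdorff_outer_def hausdorff_pre_def hausdorff_covers_def)

lemma hausdorff_content_empty [simp]: "hausdorff_content m {} = 0"
  by (simp add: hausdorff_content_def)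

lemma hausdorff_pre_le:
  "A \<subseteq> (\<Union>i. C i) \<Longrightarrow> (\<And>i. bounded (C i)) \<Longrightarrow> (\<And>i. diameter (C i) \<le> d) \<Longrightarrow>
    hausdorff_pre m d A \<le> (\<Sum>i. hausdorff_content m (C i))"
  unfolding hausdorff_pre_def hausdorff_covers_def by (rule INF_lower) auto

lemma hausdorff_pre_le_outer: "0 < d \<Longrightarrow> hausdorff_pre m d A \<le> hausdorff_outer m A"
  unfolding hausdorff_outer_eq by (rule SUP_upper) auto

lemma hausdorff_pre_mono: "A \<subseteq> B \<Longrightarrow> hausdorff_pre m d A \<le> hausdorff_pre m d B"
  unfolding hausdorff_pre_def hausdorff_covers_def by (rule INF_superset_mono) auto

lemma hausdorff_pre_antimono: "d \<le> d' \<Longrightarrow> hausdorff_pre m d' A \<le> hausdorff_pre m d A"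
  unfolding hausdorff_pre_def hausdorff_covers_def by (rule INF_superset_mono) (auto intro: order_trans)

lemma hausdorff_outer_mono: "A \<subseteq> B \<Longrightarrow> hausdorff_outer m A \<le> hausdorff_outer m B"
  unfolding hausdorff_outer_eq by (intro SUP_mono) (auto intro: hausdorff_pre_mono)

lemma hausdorff_pre_empty: "0 \<le> d \<Longrightarrow> hausdorff_pre m d {} = 0"
  using hausdorff_pre_le[of "{}" "\<lambda>_. {}" d m] by simp

lemma hausdorff_outer_empty: "hausdorff_outer m {} = 0"
proof -
  have "hausdorff_outer m {} \<le> 0"
    unfolding hausdorff_outer_eq by (rule SUP_least) (simp add: hausdorff_pre_empty)
  then show ?thesis by simp
qed

text \<open>Near-optimal covers of the pieces, with total excess \<open>e\<close> spread
  geometrically, are merged into one sequence by the pairing function.\<close>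

lemma hausdorff_pre_subadditive:
  fixes A :: "nat \<Rightarrow> 'a::euclidean_space set"
  shows "hausdorff_pre m d (\<Union>i. A i) \<le> (\<Sum>i. hausdorff_pre m d (A i))"
proof (rule ennreal_le_epsilon)
  fix e :: real assume fin: "(\<Sum>i. hausdorff_pre m d (A i)) < top" and e: "0 < e"
  have fin': "hausdorff_pre m d (A i) \<noteq> \<infinity>" for i
  proof -
    have "hausdorff_pre m d (A i) < top"
      by (rule le_less_trans[OF ennreal_term_le_suminf fin])
    then show ?thesis by simp
  qed
  have "\<forall>i. \<exists>C. C \<in> hausdorff_covers d (A i) \<and>
    (\<Sum>j. hausdorff_content m (C j)) \<le> hausdorff_pre m d (A i) + ennreal (e * (1/2) ^ Suc i)"
  proof
    fix i
    have "\<exists>C\<in>hausdorff_covers d (A i). (\<Sum>j. hausdorff_content m (C j))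
        < hausdorff_pre m d (A i) + ennreal (e * (1/2) ^ Suc i)"
      by (rule INF_approx_ennreal[OF _ _ fin']) (use e in \<open>simp_all add: hausdorff_pre_def\<close>)
    then show "\<exists>C. C \<in> hausdorff_covers d (A i) \<and>
      (\<Sum>j. hausdorff_content m (C j)) \<le> hausdorff_pre m d (A i) + ennreal (e * (1/2) ^ Suc i)"
      by (auto intro: less_imp_le)
  qed
  then obtain C where C: "\<And>i. C i \<in> hausdorff_covers d (A i)"
    "\<And>i. (\<Sum>j. hausdorff_content m (C i j)) \<le> hausdorff_pre m d (A i) + ennreal (e * (1/2) ^ Suc i)"
    by metis
  define D where "D n = (case prod_decode n of (i, j) \<Rightarrow> C i j)" for n
  have "hausdorff_pre m d (\<Union>i. A i) \<le> (\<Sum>n. hausdorff_content m (D n))"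
  proof (rule hausdorff_pre_le)
    show "(\<Union>i. A i) \<subseteq> (\<Union>n. D n)"
    proof
      fix x assume "x \<in> (\<Union>i. A i)"
      then obtain i where "x \<in> A i" by blast
      then obtain j where "x \<in> C i j" using C(1)[of i] by (auto simp: hausdorff_covers_def)
      then have "x \<in> D (prod_encode (i, j))" by (simp add: D_def)
      then show "x \<in> (\<Union>n. D n)" by blast
    qed
    show "bounded (D n)" "diameter (D n) \<le> d" for n
      using C(1) by (auto simp: D_def hausdorff_covers_def split: prod.split)
  qed
  also have "\<dots> = (\<Sum>n. (\<lambda>(i, j). hausdorff_content m (C i j)) (prod_decode n))"
    by (rule arg_cong[where f = suminf]) (auto simp: D_def split: prod.split)
  also have "\<dots> = (\<Sum>i. \<Sum>j. hausdorff_content m (C i j))"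
    by (rule suminf_ennreal_2dimen) simp
  also have "\<dots> \<le> (\<Sum>i. hausdorff_pre m d (A i) + ennreal (e * (1/2) ^ Suc i))"
    by (intro suminf_le C(2)) auto
  also have "\<dots> = (\<Sum>i. hausdorff_pre m d (A i)) + (\<Sum>i. ennreal (e * (1/2) ^ Suc i))"
    by (intro suminf_add[symmetric]) auto
  also have "(\<Sum>i. ennreal (e * (1/2) ^ Suc i)) = ennreal e"
  proof -
    have "(\<lambda>i. e * (1/2) ^ Suc i) sums (e * 1)"
      by (intro sums_mult power_half_series)
    then show ?thesis using e by (subst suminf_ennreal2) (auto simp: sums_iff)
  qed
  finally show "hausdorff_pre m d (\<Union>i. A i) \<le> (\<Sum>i. hausdorff_pre m d (A i)) + ennreal e" .
qed

lemma hausdorff_outer_subadditive: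
  fixes A :: "nat \<Rightarrow> 'a::euclidean_space set"
  shows "hausdorff_outer m (\<Union>i. A i) \<le> (\<Sum>i. hausdorff_outer m (A i))"
  unfolding hausdorff_outer_eq[of m "\<Union>i. A i"]
proof (rule SUP_least)
  fix d :: real assume d: "d \<in> {0<..}"
  have "hausdorff_pre m d (\<Union>i. A i) \<le> (\<Sum>i. hausdorff_pre m d (A i))"
    by (rule hausdorff_pre_subadditive)
  also have "\<dots> \<le> (\<Sum>i. hausdorff_outer m (A i))"
    using d by (intro suminf_le hausdorff_pre_le_outer) auto
  finally show "hausdorff_pre m d (\<Union>i. A i) \<le> (\<Sum>i. hausdorff_outer m (A i))" .
qed

lemma hausdorff_outer_Un: "hausdorff_outer m (A \<union> B) \<le> hausdorff_outer m A + hausdorff_outer m B"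
proof -
  define S where "S i = (if i = 0 then A else if i = Suc 0 then B else {})" for i :: nat
  have "A \<union> B = (\<Union>i. S i)" by (auto simp: S_def split: if_splits)
  then have "hausdorff_outer m (A \<union> B) \<le> (\<Sum>i. hausdorff_outer m (S i))"
    by (simp add: hausdorff_outer_subadditive)
  also have "\<dots> = (\<Sum>i<2. hausdorff_outer m (S i))"
    by (rule suminf_finite) (auto simp: S_def hausdorff_outer_empty)
  also have "\<dots> = hausdorff_outer m A + hausdorff_outer m B"
    by (simp add: S_def numeral_2_eq_2)
  finally show ?thesis .
qed

text \<open>A covering set of diameter below the gap \<open>e\<close> meets at most one of the two
  sets, so a fine cover splits into two covers.\<close>

lemma hausdorff_outer_separated:
  assumes e: "0 < e" and sep: "\<And>x y. x \<in> A \<Longrightarrow> y \<in> B \<Longrightarrow> e \<le> dist x y"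
  shows "hausdorff_outer m A + hausdorff_outer m B \<le> hausdorff_outer m (A \<union> B)"
proof -
  have pre: "hausdorff_pre m d A + hausdorff_pre m d B \<le> hausdorff_pre m d (A \<union> B)" if d: "0 < d" "d < e" for d
    unfolding hausdorff_pre_def[of m d "A \<union> B"]
  proof (rule INF_greatest)
    fix C assume C: "C \<in> hausdorff_covers d (A \<union> B)"
    \<comment> \<open>Sets that do not meet \<open>S\<close> are replaced by the empty set, whose
      content is 0; the indexing is kept.\<close>
    define D where "D S i = (if C i \<inter> S = {} then {} else C i)" for S i
    have D: "hausdorff_pre m d S \<le> (\<Sum>i. hausdorff_content m (D S i))" if S: "S \<subseteq> A \<union> B" for S
    proof (rule hausdorff_pre_le)
      show "S \<subseteq> (\<Union>i. D S i)"
      proof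
        fix x assume x: "x \<in> S"
        have "A \<union> B \<subseteq> (\<Union>i. C i)" using C unfolding hausdorff_covers_def by blast
        with x S have "x \<in> (\<Union>i. C i)" by blast
        then obtain i where "x \<in> C i" by blast
        then have "x \<in> D S i" using x by (auto simp: D_def)
        then show "x \<in> (\<Union>i. D S i)" by blast
      qed
    qed (use C d in \<open>auto simp: hausdorff_covers_def D_def\<close>)
    have "hausdorff_pre m d A + hausdorff_pre m d B
      \<le> (\<Sum>i. hausdorff_content m (D A i)) + (\<Sum>i. hausdorff_content m (D B i))"
      by (intro add_mono D) auto
    also have "\<dots> = (\<Sum>i. hausdorff_content m (D A i) + hausdorff_content m (D B i))"
      by (intro suminf_add) auto
    also have "\<dots> \<le> (\<Sum>i. hausdorff_content m (C i))"
    proof (intro suminf_le allI)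
      fix i
      have "C i \<inter> A = {} \<or> C i \<inter> B = {}"
      proof (rule ccontr)
        assume "\<not> ?thesis"
        then obtain x y where xy: "x \<in> C i" "x \<in> A" "y \<in> C i" "y \<in> B" by blast
        have "dist x y \<le> diameter (C i)"
          using C xy by (intro diameter_bounded_bound) (auto simp: hausdorff_covers_def)
        also have "\<dots> \<le> d" using C by (auto simp: hausdorff_covers_def)
        finally show False using sep[OF xy(2,4)] d by linarith
      qed
      then show "hausdorff_content m (D A i) + hausdorff_content m (D B i) \<le> hausdorff_content m (C i)"
        by (auto simp: D_def)
    qed auto
    finally show "hausdorff_pre m d A + hausdorff_pre m d B \<le> (\<Sum>i. hausdorff_content m (C i))" .
  qed
  have "hausdorff_outer m A + hausdorff_outer m B
      = (SUP d\<in>{0<..}. hausdorff_pre m d A + hausdorff_pre m d B)"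
    unfolding hausdorff_outer_eq
  proof (rule SUP_add_directed_ennreal[symmetric])
    fix i j :: real assume "i \<in> {0<..}" "j \<in> {0<..}"
    then show "\<exists>k\<in>{0<..}. hausdorff_pre m i A + hausdorff_pre m j B \<le> hausdorff_pre m k A + hausdorff_pre m k B"
      by (intro bexI[of _ "min i j"] add_mono hausdorff_pre_antimono) auto
  qed
  also have "\<dots> \<le> hausdorff_outer m (A \<union> B)"
  proof (rule SUP_least)
    fix d :: real assume d: "d \<in> {0<..}"
    \<comment> \<open>A coarse scale is reduced to one below the gap, where the premeasures are at
      least as large.\<close>
    define k where "k = min d (e / 2)"
    have k: "0 < k" "k < e" "k \<le> d" using d e by (auto simp: k_def)
    have "hausdorff_pre m d A + hausdorff_pre m d B \<le> hausdorff_pre m k A + hausdorff_pre m k B"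
      using k by (intro add_mono hausdorff_pre_antimono)
    also have "\<dots> \<le> hausdorff_pre m k (A \<union> B)" by (rule pre[OF k(1,2)])
    also have "\<dots> \<le> hausdorff_outer m (A \<union> B)" by (rule hausdorff_pre_le_outer[OF k(1)])
    finally show "hausdorff_pre m d A + hausdorff_pre m d B \<le> hausdorff_outer m (A \<union> B)" .
  qed
  finally show ?thesis .
qed

text \<open>Induction splits off the piece of largest index, so the gap may shrink with the larger
  index of a pair.\<close>

lemma hausdorff_outer_sum_separated:
  assumes e: "\<And>n :: nat. 0 < e n"
    and sep: "\<And>k n x y. k < n \<Longrightarrow> x \<in> R k \<Longrightarrow> y \<in> R n \<Longrightarrow> e n \<le> dist x y"
  shows "(\<Sum>k<n. hausdorff_outer m (R k)) \<le> hausdorff_outer m (\<Union>k<n. R k)"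
proof (induction n)
  case (Suc n)
  have "(\<Sum>k<Suc n. hausdorff_outer m (R k)) \<le> hausdorff_outer m (\<Union>k<n. R k) + hausdorff_outer m (R n)"
    using Suc by (simp add: add_right_mono)
  also have "\<dots> \<le> hausdorff_outer m ((\<Union>k<n. R k) \<union> R n)"
    by (rule hausdorff_outer_separated[OF e[of n]]) (use sep in blast)
  also have "(\<Union>k<n. R k) \<union> R n = (\<Union>k<Suc n. R k)" by (auto simp: less_Suc_eq)
  finally show ?case .
qed simp

text \<open>Caratheodory's criterion: \<open>A - T\<close> is exhausted by the points at distance at least \<open>1/(n+1)\<close>,
  and every second layer in between is separated, which makes the remainders summable.\<close>

lemma hausdorff_outer_closed_split:
  assumes T: "closed T"
  shows "hausdorff_outer m (A \<inter> T) + hausdorff_outer m (A - T) \<le> hausdorff_outer m A"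
\<comment> \<open>The distance to the empty set is 0 by convention, and the summation argument wants
  a finite value; both exceptional cases are trivial.\<close>
proof (cases "T = {} \<or> hausdorff_outer m A = top")
  case True
  then show ?thesis by (auto simp: hausdorff_outer_empty)
next
  case False
  then have Tne: "T \<noteq> {}" and fin: "hausdorff_outer m A < top" by (auto simp: less_top)
  define f where "f x = infdist x T" for x
  have ft: "f x \<le> f y + dist x y" for x y unfolding f_def by (rule infdist_triangle)
  define B where "B n = {x \<in> A. 1 / real (Suc n) \<le> f x}" for n
  define R where "R n = B (Suc n) - B n" for n
  have R1: "1 / real (Suc (Suc n)) \<le> f x" "f x < 1 / real (Suc n)" if "x \<in> R n" for x n
    using that by (auto simp: R_def B_def not_le)
  have RA: "R n \<subseteq> A" for n by (auto simp: R_def B_def)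
  \<comment> \<open>Two layers of equal parity are separated by at least the thickness of a layer
    between them.\<close>
  have gap: "1 / real (Suc (Suc (a + 2 * k))) - 1 / real (Suc (a + 2 * n)) \<le> dist x y
    \<and> 1 / real (a + 2 * n) - 1 / real (Suc (a + 2 * n)) \<le> dist x y"
    if "k < n" "x \<in> R (a + 2 * k)" "y \<in> R (a + 2 * n)" for a k n x y
  proof -
    have 1: "1 / real (Suc (Suc (a + 2 * k))) - 1 / real (Suc (a + 2 * n)) \<le> dist x y"
      using R1(1)[OF that(2)] R1(2)[OF that(3)] ft[of x y] by linarith
    have "1 / real (a + 2 * n) \<le> 1 / real (Suc (Suc (a + 2 * k)))"
      using that(1) by (intro divide_left_mono) auto
    then show ?thesis using 1 by linarith
  qed
  have half: "(\<Sum>k<n. hausdorff_outer m (R (a + 2 * k))) \<le> hausdorff_outer m A" for a n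
  proof -
    \<comment> \<open>Index 0 has no earlier layer, so any positive value serves; the formula itself
      would give \<open>- 1\<close> there, since \<open>1 / 0 = 0\<close>.\<close>
    define e where "e n = (if a + 2 * n = 0 then 1 else 1 / real (a + 2 * n) - 1 / real (Suc (a + 2 * n)))" for n
    have "(\<Sum>k<n. hausdorff_outer m (R (a + 2 * k))) \<le> hausdorff_outer m (\<Union>k<n. R (a + 2 * k))"
    proof (rule hausdorff_outer_sum_separated[where e = e])
      show "0 < e n" for n by (auto simp: e_def field_simps)
      show "e n \<le> dist x y" if "k < n" "x \<in> R (a + 2 * k)" "y \<in> R (a + 2 * n)" for k n x y
        using gap[OF that] that(1) by (auto simp: e_def)
    qed
    also have "\<dots> \<le> hausdorff_outer m A" using RA by (intro hausdorff_outer_mono) blast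
    finally show ?thesis .
  qed
  have split: "(\<Sum>k<2 * n. g k) = (\<Sum>k<n. g (0 + 2 * k)) + (\<Sum>k<n. g (1 + 2 * k))" for n and g :: "nat \<Rightarrow> ennreal"
    by (induction n) (simp_all add: ac_simps)
  \<comment> \<open>Even and odd layers are summed separately, each family against the whole of
    \<open>A\<close>.\<close>
  have bound: "(\<Sum>k<n. hausdorff_outer m (R k)) \<le> hausdorff_outer m A + hausdorff_outer m A" for n
  proof -
    have "(\<Sum>k<n. hausdorff_outer m (R k)) \<le> (\<Sum>k<2 * n. hausdorff_outer m (R k))"
      by (intro sum_mono2) auto
    also have "\<dots> \<le> hausdorff_outer m A + hausdorff_outer m A"
      unfolding split by (intro add_mono half)
    finally show ?thesis .
  qed
  define r where "r k = enn2real (hausdorff_outer m (R k))" for k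
  have Rfin: "hausdorff_outer m (R k) < top" for k
    by (rule le_less_trans[OF hausdorff_outer_mono[OF RA] fin])
  have r: "ennreal (r k) = hausdorff_outer m (R k)" "0 \<le> r k" for k
    using Rfin[of k] by (simp_all add: r_def)
  define a where "a = enn2real (hausdorff_outer m A)"
  have a: "ennreal a = hausdorff_outer m A" "0 \<le> a" using fin by (simp_all add: a_def)
  have "(\<Sum>k<n. r k) \<le> a + a" for n
  proof -
    have "ennreal (\<Sum>k<n. r k) = (\<Sum>k<n. hausdorff_outer m (R k))"
      using r by (subst sum_ennreal[symmetric]) auto
    also have "\<dots> \<le> hausdorff_outer m A + hausdorff_outer m A" by (rule bound)
    also have "\<dots> = ennreal (a + a)" using a by (simp only: ennreal_plus)
    finally show ?thesis using a by (subst (asm) ennreal_le_iff) auto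
  qed
  then have sr: "summable r" using r(2) by (intro summableI_nonneg_bounded)
  show ?thesis
  proof (rule ennreal_le_epsilon)
    fix e :: real assume "0 < e"
    then obtain n where n: "norm (\<Sum>i. r (i + n)) < e" using suminf_exist_split[OF _ sr] by blast
    have tail: "(\<Sum>i. hausdorff_outer m (R (i + n))) \<le> ennreal e"
    proof -
      have "(\<Sum>i. hausdorff_outer m (R (i + n))) = (\<Sum>i. ennreal (r (i + n)))" by (simp add: r)
      also have "\<dots> = ennreal (\<Sum>i. r (i + n))"
        using sr r(2) by (intro suminf_ennreal2) (simp_all add: summable_iff_shift)
      also have "\<dots> \<le> ennreal e" using n by (intro ennreal_leI) auto
      finally show ?thesis .
    qed
    have "A - T \<subseteq> B n \<union> (\<Union>i. R (i + n))"
    proof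
      fix x assume x: "x \<in> A - T"
      then have "0 < f x"
        using T Tne infdist_nonneg[of x T] in_closed_iff_infdist_zero[OF T Tne, of x] by (auto simp: f_def less_le)
      then obtain j where "1 / real (Suc j) < f x" using reals_Archimedean by (auto simp: inverse_eq_divide)
      then have ex: "\<exists>j. x \<in> B j" using x by (auto simp: B_def intro: less_imp_le)
      define j where "j = (LEAST j. x \<in> B j)"
      have j: "x \<in> B j" unfolding j_def using ex by (rule LeastI_ex)
      show "x \<in> B n \<union> (\<Union>i. R (i + n))"
      proof (cases "j \<le> n")
        case True
        then have "1 / real (Suc n) \<le> 1 / real (Suc j)" by (intro divide_left_mono) auto
        then show ?thesis using j by (auto simp: B_def)
      next
        case False
        then obtain i where i: "j = Suc (i + n)" by (metis add.commute less_imp_Suc_add not_le)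
        have "x \<notin> B (i + n)" using not_less_Least[of "i + n" "\<lambda>j. x \<in> B j"] i j_def by auto
        then have "x \<in> R (i + n)" using j i by (simp add: R_def)
        then show ?thesis by blast
      qed
    qed
    then have "hausdorff_outer m (A - T) \<le> hausdorff_outer m (B n \<union> (\<Union>i. R (i + n)))"
      by (rule hausdorff_outer_mono)
    also have "\<dots> \<le> hausdorff_outer m (B n) + hausdorff_outer m (\<Union>i. R (i + n))"
      by (rule hausdorff_outer_Un)
    also have "\<dots> \<le> hausdorff_outer m (B n) + ennreal e"
      by (intro add_left_mono order_trans[OF hausdorff_outer_subadditive tail])
    finally have 1: "hausdorff_outer m (A - T) \<le> hausdorff_outer m (B n) + ennreal e" .
    have "hausdorff_outer m (A \<inter> T) + hausdorff_outer m (B n) \<le> hausdorff_outer m ((A \<inter> T) \<union> B n)"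
    proof (rule hausdorff_outer_separated[of "1 / real (Suc n)"])
      fix x y assume "x \<in> A \<inter> T" "y \<in> B n"
      then show "1 / real (Suc n) \<le> dist x y"
        using ft[of y x] by (simp add: B_def f_def dist_commute)
    qed simp
    also have "\<dots> \<le> hausdorff_outer m A" by (rule hausdorff_outer_mono) (auto simp: B_def)
    finally have 2: "hausdorff_outer m (A \<inter> T) + hausdorff_outer m (B n) \<le> hausdorff_outer m A" .
    have "hausdorff_outer m (A \<inter> T) + hausdorff_outer m (A - T)
      \<le> (hausdorff_outer m (A \<inter> T) + hausdorff_outer m (B n)) + ennreal e"
      using add_left_mono[OF 1] by (simp add: add.assoc)
    also have "\<dots> \<le> hausdorff_outer m A + ennreal e" by (rule add_right_mono[OF 2])
    finally show "hausdorff_outer m (A \<inter> T) + hausdorff_outer m (A - T) \<le> hausdorff_outer m A + ennreal e" .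
  qed
qed

text \<open>\<open>measure_of\<close> yields the zero measure unless the given function is a
  measure. The Caratheodory-measurable sets form a sigma-algebra containing the closed sets, hence
  all Borel sets.\<close>

lemma hausdorff_measure_space:
  "measure_space (UNIV :: 'a::euclidean_space set) (sets borel) (hausdorff_outer m)"
proof -
  interpret P: sigma_algebra "UNIV :: 'a set" "Pow UNIV" by (rule sigma_algebra_Pow)
  let ?f = "hausdorff_outer m :: 'a set \<Rightarrow> ennreal"
  have oms: "outer_measure_space (Pow UNIV) ?f"
    unfolding outer_measure_space_def positive_def increasing_def countably_subadditive_def
    by (auto simp: hausdorff_outer_empty hausdorff_outer_mono hausdorff_outer_subadditive)
  have ms: "measure_space UNIV (lambda_system UNIV (Pow UNIV) ?f) ?f"
    by (rule P.caratheodory_lemma[OF oms])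
  have "closed T \<Longrightarrow> T \<in> lambda_system UNIV (Pow UNIV) ?f" for T
  proof -
    assume T: "closed T"
    have "?f (x \<inter> T) + ?f (x - T) = ?f x" for x
    proof (rule antisym[OF hausdorff_outer_closed_split[OF T]])
      have "?f ((x \<inter> T) \<union> (x - T)) \<le> ?f (x \<inter> T) + ?f (x - T)" by (rule hausdorff_outer_Un)
      then show "?f x \<le> ?f (x \<inter> T) + ?f (x - T)" by (simp add: Int_Diff_Un)
    qed
    then show "T \<in> lambda_system UNIV (Pow UNIV) ?f" unfolding P.lambda_system_eq by auto
  qed
  then have "Collect closed \<subseteq> lambda_system UNIV (Pow UNIV) ?f" by blast
  moreover have "sigma_algebra UNIV (lambda_system UNIV (Pow UNIV) ?f)"
    using ms by (simp add: measure_space_def)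
  ultimately have "sigma_sets UNIV (Collect closed) \<subseteq> lambda_system UNIV (Pow UNIV) ?f"
    by (rule sigma_algebra.sigma_sets_subset[rotated])
  then have "sets borel \<subseteq> lambda_system UNIV (Pow UNIV) ?f"
    unfolding borel_eq_closed by simp
  then show ?thesis
    using sets.sigma_algebra_axioms[of "borel :: 'a measure"] by (intro measure_down[OF ms]) auto
qed

lemma space_hausdorff_measure [simp]: "space (hausdorff_measure m) = UNIV"
  by (simp add: hausdorff_measure_def space_measure_of_conv)

lemma sets_hausdorff_measure [simp]: "sets (hausdorff_measure m) = sets borel"
  using sets.sigma_sets_eq[of borel] by (simp add: hausdorff_measure_def sets_measure_of_conv)

lemma emeasure_hausdorff_measure:
  "A \<in> sets borel \<Longrightarrow> emeasure (hausdorff_measure m) A = hausdorff_outer m A"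
  using hausdorff_measure_space[of m] unfolding hausdorff_measure_def measure_space_def
  by (intro emeasure_measure_of_sigma) auto

section \<open>Lipschitz graphs are Ahlfors regular\<close>

lemma emeasure_lborel_ball:
  "0 \<le> r \<Longrightarrow> emeasure lborel (ball (x :: 'a::euclidean_space) r) = ennreal (unit_ball_vol DIM('a) * r ^ DIM('a))"
  by (rule emeasure_ball)

locale lipschitz_graph =
  fixes \<Omega> :: "'a::euclidean_space set" and p e :: 'a and r L :: real and \<gamma> :: "'a \<Rightarrow> real"
  assumes open_dom: "open \<Omega>" and e: "norm e = 1" and r: "0 < r"
    and lip: "L-lipschitz_on {z. z \<bullet> e = 0} \<gamma>"
    and graph: "\<Omega> \<inter> ball p r = {y \<in> ball p r. y \<bullet> e > \<gamma> (y - (y \<bullet> e) *\<^sub>R e)}"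
begin

text \<open>Signed height above the graph along \<open>e\<close>. It is Lipschitz with constant
  \<open>1 + L\<close>, and moving by \<open>t *\<^sub>R e\<close> raises it by exactly
  \<open>t\<close>; the geometry below rests on these two facts.\<close>

definition G :: "'a \<Rightarrow> real" where "G y = y \<bullet> e - \<gamma> (y - (y \<bullet> e) *\<^sub>R e)"

lemma L_nonneg: "0 \<le> L" using lip by (rule lipschitz_on_nonneg)

lemma ee: "e \<bullet> e = 1" using e by (simp add: dot_square_norm)

lemma G_shift: "G (y + t *\<^sub>R e) = G y + t"
  by (simp add: G_def inner_add_left ee scaleR_add_left)

lemma projection_norm: "norm (v - (v \<bullet> e) *\<^sub>R e) \<le> norm v"
proof -
  have "(norm (v - (v \<bullet> e) *\<^sub>R e))\<^sup>2 = (norm v)\<^sup>2 - (v \<bullet> e)\<^sup>2"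
    by (simp only: power2_norm_eq_inner)
      (simp add: inner_diff_left inner_diff_right ee inner_commute power2_eq_square)
  also have "\<dots> \<le> (norm v)\<^sup>2" by simp
  finally show ?thesis by (rule power2_le_imp_le) simp
qed

lemma G_lipschitz: "\<bar>G x - G y\<bar> \<le> (1 + L) * dist x y"
proof -
  define P where "P v = v - (v \<bullet> e) *\<^sub>R e" for v
  have mem: "P v \<in> {z. z \<bullet> e = 0}" for v by (simp add: P_def inner_diff_left ee)
  have "\<bar>\<gamma> (P x) - \<gamma> (P y)\<bar> \<le> L * dist (P x) (P y)"
    using lipschitz_onD[OF lip mem mem, of x y] by (simp add: dist_real_def)
  also have "\<dots> \<le> L * dist x y"
  proof (rule mult_left_mono[OF _ L_nonneg])
    have "P x - P y = (x - y) - ((x - y) \<bullet> e) *\<^sub>R e"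
      by (simp add: P_def inner_diff_left scaleR_diff_left)
    then show "dist (P x) (P y) \<le> dist x y" using projection_norm[of "x - y"] by (simp add: dist_norm)
  qed
  finally have 1: "\<bar>\<gamma> (P x) - \<gamma> (P y)\<bar> \<le> L * dist x y" .
  have "\<bar>(x - y) \<bullet> e\<bar> \<le> norm (x - y) * norm e" by (rule Cauchy_Schwarz_ineq2)
  then have 2: "\<bar>x \<bullet> e - y \<bullet> e\<bar> \<le> dist x y" by (simp add: e dist_norm inner_diff_left)
  have "\<bar>G x - G y\<bar> \<le> \<bar>x \<bullet> e - y \<bullet> e\<bar> + \<bar>\<gamma> (P x) - \<gamma> (P y)\<bar>" by (simp add: G_def P_def)
  then show ?thesis using 1 2 by (simp add: distrib_right)
qed

text \<open>A point of the closure cannot lie below the graph because \<open>G\<close> is Lipschitz;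
  a point of the graph is a limit of its upward translates, which lie in \<Omega>.\<close>

lemma frontier_iff:
  assumes y: "y \<in> ball p r"
  shows "y \<in> frontier \<Omega> \<longleftrightarrow> G y = 0"
proof -
  have dom: "z \<in> \<Omega> \<longleftrightarrow> 0 < G z" if "z \<in> ball p r" for z
    using graph that by (auto simp: G_def set_eq_iff)
  have fr: "frontier \<Omega> = closure \<Omega> - \<Omega>" using open_dom by (simp add: frontier_def interior_open)
  show ?thesis
  proof
    assume "y \<in> frontier \<Omega>"
    then have "y \<in> closure \<Omega>" "\<not> 0 < G y" using dom[OF y] by (auto simp: fr)
    moreover have "0 \<le> G y"
    proof (rule ccontr)
      assume neg: "\<not> 0 \<le> G y"
      \<comment> \<open>Dividing by \<open>2 + L\<close>, which exceeds the Lipschitz constant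
        \<open>1 + L\<close>, leaves no point within \<open>k\<close> of \<open>y\<close> with
        \<open>G > 0\<close>; the second term keeps such points in the chart ball.\<close>
      define k where "k = min (- G y / (2 + L)) (r - dist p y)"
      have "0 < - G y / (2 + L)" using neg L_nonneg by (intro divide_pos_pos) auto
      then have k: "0 < k" using y by (simp add: k_def)
      obtain z where z: "z \<in> \<Omega>" "dist z y < k"
        using \<open>y \<in> closure \<Omega>\<close> k unfolding closure_approachable by blast
      have "dist p z < r" using z(2) dist_triangle[of p z y] by (simp add: k_def dist_commute)
      then have "0 < G z" using dom[of z] z by simp
      moreover have "(1 + L) * dist z y \<le> (1 + L) * (- G y / (2 + L))"
        using z(2) L_nonneg by (intro mult_left_mono) (auto simp: k_def)
      moreover have "(1 + L) * (- G y / (2 + L)) \<le> - G y"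
        using neg L_nonneg by (simp add: field_simps)
      ultimately show False using G_lipschitz[of z y] by linarith
    qed
    ultimately show "G y = 0" by simp
  next
    assume G0: "G y = 0"
    have "y \<in> closure \<Omega>" unfolding closure_approachable
    proof (intro allI impI)
      fix k :: real assume k: "0 < k"
      define t where "t = min k (r - dist p y) / 2"
      have t: "0 < t" "t < k" "t < r - dist p y" using k y by (auto simp: t_def min_def)
      have d: "dist (y + t *\<^sub>R e) y = t" using t(1) by (simp add: dist_norm e)
      then have "y + t *\<^sub>R e \<in> ball p r"
        using t(3) dist_triangle[of p "y + t *\<^sub>R e" y] by (simp add: dist_commute)
      then have "y + t *\<^sub>R e \<in> \<Omega>" using dom G_shift[of y t] G0 t by simp
      then show "\<exists>z\<in>\<Omega>. dist z y < k" using d t(2) by (intro bexI[of _ "y + t *\<^sub>R e"]) simp_all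
    qed
    then show "y \<in> frontier \<Omega>" using dom[OF y] G0 by (simp add: fr)
  qed
qed

text \<open>The balls of radius \<open>d/2\<close> around a \<open>d\<close>-separated subset of the graph and their translates
  by multiples of \<open>2 (1 + L) d e\<close> are disjoint.\<close>

lemma separated_card:
  assumes S: "finite S" "S \<subseteq> frontier \<Omega> \<inter> ball p r \<inter> cball x R"
    and sep: "\<And>s t. s \<in> S \<Longrightarrow> t \<in> S \<Longrightarrow> s \<noteq> t \<Longrightarrow> d \<le> dist s t"
    and d: "0 < d" "d \<le> R"
  shows "real (card S) * d ^ (DIM('a) - 1) \<le> (12 + 8 * L) ^ DIM('a) * R ^ (DIM('a) - 1)"
proof -
  let ?D = "DIM('a)"
  define \<tau> where "\<tau> = 2 * ((1 + L) * d)"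
  have \<tau>: "0 < \<tau>" using d L_nonneg by (simp add: \<tau>_def)
  \<comment> \<open>Stacking about \<open>R / d\<close> translates, each raised by an amount of
    order \<open>d\<close>, fills a height of order \<open>R\<close>. The volume count thereby drops
    from \<open>d ^ D\<close> to \<open>d ^ (D - 1)\<close>, with \<open>D\<close> the
    dimension.\<close>
  define n where "n = nat \<lceil>R / d\<rceil>"
  have "1 \<le> R / d" using d by simp
  then have n: "R / d \<le> real n" "real n \<le> R / d + 1" unfolding n_def by linarith+
  define B where "B = (\<lambda>(s, k :: nat). ball (s + (real k * \<tau>) *\<^sub>R e) (d / 2))"
  define I where "I = S \<times> {..<n}"
  have G0: "G s = 0" if "s \<in> S" for s using frontier_iff[of s] S(2) that by blast
  have disj: "disjoint_family_on B I"
    unfolding disjoint_family_on_def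
  proof (intro ballI impI)
    fix u v assume uv: "u \<in> I" "v \<in> I" "u \<noteq> v"
    obtain s k t l where st: "u = (s, k)" "v = (t, l)" by (cases u, cases v) auto
    have s: "s \<in> S" "t \<in> S" using uv st by (auto simp: I_def)
    show "B u \<inter> B v = {}"
    proof (rule ccontr)
      assume "B u \<inter> B v \<noteq> {}"
      then obtain y where y: "dist (s + (real k * \<tau>) *\<^sub>R e) y < d / 2" "dist (t + (real l * \<tau>) *\<^sub>R e) y < d / 2"
        by (auto simp: B_def st)
      \<comment> \<open>A centre with index \<open>k\<close> has \<open>G = k * \<tau>\<close>, and
        \<open>G\<close> varies by less than \<open>\<tau> / 4\<close> within distance
        \<open>d / 2\<close>; a common point of two balls therefore forces equal indices.\<close>
      have near: "\<bar>G (w + (real j * \<tau>) *\<^sub>R e) - G y\<bar> < \<tau> / 4"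
        if "dist (w + (real j * \<tau>) *\<^sub>R e) y < d / 2" for w j
      proof -
        have "(1 + L) * dist (w + (real j * \<tau>) *\<^sub>R e) y < (1 + L) * (d / 2)"
          using that L_nonneg by (intro mult_strict_left_mono) auto
        moreover have "(1 + L) * (d / 2) = \<tau> / 4" by (simp add: \<tau>_def)
        ultimately show ?thesis using G_lipschitz[of "w + (real j * \<tau>) *\<^sub>R e" y] by linarith
      qed
      have "\<bar>real k * \<tau> - G y\<bar> < \<tau> / 4" "\<bar>real l * \<tau> - G y\<bar> < \<tau> / 4"
        using near[OF y(1)] near[OF y(2)] G0[OF s(1)] G0[OF s(2)] by (simp_all add: G_shift)
      then have "\<bar>real k * \<tau> - real l * \<tau>\<bar> < \<tau>" using \<tau> by linarith
      then have "\<bar>real k - real l\<bar> * \<tau> < 1 * \<tau>" using \<tau> by (simp add: left_diff_distrib[symmetric] abs_mult)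
      then have "\<bar>real k - real l\<bar> < 1" using \<tau> by (simp only: mult_less_cancel_right_pos)
      then have kl: "k = l" by linarith
      have "dist s t = dist (s + (real k * \<tau>) *\<^sub>R e) (t + (real l * \<tau>) *\<^sub>R e)" by (simp add: kl)
      also have "\<dots> < d" using dist_triangle2[of "s + (real k * \<tau>) *\<^sub>R e" "t + (real l * \<tau>) *\<^sub>R e" y] y
        by (simp add: dist_commute)
      finally have "s = t" using sep[OF s] by force
      then show False using uv st kl by simp
    qed
  qed
  \<comment> \<open>A generous radius: the distance to the base point, the height of the stack and
    the radius of a ball add up to at most \<open>R + 2 * (1 + L) * R + R\<close>.\<close>
  define \<rho> where "\<rho> = (6 + 4 * L) * R"
  have \<rho>: "0 \<le> \<rho>" using d L_nonneg by (simp add: \<rho>_def)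
  have sub: "(\<Union>i\<in>I. B i) \<subseteq> ball x \<rho>"
  proof
    fix y assume "y \<in> (\<Union>i\<in>I. B i)"
    then obtain s k where sk: "s \<in> S" "k < n" "dist (s + (real k * \<tau>) *\<^sub>R e) y < d / 2"
      by (auto simp: I_def B_def)
    have "real k * \<tau> \<le> (R / d) * \<tau>"
    proof (rule mult_right_mono)
      have "real k + 1 \<le> real n" using sk(2) by linarith
      then show "real k \<le> R / d" using n(2) by linarith
    qed (use \<tau> in simp)
    also have "\<dots> = 2 * (1 + L) * R" using d by (simp add: \<tau>_def)
    finally have kt: "real k * \<tau> \<le> 2 * (1 + L) * R" .
    have "dist x y \<le> dist x s + dist s (s + (real k * \<tau>) *\<^sub>R e) + dist (s + (real k * \<tau>) *\<^sub>R e) y"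
      using dist_triangle[of x y s] dist_triangle[of s y "s + (real k * \<tau>) *\<^sub>R e"] by linarith
    also have "dist s (s + (real k * \<tau>) *\<^sub>R e) = real k * \<tau>" using \<tau> by (simp add: dist_norm e)
    also have "dist x s \<le> R" using S(2) sk(1) by auto
    finally have "dist x y < R + 2 * (1 + L) * R + R" using kt sk(3) d by linarith
    also have "\<dots> \<le> \<rho>"
      using d L_nonneg by (simp add: \<rho>_def algebra_simps)
    finally show "y \<in> ball x \<rho>" by simp
  qed
  have "ennreal (real (card S) * real n * (unit_ball_vol ?D * (d / 2) ^ ?D)) = (\<Sum>i\<in>I. emeasure lborel (B i))"
  proof -
    have "emeasure lborel (B i) = ennreal (unit_ball_vol ?D * (d / 2) ^ ?D)" for i
      using d by (cases i) (simp add: B_def emeasure_lborel_ball)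
    then have "(\<Sum>i\<in>I. emeasure lborel (B i)) = of_nat (card I) * ennreal (unit_ball_vol ?D * (d / 2) ^ ?D)" by simp
    also have "\<dots> = ennreal (real (card I) * (unit_ball_vol ?D * (d / 2) ^ ?D))"
      using d by (simp add: ennreal_mult ennreal_of_nat_eq_real_of_nat)
    also have "card I = card S * n" by (simp add: I_def card_cartesian_product)
    finally show ?thesis by simp
  qed
  also have "\<dots> = emeasure lborel (\<Union>i\<in>I. B i)"
    using S(1) by (intro sum_emeasure disj) (auto simp: B_def I_def)
  also have "\<dots> \<le> emeasure lborel (ball x \<rho>)" by (rule emeasure_mono[OF sub]) simp
  also have "\<dots> = ennreal (unit_ball_vol ?D * \<rho> ^ ?D)" using \<rho> by (rule emeasure_lborel_ball)
  finally have "real (card S) * real n * (unit_ball_vol ?D * (d / 2) ^ ?D) \<le> unit_ball_vol ?D * \<rho> ^ ?D"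
    using \<rho> by (subst (asm) ennreal_le_iff) auto
  then have "unit_ball_vol ?D * (real (card S) * real n * (d / 2) ^ ?D) \<le> unit_ball_vol ?D * \<rho> ^ ?D"
    by (simp add: ac_simps)
  then have 1: "real (card S) * real n * (d / 2) ^ ?D \<le> \<rho> ^ ?D"
    by (subst (asm) mult_le_cancel_left_pos) auto
  have "real (card S) * (R / d) * d ^ ?D \<le> real (card S) * real n * d ^ ?D"
    using n d by (intro mult_right_mono mult_left_mono) auto
  also have "\<dots> = 2 ^ ?D * (real (card S) * real n * (d / 2) ^ ?D)" by (simp add: power_divide)
  also have "\<dots> \<le> 2 ^ ?D * \<rho> ^ ?D" using 1 by (intro mult_left_mono) auto
  also have "\<dots> = (2 * \<rho>) ^ ?D" by (rule power_mult_distrib[symmetric])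
  also have "2 * \<rho> = (12 + 8 * L) * R" by (simp add: \<rho>_def algebra_simps)
  also have "\<dots> ^ ?D = (12 + 8 * L) ^ ?D * R ^ ?D" by (rule power_mult_distrib)
  finally have 2: "real (card S) * (R / d) * d ^ ?D \<le> (12 + 8 * L) ^ ?D * R ^ ?D" .
  have Suc: "z ^ ?D = z ^ (?D - 1) * z" for z :: real
    using power_minus_mult[OF DIM_positive[where 'a = 'a], of z] by simp
  have "R * (real (card S) * d ^ (?D - 1)) = real (card S) * (R / d) * d ^ ?D"
    unfolding Suc[of d] using d by simp
  also note 2
  also have "(12 + 8 * L) ^ ?D * R ^ ?D = R * ((12 + 8 * L) ^ ?D * R ^ (?D - 1))"
    unfolding Suc[of R] by simp
  finally have "R * (real (card S) * d ^ (?D - 1)) \<le> R * ((12 + 8 * L) ^ ?D * R ^ (?D - 1))" .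
  then show ?thesis using d by (subst (asm) mult_le_cancel_left_pos) auto
qed

text \<open>A separated set of maximal cardinality is a net; it exists because
  \<open>separated_card\<close> bounds the cardinality.\<close>

lemma finite_net:
  assumes d: "0 < d" "d \<le> R"
  obtains S where "finite S" "frontier \<Omega> \<inter> ball p r \<inter> cball x R \<subseteq> (\<Union>s\<in>S. cball s d)"
    "real (card S) * d ^ (DIM('a) - 1) \<le> (12 + 8 * L) ^ DIM('a) * R ^ (DIM('a) - 1)"
proof -
  let ?A = "frontier \<Omega> \<inter> ball p r \<inter> cball x R"
  define P where "P S \<longleftrightarrow> finite S \<and> S \<subseteq> ?A \<and> (\<forall>s\<in>S. \<forall>t\<in>S. s \<noteq> t \<longrightarrow> d \<le> dist s t)" for S
  have card: "real (card S) * d ^ (DIM('a) - 1) \<le> (12 + 8 * L) ^ DIM('a) * R ^ (DIM('a) - 1)" if "P S" for S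
    using that unfolding P_def by (intro separated_card[OF _ _ _ d]) auto
  define b where "b = nat \<lceil>(12 + 8 * L) ^ DIM('a) * R ^ (DIM('a) - 1) / d ^ (DIM('a) - 1)\<rceil>"
  have P0: "P {}" by (simp add: P_def)
  have "card S \<le> b" if "P S" for S
  proof -
    have "real (card S) \<le> (12 + 8 * L) ^ DIM('a) * R ^ (DIM('a) - 1) / d ^ (DIM('a) - 1)"
      using card[OF that] d by (simp add: pos_le_divide_eq)
    then show ?thesis unfolding b_def by linarith
  qed
  then have "\<forall>T. P T \<longrightarrow> card T < Suc b" by (simp add: less_Suc_eq_le)
  from ex_has_greatest_nat[of P, OF P0 this] obtain S
    where S: "P S" "\<And>T. P T \<Longrightarrow> card T \<le> card S" by (elim exE conjE) simp
  have "?A \<subseteq> (\<Union>s\<in>S. cball s d)"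
  proof
    fix y assume y: "y \<in> ?A"
    show "y \<in> (\<Union>s\<in>S. cball s d)"
    proof (rule ccontr)
      assume n: "y \<notin> (\<Union>s\<in>S. cball s d)"
      then have "P (insert y S)" using S(1) y by (auto simp: P_def dist_commute not_le)
      then have "card (insert y S) \<le> card S" by (rule S(2))
      moreover have "y \<notin> S" using n d by auto
      ultimately show False using S(1) by (simp add: P_def)
    qed
  qed
  then show ?thesis using that[of S] S(1) card[OF S(1)] by (auto simp: P_def)
qed

text \<open>At every scale, cover by balls of radius \<open>d\<close> around a net. Their total
  content is a constant times \<open>card S * d ^ (DIM('a) - 1)\<close>, and the bound on it from
  \<open>finite_net\<close> is free of \<open>d\<close>.\<close>

lemma hausdorff_upper:
  assumes R: "0 < R"
  shows "hausdorff_outer (DIM('a) - 1) (frontier \<Omega> \<inter> ball p r \<inter> cball x R)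
    \<le> ennreal (unit_ball_vol (real (DIM('a) - 1)) * (12 + 8 * L) ^ DIM('a) * R ^ (DIM('a) - 1))"
  unfolding hausdorff_outer_eq
proof (rule SUP_least)
  let ?A = "frontier \<Omega> \<inter> ball p r \<inter> cball x R" and ?m = "DIM('a) - 1"
  fix k :: real assume k: "k \<in> {0<..}"
  \<comment> \<open>A ball of radius \<open>d\<close> has diameter \<open>2 * d\<close>, which may
    not exceed the scale \<open>k\<close>.\<close>
  define d where "d = min (k / 2) R"
  have d: "0 < d" "d \<le> R" "2 * d \<le> k" using k R by (auto simp: d_def)
  obtain S where S: "finite S" "?A \<subseteq> (\<Union>s\<in>S. cball s d)"
    "real (card S) * d ^ ?m \<le> (12 + 8 * L) ^ DIM('a) * R ^ ?m"
    by (rule finite_net[OF d(1,2)])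
  obtain h where "bij_betw h {0..<card S} S" using ex_bij_betw_nat_finite[OF S(1)] by blast
  then have h: "h ` {..<card S} = S" by (simp add: bij_betw_def lessThan_atLeast0)
  define C where "C i = (if i < card S then cball (h i) d else {})" for i
  have "hausdorff_pre ?m k ?A \<le> (\<Sum>i. hausdorff_content ?m (C i))"
  proof (rule hausdorff_pre_le)
    show "?A \<subseteq> (\<Union>i. C i)"
    proof
      fix y assume "y \<in> ?A"
      then obtain s where "s \<in> h ` {..<card S}" "y \<in> cball s d" using S(2) unfolding h by blast
      then obtain i where "i < card S" "y \<in> cball (h i) d" by blast
      then have "y \<in> C i" by (simp add: C_def)
      then show "y \<in> (\<Union>i. C i)" by blast
    qed
    show "bounded (C i)" "diameter (C i) \<le> k" for i using d k by (auto simp: C_def)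
  qed
  also have "\<dots> = (\<Sum>i<card S. hausdorff_content ?m (C i))"
    by (rule suminf_finite) (auto simp: C_def)
  also have "\<dots> = (\<Sum>i<card S. ennreal (unit_ball_vol (real ?m) * d ^ ?m))"
  proof (rule sum.cong[OF refl])
    fix i assume "i \<in> {..<card S}"
    moreover have "h i \<in> cball (h i) d" using d by simp
    then have "cball (h i) d \<noteq> {}" by blast
    ultimately show "hausdorff_content ?m (C i) = ennreal (unit_ball_vol (real ?m) * d ^ ?m)"
      using d by (simp add: hausdorff_content_def C_def del: cball_eq_empty)
  qed
  also have "\<dots> = ennreal (real (card S) * (unit_ball_vol (real ?m) * d ^ ?m))"
    using d by (simp add: ennreal_mult ennreal_of_nat_eq_real_of_nat)
  also have "\<dots> \<le> ennreal (unit_ball_vol (real ?m) * (12 + 8 * L) ^ DIM('a) * R ^ ?m)"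
  proof (rule ennreal_leI)
    have "unit_ball_vol (real ?m) * (real (card S) * d ^ ?m) \<le> unit_ball_vol (real ?m) * ((12 + 8 * L) ^ DIM('a) * R ^ ?m)"
      using S(3) by (intro mult_left_mono) auto
    then show "real (card S) * (unit_ball_vol (real ?m) * d ^ ?m) \<le> unit_ball_vol (real ?m) * (12 + 8 * L) ^ DIM('a) * R ^ ?m"
      by (simp add: ac_simps)
  qed
  finally show "hausdorff_pre ?m k ?A \<le> ennreal (unit_ball_vol (real ?m) * (12 + 8 * L) ^ DIM('a) * R ^ ?m)" .
qed

section \<open>Vertical tubes and the lower bound\<close>

definition tube :: "real \<Rightarrow> 'a set \<Rightarrow> 'a set" where
  "tube R S = (\<lambda>(y, t). y + t *\<^sub>R e) ` (S \<times> {- R..R})"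

text \<open>Balls of radius \<open>2 * D\<close> centred at steps of \<open>D\<close> along
  \<open>e\<close> cover the tube; with \<open>n = \<lceil>R / D\<rceil>\<close> there are
  \<open>2 * n + 1\<close> of them, at most \<open>5 * R / D\<close>. \<open>D\<close> is any
  positive bound on the diameter, so that sets of diameter 0 can be reached by a limit.\<close>

lemma tube_measure_pos:
  assumes S: "bounded S" "diameter S \<le> D" and D: "0 < D" "D \<le> R"
  shows "emeasure lborel (tube R S) \<le> ennreal (5 * 2 ^ DIM('a) * unit_ball_vol DIM('a) * R * D ^ (DIM('a) - 1))"
proof (cases "S = {}")
  case True
  then show ?thesis by (simp add: tube_def)
next
  case False
  then obtain s where s: "s \<in> S" by blast
  define n where "n = \<lceil>R / D\<rceil>"
  have RD: "1 \<le> R / D" using D by simp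
  have n: "R / D \<le> real_of_int n" "real_of_int n \<le> R / D + 1" unfolding n_def by linarith+
  define B where "B k = cball (s + (real_of_int k * D) *\<^sub>R e) (2 * D)" for k
  have sub: "tube R S \<subseteq> (\<Union>k\<in>{-n..n}. B k)"
  proof
    fix w assume "w \<in> tube R S"
    then obtain y t where yt: "y \<in> S" "- R \<le> t" "t \<le> R" "w = y + t *\<^sub>R e" by (auto simp: tube_def)
    define k where "k = \<lfloor>t / D\<rfloor>"
    have k: "real_of_int k \<le> t / D" "t / D < real_of_int k + 1" unfolding k_def by linarith+
    have kD: "real_of_int k * D \<le> t" "t < real_of_int k * D + D"
      using k D by (simp_all add: field_simps)
    have "t / D \<le> R / D" "- (R / D) \<le> t / D" using yt D by (simp_all add: field_simps)
    then have "real_of_int k \<le> real_of_int n" using k n by linarith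
    have lo: "- n \<le> k"
    proof -
      have "real_of_int (- n) \<le> t / D" using n \<open>- (R / D) \<le> t / D\<close> by simp
      then show ?thesis unfolding k_def by (simp only: le_floor_iff)
    qed
    have hi: "k \<le> n" using \<open>real_of_int k \<le> real_of_int n\<close> by simp
    have "dist (s + (real_of_int k * D) *\<^sub>R e) w \<le> dist s y + norm ((t - real_of_int k * D) *\<^sub>R e)"
    proof -
      have eq: "s + (real_of_int k * D) *\<^sub>R e - w = (s - y) - (t - real_of_int k * D) *\<^sub>R e"
        unfolding yt(4) by (simp add: scaleR_diff_left)
      show ?thesis unfolding dist_norm eq by (rule norm_triangle_ineq4)
    qed
    also have "\<dots> \<le> D + D"
      using diameter_bounded_bound[OF S(1) s yt(1)] S(2) kD e by simp
    finally have "w \<in> B k" by (simp add: B_def)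
    then show "w \<in> (\<Union>k\<in>{-n..n}. B k)" using lo hi by auto
  qed
  have "emeasure lborel (tube R S) \<le> emeasure lborel (\<Union>k\<in>{-n..n}. B k)"
    by (rule emeasure_mono[OF sub]) (auto simp: B_def)
  also have "\<dots> \<le> (\<Sum>k\<in>{-n..n}. emeasure lborel (B k))"
    by (rule emeasure_subadditive_finite) (auto simp: B_def)
  also have "\<dots> = (\<Sum>k\<in>{-n..n}. ennreal (unit_ball_vol DIM('a) * (2 * D) ^ DIM('a)))"
    using D by (intro sum.cong refl) (simp add: B_def emeasure_cball)
  also have "\<dots> = ennreal (real (nat (2 * n + 1)) * (unit_ball_vol DIM('a) * (2 * D) ^ DIM('a)))"
    using D by (simp add: ennreal_mult ennreal_of_nat_eq_real_of_nat)
  also have "\<dots> \<le> ennreal (5 * (R / D) * (unit_ball_vol DIM('a) * (2 * D) ^ DIM('a)))"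
  proof (intro ennreal_leI mult_right_mono)
    have "0 \<le> n" using n(1) RD by linarith
    then have "real (nat (2 * n + 1)) = 2 * real_of_int n + 1" by simp
    also have "\<dots> \<le> 5 * (R / D)" using n(2) RD by linarith
    finally show "real (nat (2 * n + 1)) \<le> 5 * (R / D)" .
  qed (use D in simp)
  also have "5 * (R / D) * (unit_ball_vol DIM('a) * (2 * D) ^ DIM('a))
    = 5 * 2 ^ DIM('a) * unit_ball_vol DIM('a) * R * D ^ (DIM('a) - 1)"
  proof -
    have "D ^ DIM('a) = D ^ (DIM('a) - 1) * D"
      using power_minus_mult[OF DIM_positive[where 'a = 'a], of D] by simp
    then show ?thesis using D by (simp add: power_mult_distrib)
  qed
  finally show ?thesis .
qed

text \<open>At diameter 0 the tube must be null; this follows by letting \<open>D\<close> tend to 0,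
  as \<open>D\<close> occurs with a power of at least 1.\<close>

lemma tube_measure:
  assumes S: "bounded S" "diameter S \<le> R" and R: "0 < R"
    and dim: "2 \<le> DIM('a)"
  shows "emeasure lborel (tube R S)
    \<le> ennreal (5 * 2 ^ DIM('a) * unit_ball_vol DIM('a) * R * diameter S ^ (DIM('a) - 1))"
proof (cases "diameter S = 0")
  case False
  then have "0 < diameter S" using diameter_ge_0[OF S(1)] by simp
  then show ?thesis using tube_measure_pos[OF S(1) order_refl _ S(2)] by simp
next
  case True
  define K where "K = 5 * 2 ^ DIM('a) * unit_ball_vol DIM('a) * R"
  have K: "0 \<le> K" using R by (simp add: K_def)
  show ?thesis
  proof (rule ennreal_le_epsilon)
    fix k :: real assume k: "0 < k"
    define D where "D = min (min R 1) (k / (K + 1))"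
    have D: "0 < D" "D \<le> R" "D \<le> 1" "D \<le> k / (K + 1)" using R k K by (auto simp: D_def)
    have "emeasure lborel (tube R S) \<le> ennreal (K * D ^ (DIM('a) - 1))"
      unfolding K_def by (rule tube_measure_pos[OF S(1) _ D(1,2)]) (use True D in simp)
    also have "\<dots> \<le> ennreal k"
    proof (rule ennreal_leI)
      have "D ^ (DIM('a) - 1) \<le> D ^ 1" using D dim by (intro power_decreasing) auto
      then have "K * D ^ (DIM('a) - 1) \<le> K * (k / (K + 1))"
        using D K by (intro mult_left_mono) auto
      also have "\<dots> \<le> k" using K k by (simp add: field_simps)
      finally show "K * D ^ (DIM('a) - 1) \<le> k" .
    qed
    finally show "emeasure lborel (tube R S)
      \<le> ennreal (5 * 2 ^ DIM('a) * unit_ball_vol DIM('a) * R * diameter S ^ (DIM('a) - 1)) + ennreal k"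
      by (simp add: add_increasing)
  qed
qed

text \<open>Points near \<open>x\<close> slide along \<open>e\<close> onto the graph by at most
  \<open>R\<close>, so tubes over the sets of any cover of the graph piece cover a solid ball of
  radius comparable to \<open>R\<close>. Its volume, of order \<open>R ^ DIM('a)\<close>, is at most
  a constant times \<open>R\<close> times the total content of the cover. Cancelling
  \<open>R\<close> gives the bound already at scale \<open>R\<close>.\<close>

lemma hausdorff_lower:
  assumes x: "x \<in> frontier \<Omega>" and R: "0 < R" and sub: "ball x R \<subseteq> ball p r" and dim: "2 \<le> DIM('a)"
  shows "ennreal (unit_ball_vol (real (DIM('a) - 1)) / (5 * 2 ^ DIM('a) * 2 ^ (DIM('a) - 1) * (2 + L) ^ DIM('a))
      * R ^ (DIM('a) - 1)) \<le> hausdorff_outer (DIM('a) - 1) (frontier \<Omega> \<inter> ball x R)"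
proof -
  let ?m = "DIM('a) - 1" and ?D = "DIM('a)"
  let ?A = "frontier \<Omega> \<inter> ball x R"
  have xb: "x \<in> ball p r" using subsetD[OF sub, of x] R by simp
  have G0: "G x = 0" using frontier_iff[OF xb] x by simp
  \<comment> \<open>Chosen so that the foot point of \<open>y\<close>, at distance at most
    \<open>(2 + L) * dist x y\<close> from \<open>x\<close>, still lies in
    \<open>ball x R\<close>.\<close>
  define Z where "Z = ball x (R / (2 + L))"
  define \<kappa> where "\<kappa> = 5 * 2 ^ ?D * unit_ball_vol ?D * R"
  define \<omega> where "\<omega> = unit_ball_vol (real ?m)"
  have \<kappa>: "0 < \<kappa>" and \<omega>: "0 < \<omega>" using R by (simp_all add: \<kappa>_def \<omega>_def)
  have "ennreal (\<omega> / (5 * 2 ^ ?D * 2 ^ ?m * (2 + L) ^ ?D) * R ^ ?m) \<le> hausdorff_pre ?m R ?A"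
    unfolding hausdorff_pre_def
  proof (rule INF_greatest)
    fix C assume "C \<in> hausdorff_covers R ?A"
    then have C: "?A \<subseteq> (\<Union>i. C i)" "\<And>i. bounded (C i)" "\<And>i. diameter (C i) \<le> R"
      by (auto simp: hausdorff_covers_def)
    \<comment> \<open>Closures have the same diameter and make the tubes compact, hence
      Borel.\<close>
    define U where "U i = tube R (closure (C i))" for i
    have comp: "compact (closure (C i))" for i using C(2) by (simp add: compact_closure)
    have "compact (U i)" for i
      unfolding U_def tube_def
      by (intro compact_continuous_image compact_Times comp compact_Icc)
        (auto simp: case_prod_beta intro!: continuous_intros)
    then have Um: "U i \<in> sets lborel" for i using borel_compact[of "U i"] by simp
    have ZU: "Z \<subseteq> (\<Union>i. U i)"
    proof
      fix y assume "y \<in> Z"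
      then have d: "dist x y < R / (2 + L)" by (simp add: Z_def)
      then have d': "(2 + L) * dist x y < R" using L_nonneg by (simp add: field_simps)
      have t: "\<bar>G y\<bar> \<le> (1 + L) * dist x y" using G_lipschitz[of x y] G0 by (simp add: abs_minus_commute)
      define z where "z = y + (- G y) *\<^sub>R e"
      have Gz: "G z = 0" unfolding z_def G_shift by simp
      have "dist x z \<le> dist x y + dist y z" by (rule dist_triangle)
      also have "dist y z = \<bar>G y\<bar>" by (simp add: z_def dist_norm e)
      finally have "dist x z \<le> (2 + L) * dist x y" using t by (simp add: distrib_right)
      then have zR: "z \<in> ball x R" using d' by simp
      then have "z \<in> frontier \<Omega>" using frontier_iff[of z] sub Gz by blast
      then obtain i where i: "z \<in> C i" using C(1) zR by blast
      have "y = z + (G y) *\<^sub>R e" by (simp add: z_def)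
      moreover have "\<bar>G y\<bar> \<le> R"
      proof -
        have "(1 + L) * dist x y \<le> (2 + L) * dist x y" by (intro mult_right_mono) auto
        then show ?thesis using t d' by linarith
      qed
      ultimately have "y \<in> U i"
        unfolding U_def tube_def using i closure_subset[of "C i"]
        by (intro image_eqI[of _ _ "(z, G y)"]) auto
      then show "y \<in> (\<Union>i. U i)" by blast
    qed
    have Ule: "emeasure lborel (U i) \<le> ennreal (\<kappa> * 2 ^ ?m / \<omega>) * hausdorff_content ?m (C i)" for i
    proof (cases "C i = {}")
      case True
      then show ?thesis by (simp add: U_def tube_def)
    next
      case False
      have "emeasure lborel (U i) \<le> ennreal (\<kappa> * diameter (C i) ^ ?m)"
        using tube_measure[of "closure (C i)" R] C(2,3)[of i] R dim
        unfolding U_def \<kappa>_def by (simp add: diameter_closure bounded_closure)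
      also have "\<kappa> * diameter (C i) ^ ?m = (\<kappa> * 2 ^ ?m / \<omega>) * (\<omega> * (diameter (C i) / 2) ^ ?m)"
        using \<omega> by (simp add: power_divide)
      also have "ennreal \<dots> = ennreal (\<kappa> * 2 ^ ?m / \<omega>) * hausdorff_content ?m (C i)"
        using False \<kappa> \<omega> unfolding hausdorff_content_def \<omega>_def[symmetric]
        by (subst ennreal_mult') auto
      finally show ?thesis .
    qed
    have "ennreal (unit_ball_vol ?D * (R / (2 + L)) ^ ?D) = emeasure lborel Z"
      unfolding Z_def using R L_nonneg by (intro emeasure_lborel_ball[symmetric]) auto
    also have "\<dots> \<le> emeasure lborel (\<Union>i. U i)"
      using Um by (intro emeasure_mono[OF ZU]) auto
    also have "\<dots> \<le> (\<Sum>i. emeasure lborel (U i))"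
      using Um by (intro emeasure_subadditive_countably) auto
    also have "\<dots> \<le> (\<Sum>i. ennreal (\<kappa> * 2 ^ ?m / \<omega>) * hausdorff_content ?m (C i))"
      by (intro suminf_le Ule) auto
    also have "\<dots> = ennreal (\<kappa> * 2 ^ ?m / \<omega>) * (\<Sum>i. hausdorff_content ?m (C i))" by simp
    finally have main: "ennreal (unit_ball_vol ?D * (R / (2 + L)) ^ ?D)
      \<le> ennreal (\<kappa> * 2 ^ ?m / \<omega>) * (\<Sum>i. hausdorff_content ?m (C i))" .
    have RD: "R ^ ?D = R ^ ?m * R"
      using power_minus_mult[OF DIM_positive[where 'a = 'a], of R] by simp
    have eq: "unit_ball_vol ?D * (R / (2 + L)) ^ ?D
      = (\<kappa> * 2 ^ ?m / \<omega>) * (\<omega> / (5 * 2 ^ ?D * 2 ^ ?m * (2 + L) ^ ?D) * R ^ ?m)"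
      using \<omega> R L_nonneg unfolding \<kappa>_def power_divide RD by (simp add: field_simps)
    show "ennreal (\<omega> / (5 * 2 ^ ?D * 2 ^ ?m * (2 + L) ^ ?D) * R ^ ?m) \<le> (\<Sum>i. hausdorff_content ?m (C i))"
    proof (cases "\<Sum>i. hausdorff_content ?m (C i)" rule: ennreal_cases)
      case (real q)
      have "(\<kappa> * 2 ^ ?m / \<omega>) * (\<omega> / (5 * 2 ^ ?D * 2 ^ ?m * (2 + L) ^ ?D) * R ^ ?m) \<le> (\<kappa> * 2 ^ ?m / \<omega>) * q"
      proof -
        have k: "0 \<le> \<kappa> * 2 ^ ?m / \<omega>" using \<kappa> \<omega> by simp
        have "ennreal ((\<kappa> * 2 ^ ?m / \<omega>) * (\<omega> / (5 * 2 ^ ?D * 2 ^ ?m * (2 + L) ^ ?D) * R ^ ?m))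
            \<le> ennreal ((\<kappa> * 2 ^ ?m / \<omega>) * q)"
          using main unfolding eq real(2) ennreal_mult[OF k real(1)] .
        then show ?thesis using mult_nonneg_nonneg[OF k real(1)] by (simp only: ennreal_le_iff)
      qed
      then have "\<omega> / (5 * 2 ^ ?D * 2 ^ ?m * (2 + L) ^ ?D) * R ^ ?m \<le> q"
        using \<kappa> \<omega> by (subst (asm) mult_le_cancel_left_pos) auto
      then show ?thesis using real by (simp add: ennreal_leI)
    qed simp
  qed
  also have "\<dots> \<le> hausdorff_outer ?m ?A" by (rule hausdorff_pre_le_outer[OF R])
  finally show ?thesis unfolding \<omega>_def .
qed

end

section \<open>The boundary case\<close>

lemma space_surface_measure [simp]: "space (surface_measure \<Omega>) = frontier \<Omega>"
  by (simp add: surface_measure_def space_restrict_space)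

lemma emeasure_surface_measure:
  fixes \<Omega> :: "'a::euclidean_space set"
  assumes "A \<in> sets borel" "A \<subseteq> frontier \<Omega>"
  shows "emeasure (surface_measure \<Omega>) A = hausdorff_outer (DIM('a) - 1) A"
  unfolding surface_measure_def using assms
  by (subst emeasure_restrict_space) (auto simp: emeasure_hausdorff_measure)

text \<open>Both regularity bounds with the chart data hidden: only a radius and two constants
  survive, to be chosen for each boundary point.\<close>

lemma lipschitz_boundary_patch:
  fixes \<Omega> :: "'a::euclidean_space set"
  assumes "open \<Omega>" "lipschitz_boundary \<Omega>" "p \<in> frontier \<Omega>"
  obtains r K k where "0 < r" "0 \<le> K" "0 < k"
    "\<forall>x R. 0 < R \<longrightarrow>
      hausdorff_outer (DIM('a) - 1) (frontier \<Omega> \<inter> ball p r \<inter> cball x R) \<le> ennreal (K * R ^ (DIM('a) - 1))"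
    "\<forall>x R. 2 \<le> DIM('a) \<longrightarrow> x \<in> frontier \<Omega> \<longrightarrow> 0 < R \<longrightarrow> ball x R \<subseteq> ball p r \<longrightarrow>
      ennreal (k * R ^ (DIM('a) - 1)) \<le> hausdorff_outer (DIM('a) - 1) (frontier \<Omega> \<inter> ball x R)"
proof -
  obtain e r L and \<gamma> :: "'a \<Rightarrow> real" where *: "norm e = 1" "r > 0" "L-lipschitz_on {z. z \<bullet> e = 0} \<gamma>"
    "\<Omega> \<inter> ball p r = {y \<in> ball p r. y \<bullet> e > \<gamma> (y - (y \<bullet> e) *\<^sub>R e)}"
    using assms(2,3) unfolding lipschitz_boundary_def by blast
  interpret lipschitz_graph \<Omega> p e r L \<gamma>
    by standard (use assms(1) * in auto)
  show ?thesis
  proof (rule that[OF *(2)])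
    show "0 \<le> unit_ball_vol (real (DIM('a) - 1)) * (12 + 8 * L) ^ DIM('a)"
      using L_nonneg by simp
    show "0 < unit_ball_vol (real (DIM('a) - 1)) / (5 * 2 ^ DIM('a) * 2 ^ (DIM('a) - 1) * (2 + L) ^ DIM('a))"
      using L_nonneg by simp
  qed (use hausdorff_upper hausdorff_lower in blast)+
qed

context
  fixes \<Omega> :: "'a::euclidean_space set"
  assumes nonempty: "\<Omega> \<noteq> {}" and op: "open \<Omega>" and bd: "bounded \<Omega>"
    and lb: "lipschitz_boundary \<Omega>" and dim: "2 \<le> DIM('a)"
begin

lemma frontier_compact: "compact (frontier \<Omega>)"
  using bd by (rule compact_frontier_bounded)

lemma frontier_nonempty: "frontier \<Omega> \<noteq> {}"
  using frontier_eq_empty[of \<Omega>] nonempty bd not_bounded_UNIV by blast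

text \<open>Compactness of the boundary: finitely many half-size patches cover it, so a ball of
  radius at most \<rho> around a boundary point lies in one full patch. For larger radii the finite
  total mass divided by \<open>\<rho> ^ m\<close> serves as the constant, \<open>m\<close> being the
  dimension of the boundary.\<close>

lemma boundary_growth:
  obtains C where "growth_measure (surface_measure \<Omega>) (DIM('a) - 1) C"
proof -
  let ?m = "DIM('a) - 1" and ?X = "frontier \<Omega>"
  have "\<forall>p\<in>?X. \<exists>r K. 0 < r \<and> 0 \<le> K \<and> (\<forall>x R. 0 < R \<longrightarrow>
    hausdorff_outer ?m (?X \<inter> ball p r \<inter> cball x R) \<le> ennreal (K * R ^ ?m))"
  proof
    fix p assume p: "p \<in> ?X"
    show "\<exists>r K. 0 < r \<and> 0 \<le> K \<and> (\<forall>x R. 0 < R \<longrightarrow>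
      hausdorff_outer ?m (?X \<inter> ball p r \<inter> cball x R) \<le> ennreal (K * R ^ ?m))"
      by (rule lipschitz_boundary_patch[OF op lb p]) (intro exI conjI)
  qed
  then obtain r K where rK: "\<And>p. p \<in> ?X \<Longrightarrow> 0 < r p" "\<And>p. p \<in> ?X \<Longrightarrow> 0 \<le> K p"
    "\<And>p x R. p \<in> ?X \<Longrightarrow> 0 < R \<Longrightarrow>
      hausdorff_outer ?m (?X \<inter> ball p (r p) \<inter> cball x R) \<le> ennreal (K p * R ^ ?m)" by metis
  obtain D where D: "D \<subseteq> ?X" "finite D" "?X \<subseteq> (\<Union>p\<in>D. ball p (r p / 2))"
  proof (rule compactE_image[OF frontier_compact, of ?X "\<lambda>p. ball p (r p / 2)"])
    show "?X \<subseteq> (\<Union>p\<in>?X. ball p (r p / 2))" using rK(1) by (force simp: dist_commute)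
  qed auto
  have Dne: "D \<noteq> {}" using D(3) frontier_nonempty by auto
  define \<rho> where "\<rho> = Min ((\<lambda>p. r p / 2) ` D)"
  have "0 < \<rho>" unfolding \<rho>_def using D Dne rK(1) by (subst Min_gr_iff) auto
  moreover have "\<rho> \<le> r p / 2" if "p \<in> D" for p
    unfolding \<rho>_def using D that by (intro Min_le) auto
  ultimately have \<rho>: "0 < \<rho>" "\<And>p. p \<in> D \<Longrightarrow> \<rho> \<le> r p / 2" by auto
  define K1 where "K1 = (\<Sum>p\<in>D. K p)"
  have K1: "K p \<le> K1" if "p \<in> D" for p
    unfolding K1_def using D rK(2) that by (intro member_le_sum) auto
  have K10: "0 \<le> K1" unfolding K1_def using D rK(2) by (intro sum_nonneg) auto
  have small: "hausdorff_outer ?m (ball x R \<inter> ?X) \<le> ennreal (K1 * R ^ ?m)"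
    if x: "x \<in> ?X" and R: "0 < R" "R \<le> \<rho>" for x R
  proof -
    obtain p where p: "p \<in> D" "dist p x < r p / 2" using D(3) x by auto
    have "ball x R \<inter> ?X \<subseteq> ?X \<inter> ball p (r p) \<inter> cball x R"
    proof
      fix y assume y: "y \<in> ball x R \<inter> ?X"
      have "dist p y \<le> dist p x + dist x y" by (rule dist_triangle)
      then have "dist p y < r p" using y p(2) R(2) \<rho>(2)[OF p(1)] by simp
      then show "y \<in> ?X \<inter> ball p (r p) \<inter> cball x R" using y by simp
    qed
    then have "hausdorff_outer ?m (ball x R \<inter> ?X) \<le> hausdorff_outer ?m (?X \<inter> ball p (r p) \<inter> cball x R)"
      by (rule hausdorff_outer_mono)
    also have "\<dots> \<le> ennreal (K p * R ^ ?m)" using rK(3) p(1) D(1) R(1) by blast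
    also have "\<dots> \<le> ennreal (K1 * R ^ ?m)"
      using K1[OF p(1)] R(1) by (intro ennreal_leI mult_right_mono) auto
    finally show ?thesis .
  qed
  have fin: "hausdorff_outer ?m ?X < top"
  proof -
    obtain n :: nat and x where x: "\<forall>j<n. x j \<in> ?X" "?X \<subseteq> (\<Union>j<n. ball (x j) \<rho>)"
      using finite_ball_cover[OF frontier_compact \<rho>(1)] by blast
    define S where "S j = (if j < n then ball (x j) \<rho> \<inter> ?X else {})" for j
    have "?X \<subseteq> (\<Union>j. S j)"
    proof
      fix y assume y: "y \<in> ?X"
      then obtain j where "j < n" "y \<in> ball (x j) \<rho>" using x(2) by auto
      then have "y \<in> S j" using y by (simp add: S_def)
      then show "y \<in> (\<Union>j. S j)" by blast
    qed
    then have "hausdorff_outer ?m ?X \<le> hausdorff_outer ?m (\<Union>j. S j)" by (rule hausdorff_outer_mono)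
    also have "\<dots> \<le> (\<Sum>j. hausdorff_outer ?m (S j))" by (rule hausdorff_outer_subadditive)
    also have "\<dots> = (\<Sum>j<n. hausdorff_outer ?m (S j))"
      by (rule suminf_finite) (auto simp: S_def hausdorff_outer_empty)
    also have "\<dots> \<le> (\<Sum>j<n. ennreal (K1 * \<rho> ^ ?m))"
      using x(1) \<rho>(1) small by (intro sum_mono) (simp add: S_def del: One_nat_def)
    also have "\<dots> < top" by (simp add: ennreal_mult_less_top of_nat_less_top)
    finally show ?thesis .
  qed
  define M where "M = surface_measure \<Omega>"
  have X: "?X \<in> sets borel" by (simp add: borel_closed)
  have sp: "space M = ?X" by (simp add: M_def)
  have em: "emeasure M A = hausdorff_outer ?m A" if "A \<in> sets borel" "A \<subseteq> ?X" for A
    unfolding M_def using that by (rule emeasure_surface_measure)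
  have fM: "finite_measure M"
    by (rule finite_measureI) (use fin em[OF X] in \<open>simp add: sp\<close>)
  interpret finite_measure M by (rule fM)
  define C where "C = K1 + measure M (space M) / \<rho> ^ ?m + 1"
  have C: "0 < C" "K1 \<le> C" "measure M (space M) / \<rho> ^ ?m \<le> C"
    using K10 \<rho>(1) by (auto simp: C_def intro!: add_nonneg_pos add_nonneg_nonneg)
  have "growth_measure M ?m C"
  proof
    show "sets M = sets (restrict_space borel (space M))"
      unfolding sp by (simp add: M_def surface_measure_def sets_restrict_space)
    show "space M \<in> sets borel" using X by (simp add: sp)
    show "bounded (space M)" using frontier_compact by (simp add: sp compact_imp_bounded)
    show "0 < ?m" using dim by simp
    show "0 < C" by (rule C)
    fix x and R :: real assume x: "x \<in> space M" and R: "0 < R"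
    show "measure M (ball x R \<inter> space M) \<le> C * R ^ ?m"
    proof (cases "R \<le> \<rho>")
      case True
      have "ennreal (measure M (ball x R \<inter> space M)) \<le> ennreal (K1 * R ^ ?m)"
        using em[of "ball x R \<inter> ?X"] small[of x R] x R X True
        by (simp add: sp emeasure_eq_measure[symmetric])
      then have "measure M (ball x R \<inter> space M) \<le> K1 * R ^ ?m"
        using K10 R by (subst (asm) ennreal_le_iff) auto
      also have "\<dots> \<le> C * R ^ ?m" using C R by (intro mult_right_mono) auto
      finally show ?thesis .
    next
      case False
      have "measure M (ball x R \<inter> space M) \<le> measure M (space M)"
        by (rule finite_measure_mono) auto
      also have "\<dots> = measure M (space M) / \<rho> ^ ?m * \<rho> ^ ?m" using \<rho>(1) by simp
      also have "\<dots> \<le> C * R ^ ?m"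
        using C \<rho>(1) False by (intro mult_mono power_mono) auto
      finally show ?thesis .
    qed
  qed
  then show ?thesis using that unfolding M_def by blast
qed

text \<open>Lipschitz functions belong to the trace space: the distance to \<open>F\<close> vanishes
  exactly on \<open>F\<close>, and the constant 1 serves as the plateau. Oscillation is read off the
  kernel of exponent \<open>m + 1\<close>, and \<open>F0\<close> lies in one boundary patch, where
  the lower bound holds.\<close>

lemma boundary_non_polyhedric:
  "non_polyhedric
    (dual_space (H_half_boundary \<Omega>) (H_half_boundary_norm \<Omega>))
    (dual_norm (H_half_boundary \<Omega>) (H_half_boundary_norm \<Omega>))
    (functional_of (surface_measure \<Omega>) (H_half_boundary \<Omega>) ` bounded_by_one (surface_measure \<Omega>))"
proof -
  define M where "M = surface_measure \<Omega>"
  define m where "m = DIM('a) - 1"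
  let ?X = "frontier \<Omega>"
  obtain C where "growth_measure M m C" using boundary_growth unfolding M_def m_def by blast
  then interpret growth_measure M m C .
  have sp: "space M = ?X" by (simp add: M_def)
  have X: "?X \<in> sets borel" by (simp add: borel_closed)
  have em: "emeasure M A = hausdorff_outer m A" if "A \<in> sets borel" "A \<subseteq> ?X" for A
    unfolding M_def m_def using that by (rule emeasure_surface_measure)
  have rm: "real DIM('a) - 1 = real m" using dim by (simp add: m_def)
  define Q where "Q = trace_sq \<Omega>"
  have Q: "Q u = L2_sq M u + slobodeckij_sq (real m) (1/2) M u" for u
    by (simp add: Q_def trace_sq_def M_def rm)
  interpret E: energy Q "borel_measurable M"
  proof
    show "Q (c *\<^sub>R u) = ennreal (c\<^sup>2) * Q u" if "u \<in> borel_measurable M" for c u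
      using that by (simp add: Q L2_sq_scale slobodeckij_scale distrib_left)
    show "Q (u + v) \<le> 2 * Q u + 2 * Q v" if "u \<in> borel_measurable M" "v \<in> borel_measurable M" for u v
    proof -
      have "Q (u + v) \<le> (2 * L2_sq M u + 2 * L2_sq M v)
        + (2 * slobodeckij_sq (real m) (1/2) M u + 2 * slobodeckij_sq (real m) (1/2) M v)"
        unfolding Q using that by (intro add_mono L2_sq_add slobodeckij_add)
      also have "\<dots> = 2 * Q u + 2 * Q v" by (simp add: Q distrib_left ac_simps)
      finally show ?thesis .
    qed
  qed (fact measurable_space_subspace)+
  define V where "V = H_half_boundary \<Omega>"
  define N where "N = H_half_boundary_norm \<Omega>"
  have V: "V = E.carrier"
    unfolding V_def H_half_boundary_def E.carrier_def by (simp add: Q_def M_def)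
  have N: "N = E.norm_of"
    unfolding N_def H_half_boundary_norm_def E.norm_of_def fun_eq_iff by (simp add: Q_def)
  interpret seminormed_carrier V N unfolding V N by (rule E.carrier_seminormed)
  have QN: "Q z = ennreal ((N z)\<^sup>2)" if "z \<in> V" for z
    using that unfolding V N by (rule E.norm_of_square[symmetric])
  obtain K where K: "0 \<le> K" "\<And>L u. 0 \<le> L \<Longrightarrow> (\<forall>x\<in>space M. \<forall>y\<in>space M. \<bar>u x - u y\<bar> \<le> L * dist x y) \<Longrightarrow>
      slobodeckij_sq (real m) (1/2) M u \<le> ennreal (K * L\<^sup>2)"
    using slobodeckij_lipschitz[of "1/2"] by auto
  \<comment> \<open>Slope 1 is enough for distance functions and constants.\<close>
  have lipV: "u \<in> V" if "continuous_on UNIV u" "\<forall>x\<in>space M. \<bar>u x\<bar> \<le> B" "0 \<le> B"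
    "\<forall>x\<in>space M. \<forall>y\<in>space M. \<bar>u x - u y\<bar> \<le> 1 * dist x y" for u B
  proof -
    have "u \<in> borel_measurable M"
      using measurable_compose[OF measurable_id borel_measurable_continuous_onI[OF that(1)]] by simp
    moreover have "Q u \<le> ennreal (measure M (space M) * B\<^sup>2) + ennreal (K * 1\<^sup>2)"
      unfolding Q using that by (intro add_mono L2_sq_bounded K(2)) auto
    then have "Q u < \<infinity>" by (rule le_less_trans) simp
    ultimately show ?thesis by (simp add: V E.carrier_def)
  qed
  obtain p0 where p0: "p0 \<in> ?X" using frontier_nonempty by blast
  obtain r K' c where r: "0 < r" and c: "0 < c" and
    low': "\<forall>x R. 2 \<le> DIM('a) \<longrightarrow> x \<in> ?X \<longrightarrow> 0 < R \<longrightarrow> ball x R \<subseteq> ball p0 r \<longrightarrow>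
      ennreal (c * R ^ m) \<le> hausdorff_outer m (?X \<inter> ball x R)"
    unfolding m_def by (rule lipschitz_boundary_patch[OF op lb p0])
  have low: "ennreal (c * R ^ m) \<le> hausdorff_outer m (?X \<inter> ball x R)"
    if "x \<in> ?X" "0 < R" "ball x R \<subseteq> ball p0 r" for x R
    using low' dim that by blast
  \<comment> \<open>A quarter of the patch radius leaves room for balls of radius up to
    \<open>r / 4\<close> around its points.\<close>
  define F0 where "F0 = ?X \<inter> cball p0 (r / 4)"
  have F0: "compact F0" "F0 \<subseteq> space M"
    using frontier_compact by (auto simp: F0_def sp)
  have lower: "c * R ^ m \<le> measure M (ball x R \<inter> space M)" if x: "x \<in> F0" and R: "0 < R" "R \<le> r / 4" for x R
  proof -
    have "ball x R \<subseteq> ball p0 r"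
    proof
      fix y assume y: "y \<in> ball x R"
      have "dist p0 y \<le> dist p0 x + dist x y" by (rule dist_triangle)
      then show "y \<in> ball p0 r" using x y R r by (simp add: F0_def)
    qed
    then have "ennreal (c * R ^ m) \<le> hausdorff_outer m (?X \<inter> ball x R)"
      using x R by (intro low) (auto simp: F0_def)
    also have "\<dots> = ennreal (measure M (ball x R \<inter> space M))"
      using X by (simp add: em sp Int_commute emeasure_eq_measure[symmetric])
    finally show ?thesis by (subst (asm) ennreal_le_iff) auto
  qed
  have F0pos: "0 < measure M F0"
  proof -
    have "p0 \<in> F0" using p0 r by (simp add: F0_def)
    then have "c * (r / 4) ^ m \<le> measure M (ball p0 (r / 4) \<inter> space M)" using r by (intro lower) auto
    also have "\<dots> \<le> measure M F0"
      using compact_sets[OF F0] by (intro finite_measure_mono) (auto simp: F0_def sp)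
    finally show ?thesis using c r by (meson less_le_trans mult_pos_pos zero_less_divide_iff zero_less_numeral zero_less_power)
  qed
  \<comment> \<open>One constant has to serve both the growth bound, with \<open>C\<close>, and the
    oscillation bound, with 1.\<close>
  define C' where "C' = max C 1"
  interpret regular_pivot V N M m C' "1/2" c "r / 4" F0 "\<lambda>_. 1" 1
  proof
    show "z \<in> borel_measurable M" if "z \<in> V" for z using that by (simp add: V E.carrier_def)
    show "L2_sq M z \<le> ennreal ((N z)\<^sup>2)" if "z \<in> V" for z
      unfolding QN[OF that, symmetric] Q by simp
    show "0 < C'" by (simp add: C'_def)
    show "measure M (ball x R \<inter> space M) \<le> C' * R ^ m" if "x \<in> space M" "0 < R" for x R
    proof -
      have "C * R ^ m \<le> C' * R ^ m" using that(2) by (intro mult_right_mono) (auto simp: C'_def)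
      then show ?thesis using upper[OF that] by linarith
    qed
    show "(\<integral>\<^sup>+x. \<integral>\<^sup>+y. ennreal ((z x - z y)\<^sup>2) * indicator (ball x d) y \<partial>M \<partial>M)
        \<le> ennreal (C' * d ^ m * d powr (2 * (1/2)) * (N z)\<^sup>2)" if z: "z \<in> V" and d: "0 < d" "d \<le> 1" for z d
    proof -
      have "(\<integral>\<^sup>+x. \<integral>\<^sup>+y. ennreal ((z x - z y)\<^sup>2) * indicator (ball x d) y \<partial>M \<partial>M)
        \<le> ennreal (d powr (real m + 2 * (1/2))) * slobodeckij_sq (real m) (1/2) M z"
        using z d by (intro slobodeckij_osc) (auto simp: V E.carrier_def)
      also have "\<dots> \<le> ennreal (d powr (real m + 2 * (1/2))) * ennreal ((N z)\<^sup>2)"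
        unfolding QN[OF z, symmetric] Q by (intro mult_left_mono) auto
      also have "\<dots> = ennreal (d ^ m * d powr (2 * (1/2)) * (N z)\<^sup>2)"
        using d by (simp add: ennreal_mult'[symmetric] powr_add powr_realpow)
      also have "\<dots> \<le> ennreal (C' * (d ^ m * d powr (2 * (1/2)) * (N z)\<^sup>2))"
      proof (rule ennreal_leI)
        have "0 \<le> d ^ m * d powr (2 * (1/2)) * (N z)\<^sup>2" using d by simp
        then have "1 * (d ^ m * d powr (2 * (1/2)) * (N z)\<^sup>2) \<le> C' * (d ^ m * d powr (2 * (1/2)) * (N z)\<^sup>2)"
          by (intro mult_right_mono) (simp add: C'_def)
        then show "d ^ m * d powr (2 * (1/2)) * (N z)\<^sup>2 \<le> C' * (d ^ m * d powr (2 * (1/2)) * (N z)\<^sup>2)"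
          by simp
      qed
      finally show ?thesis by (simp add: mult.assoc)
    qed
    show "\<exists>u\<in>V. continuous_on (space M) u \<and> (\<forall>x\<in>space M. 0 \<le> u x \<and> (u x = 0 \<longleftrightarrow> x \<in> F))"
      if F: "compact F" "F \<subseteq> space M" for F
    \<comment> \<open>\<open>infdist\<close> to the empty set is identically 0, so the constant 1
      takes its place.\<close>
    proof (cases "F = {}")
      case True
      show ?thesis by (rule bexI[of _ "\<lambda>_. 1"]) (use True lipV[of "\<lambda>_. 1" 1] in auto)
    next
      case False
      have cont: "continuous_on A (\<lambda>x. infdist x F)" for A by (intro continuous_intros)
      obtain B where B: "\<forall>x\<in>space M. norm (infdist x F) \<le> B" "0 < B"
        using compact_imp_bounded[OF compact_continuous_image[OF cont frontier_compact]]
        by (auto simp: bounded_pos sp)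
      show ?thesis
      proof (rule bexI[of _ "\<lambda>x. infdist x F"])
        show "(\<lambda>x. infdist x F) \<in> V"
          using B infdist_triangle_abs[of _ F] by (intro lipV[of _ B] cont) auto
        show "continuous_on (space M) (\<lambda>x. infdist x F) \<and>
          (\<forall>x\<in>space M. 0 \<le> infdist x F \<and> (infdist x F = 0 \<longleftrightarrow> x \<in> F))"
          using cont in_closed_iff_infdist_zero[OF compact_imp_closed[OF F(1)] False]
          by (auto simp: infdist_nonneg)
      qed
    qed
    show "(\<lambda>_. 1) \<in> V" by (rule lipV[of _ 1]) auto
  qed (use lower F0 F0pos r c sets_M space_borel space_bounded m_pos in auto)
  show ?thesis using non_polyhedric_unit_ball unfolding V_def N_def M_def .
qed

end

section \<open>Smooth bump functions\<close>

text \<open>The classical flat function \<open>exp (- 1 / t)\<close> with negative powers attached.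
  Allowing every \<open>j\<close> makes the family closed under differentiation up to linear
  combinations, and smoothness follows by induction.\<close>

definition flat_exp :: "nat \<Rightarrow> real \<Rightarrow> real" where
  "flat_exp j t = (if t \<le> 0 then 0 else exp (- 1 / t) / t ^ j)"

lemma flat_exp_tendsto_0: "(flat_exp j \<longlongrightarrow> 0) (at 0)"
proof (rule filterlim_split_at)
  show "(flat_exp j \<longlongrightarrow> 0) (at_left 0)"
    by (rule tendsto_eventually) (simp add: flat_exp_def eventually_at_filter)
  \<comment> \<open>With \<open>x = 1 / t\<close> this is the decay of \<open>x ^ j / exp x\<close>
    at infinity.\<close>
  have "((\<lambda>t. inverse t ^ j / exp (inverse t)) \<longlongrightarrow> (0::real)) (at_right 0)"
    by (rule filterlim_compose[OF tendsto_power_div_exp_0 filterlim_inverse_at_top_right])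
  moreover have "\<forall>\<^sub>F t :: real in at_right 0. inverse t ^ j / exp (inverse t) = flat_exp j t"
    by (simp add: eventually_at_filter flat_exp_def exp_minus power_inverse divide_inverse)
  ultimately show "(flat_exp j \<longlongrightarrow> 0) (at_right 0)"
    by (rule Lim_transform_eventually)
qed

text \<open>Away from 0 this is calculus. At 0 the difference quotient of \<open>flat_exp j\<close>
  is \<open>flat_exp (Suc j)\<close>, which tends to 0.\<close>

lemma flat_exp_derivative:
  "(flat_exp j has_real_derivative flat_exp (j + 2) t - real j * flat_exp (j + 1) t) (at t)"
proof (cases t "0 :: real" rule: linorder_cases)
  case less
  have "((\<lambda>t. 0) has_real_derivative 0) (at t)" by simp
  then have "(flat_exp j has_real_derivative 0) (at t)"
    by (rule has_field_derivative_transform_within_open[of _ _ _ "{..<0}"])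
      (use less in \<open>auto simp: flat_exp_def\<close>)
  then show ?thesis using less by (simp add: flat_exp_def)
next
  case equal
  have "((\<lambda>h. (flat_exp j (0 + h) - flat_exp j 0) / h) \<longlongrightarrow> 0) (at 0)"
  proof (rule Lim_transform_eventually[OF flat_exp_tendsto_0[of "Suc j"]])
    show "\<forall>\<^sub>F h in at 0. flat_exp (Suc j) h = (flat_exp j (0 + h) - flat_exp j 0) / h"
      by (simp add: eventually_at_filter flat_exp_def)
  qed
  then show ?thesis using equal by (simp add: DERIV_def flat_exp_def)
next
  case greater
  have "((\<lambda>t. exp (- 1 / t) / t ^ j) has_real_derivative
    (exp (- 1 / t) * (1 / t\<^sup>2) * t ^ j - exp (- 1 / t) * (real j * t ^ (j - 1))) / (t ^ j * t ^ j)) (at t)"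
    using greater by (auto intro!: derivative_eq_intros simp: power2_eq_square)
  also have "(exp (- 1 / t) * (1 / t\<^sup>2) * t ^ j - exp (- 1 / t) * (real j * t ^ (j - 1))) / (t ^ j * t ^ j)
    = flat_exp (j + 2) t - real j * flat_exp (j + 1) t"
  proof -
    have 1: "real j * t ^ (j - 1) / (t ^ j * t ^ j) = real j / t ^ (j + 1)"
      using greater by (cases j) simp_all
    have 2: "(E * (1 / t\<^sup>2) * p - E * q) / (p * p) = E / (p * t\<^sup>2) - E * (q / (p * p))"
      if "0 < p" for E p q :: real
      using that by (simp add: diff_divide_distrib)
    show ?thesis using greater unfolding 2[OF zero_less_power[OF greater]] 1
      by (simp add: flat_exp_def power_add power2_eq_square ac_simps)
  qed
  finally have d: "((\<lambda>t. exp (- 1 / t) / t ^ j) has_real_derivative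
    flat_exp (j + 2) t - real j * flat_exp (j + 1) t) (at t)" .
  show ?thesis
    by (rule has_field_derivative_transform_within_open[OF d, of "{0<..}"])
      (use greater in \<open>auto simp: flat_exp_def\<close>)
qed

text \<open>A class of functions containing the standard bump on \<open>ball a r\<close> and closed under partial
  derivatives.\<close>

inductive_set bumps :: "'a::euclidean_space \<Rightarrow> real \<Rightarrow> ('a \<Rightarrow> real) set" for a r where
  base: "(\<lambda>x. flat_exp j (r\<^sup>2 - (x - a) \<bullet> (x - a))) \<in> bumps a r"
| add: "f \<in> bumps a r \<Longrightarrow> g \<in> bumps a r \<Longrightarrow> (\<lambda>x. f x + g x) \<in> bumps a r"
| scale: "f \<in> bumps a r \<Longrightarrow> (\<lambda>x. c * f x) \<in> bumps a r"
| coord: "f \<in> bumps a r \<Longrightarrow> (\<lambda>x. ((x - a) \<bullet> b) * f x) \<in> bumps a r"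

text \<open>Differentiating the radial argument produces the factor
  \<open>- 2 * ((x - a) \<bullet> i)\<close>; this is why \<open>coord\<close> is among the closure
  rules.\<close>

lemma bumps_derivative:
  assumes "f \<in> bumps a r"
  shows "\<exists>f'. (\<forall>x. (f has_derivative f' x) (at x)) \<and> (\<forall>i. (\<lambda>x. f' x i) \<in> bumps a r)"
  using assms
proof induction
  case (base j)
  define q where "q x = r\<^sup>2 - (x - a) \<bullet> (x - a)" for x
  define f' where "f' x i = - 2 * ((x - a) \<bullet> i) * (flat_exp (j + 2) (q x) - real j * flat_exp (j + 1) (q x))" for x i
  have "((\<lambda>x. flat_exp j (q x)) has_derivative f' x) (at x)" for x
  proof -
    have "(q has_derivative (\<lambda>i. - 2 * ((x - a) \<bullet> i))) (at x)"
      unfolding q_def by (auto intro!: derivative_eq_intros simp: inner_commute)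
    from has_derivative_compose[OF this flat_exp_derivative[unfolded has_field_derivative_def]]
    show ?thesis by (simp add: f'_def[abs_def] mult.commute mult.left_commute)
  qed
  moreover have "(\<lambda>x. f' x i) \<in> bumps a r" for i
  proof -
    have "(\<lambda>x. ((x - a) \<bullet> i) * ((- 2) * flat_exp (j + 2) (r\<^sup>2 - (x - a) \<bullet> (x - a))
      + (2 * real j) * flat_exp (j + 1) (r\<^sup>2 - (x - a) \<bullet> (x - a)))) \<in> bumps a r"
      by (intro bumps.intros)
    moreover have "(\<lambda>x. f' x i) = (\<lambda>x. ((x - a) \<bullet> i) * ((- 2) * flat_exp (j + 2) (r\<^sup>2 - (x - a) \<bullet> (x - a))
      + (2 * real j) * flat_exp (j + 1) (r\<^sup>2 - (x - a) \<bullet> (x - a))))"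
      by (simp add: f'_def q_def fun_eq_iff algebra_simps)
    ultimately show ?thesis by simp
  qed
  ultimately show ?case unfolding q_def by blast
next
  case (add f g)
  then obtain f' g' where 1: "\<And>x. (f has_derivative f' x) (at x)" "\<And>i. (\<lambda>x. f' x i) \<in> bumps a r"
    "\<And>x. (g has_derivative g' x) (at x)" "\<And>i. (\<lambda>x. g' x i) \<in> bumps a r" by blast
  show ?case
    by (rule exI[of _ "\<lambda>x i. f' x i + g' x i"]) (auto intro!: has_derivative_add bumps.add 1)
next
  case (scale f c)
  then obtain f' where 1: "\<And>x. (f has_derivative f' x) (at x)" "\<And>i. (\<lambda>x. f' x i) \<in> bumps a r" by blast
  show ?case
    by (rule exI[of _ "\<lambda>x i. c * f' x i"]) (auto intro!: has_derivative_mult_right bumps.scale 1)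
next
  case (coord f b)
  then obtain f' where 1: "\<And>x. (f has_derivative f' x) (at x)" "\<And>i. (\<lambda>x. f' x i) \<in> bumps a r" by blast
  have "((\<lambda>x. ((x - a) \<bullet> b) * f x) has_derivative (\<lambda>i. ((x - a) \<bullet> b) * f' x i + (i \<bullet> b) * f x)) (at x)" for x
    by (auto intro!: derivative_eq_intros 1)
  moreover have "(\<lambda>x. ((x - a) \<bullet> b) * f' x i + (i \<bullet> b) * f x) \<in> bumps a r" for i
    by (intro bumps.add bumps.coord bumps.scale 1 coord)
  ultimately show ?case
    by (intro exI[of _ "\<lambda>x i. ((x - a) \<bullet> b) * f' x i + (i \<bullet> b) * f x"] conjI allI)
qed

lemma bumps_C_k: "f \<in> bumps a r \<Longrightarrow> C_k k f"
proof (induction k arbitrary: f)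
  case 0
  obtain f' where f': "\<And>x. (f has_derivative f' x) (at x)" using bumps_derivative[OF 0] by blast
  then have "continuous (at x) f" for x by (rule has_derivative_continuous)
  then show ?case by (simp add: continuous_at_imp_continuous_on)
next
  case (Suc k)
  obtain f' where f': "\<And>x. (f has_derivative f' x) (at x)" "\<And>i. (\<lambda>x. f' x i) \<in> bumps a r"
    using bumps_derivative[OF Suc.prems] by blast
  have eq: "frechet_derivative f (at x) = f' x" for x by (rule frechet_derivative_at[OF f'(1), symmetric])
  have "C_k k (\<lambda>x. frechet_derivative f (at x) i)" for i unfolding eq by (rule Suc.IH[OF f'(2)])
  moreover have "f differentiable (at x)" for x using f'(1) by (rule differentiableI)
  ultimately show ?case by simp
qed

definition bump :: "'a::euclidean_space \<Rightarrow> real \<Rightarrow> 'a \<Rightarrow> real" where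
  "bump a r x = flat_exp 0 (r\<^sup>2 - (x - a) \<bullet> (x - a))"

lemma bump_nonneg: "0 \<le> bump a r x"
  by (simp add: bump_def flat_exp_def)

lemma bump_eq_0_iff: "0 < r \<Longrightarrow> bump a r x = 0 \<longleftrightarrow> x \<notin> ball a r"
proof -
  assume r: "0 < r"
  have "(x - a) \<bullet> (x - a) = (dist a x)\<^sup>2"
    by (simp add: dist_norm power2_norm_eq_inner[symmetric] norm_minus_commute)
  moreover have "r\<^sup>2 \<le> (dist a x)\<^sup>2 \<longleftrightarrow> r \<le> dist a x"
    using r by (intro power_mono_iff) auto
  ultimately show ?thesis by (simp add: bump_def flat_exp_def not_less)
qed

lemma bump_test_function:
  assumes "0 < r" "cball a r \<subseteq> \<Omega>"
  shows "bump a r \<in> test_functions \<Omega>"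
proof -
  have "{x. bump a r x \<noteq> 0} = ball a r" using bump_eq_0_iff[OF assms(1)] by blast
  moreover have "C_k k (bump a r)" for k
    using bumps_C_k[OF bumps.base] by (simp add: bump_def[abs_def])
  ultimately show ?thesis using assms by (simp add: test_functions_def)
qed


section \<open>Test functions\<close>

lemma has_frechet_derivative:
  "f differentiable (at x) \<Longrightarrow> (f has_derivative frechet_derivative f (at x)) (at x)"
  by (simp add: frechet_derivative_works)

lemma frechet_derivative_add:
  assumes "f differentiable (at x)" "g differentiable (at x)"
  shows "frechet_derivative (\<lambda>x. f x + g x) (at x) i = frechet_derivative f (at x) i + frechet_derivative g (at x) i"
  by (rule fun_cong[OF frechet_derivative_at[OF has_derivative_add[OF assms[THEN has_frechet_derivative]]], symmetric])

lemma frechet_derivative_scale: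
  fixes f :: "'a::real_normed_vector \<Rightarrow> real"
  assumes "f differentiable (at x)"
  shows "frechet_derivative (\<lambda>x. c * f x) (at x) i = c * frechet_derivative f (at x) i"
  by (rule fun_cong[OF frechet_derivative_at[OF has_derivative_mult_right[OF assms[THEN has_frechet_derivative]]], symmetric])

lemma C_k_add: "C_k k f \<Longrightarrow> C_k k g \<Longrightarrow> C_k k (\<lambda>x. f x + g x)"
proof (induction k arbitrary: f g)
  case (Suc k)
  then have d: "\<And>x. f differentiable (at x)" "\<And>x. g differentiable (at x)" by auto
  have "C_k k (\<lambda>x. frechet_derivative f (at x) i + frechet_derivative g (at x) i)" if "i \<in> Basis" for i
    using Suc.prems that by (intro Suc.IH) auto
  then show ?case using d by (simp add: frechet_derivative_add[OF d] differentiable_add)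
qed (auto intro: continuous_intros)

lemma C_k_scale: "C_k k f \<Longrightarrow> C_k k (\<lambda>x. c * f x)"
proof (induction k arbitrary: f)
  case (Suc k)
  then have d: "\<And>x. f differentiable (at x)" by auto
  have "C_k k (\<lambda>x. c * frechet_derivative f (at x) i)" if "i \<in> Basis" for i
    using Suc.prems that by (intro Suc.IH) auto
  then show ?case using d by (simp add: frechet_derivative_scale[OF d] differentiable_mult)
qed (auto intro: continuous_intros)

lemma C_k_zero: "C_k k (\<lambda>x. 0 :: real)"
proof (induction k)
  case (Suc k)
  then show ?case by (simp add: frechet_derivative_const)
qed simp

text \<open>Serves for partial derivatives and multiples, whose supports can only shrink.\<close>

lemma test_functions_support:
  assumes "\<phi> \<in> test_functions \<Omega>" "{x. \<psi> x \<noteq> 0} \<subseteq> closure {x. \<phi> x \<noteq> 0}" "\<And>k. C_k k \<psi>"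
  shows "\<psi> \<in> test_functions \<Omega>"
proof -
  have sub: "closure {x. \<psi> x \<noteq> 0} \<subseteq> closure {x. \<phi> x \<noteq> 0}"
    using assms(2) by (rule closure_minimal) simp
  have "compact (closure {x. \<phi> x \<noteq> 0})" using assms(1) by (simp add: test_functions_def)
  then have "compact (closure {x. \<phi> x \<noteq> 0} \<inter> closure {x. \<psi> x \<noteq> 0})" by (intro compact_Int_closed closed_closure)
  then have "compact (closure {x. \<psi> x \<noteq> 0})" unfolding Int_absorb1[OF sub] .
  moreover have "closure {x. \<psi> x \<noteq> 0} \<subseteq> \<Omega>"
    using assms(1) sub unfolding test_functions_def by blast
  ultimately show ?thesis using assms(3) unfolding test_functions_def by blast
qed

section \<open>Gradients, and functions with one bound for size and slope\<close>

abbreviation pderivative :: "('a::euclidean_space \<Rightarrow> real) \<Rightarrow> 'a \<Rightarrow> 'a \<Rightarrow> real" where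
  "pderivative f i x \<equiv> frechet_derivative f (at x) i"

definition gradient :: "('a::euclidean_space \<Rightarrow> real) \<Rightarrow> 'a \<Rightarrow> 'a" where
  "gradient f x = (\<Sum>i\<in>Basis. pderivative f i x *\<^sub>R i)"

lemma gradient_inner: "i \<in> Basis \<Longrightarrow> gradient f x \<bullet> i = pderivative f i x"
  by (simp add: gradient_def inner_sum_left_Basis)

lemma frechet_derivative_inner:
  assumes "f differentiable (at x)"
  shows "frechet_derivative f (at x) v = gradient f x \<bullet> v"
proof -
  have lin: "linear (frechet_derivative f (at x))"
    using has_frechet_derivative[OF assms] by (rule has_derivative_linear)
  have "frechet_derivative f (at x) v = frechet_derivative f (at x) (\<Sum>i\<in>Basis. (v \<bullet> i) *\<^sub>R i)"
    by (simp add: euclidean_representation)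
  also have "\<dots> = (\<Sum>i\<in>Basis. (v \<bullet> i) * pderivative f i x)"
    using lin by (simp add: linear_sum linear_scale)
  also have "\<dots> = gradient f x \<bullet> v"
    unfolding gradient_def inner_sum_left inner_scaleR_left
    by (intro sum.cong refl) (simp add: inner_commute mult.commute)
  finally show ?thesis .
qed

lemma gradient_norm: "(norm (gradient f x))\<^sup>2 = (\<Sum>i\<in>Basis. (pderivative f i x)\<^sup>2)"
proof -
  have "(norm (gradient f x))\<^sup>2 = (\<Sum>i\<in>Basis. (gradient f x \<bullet> i) * (gradient f x \<bullet> i))"
    by (simp only: power2_norm_eq_inner) (rule euclidean_inner)
  then show ?thesis by (simp add: gradient_inner power2_eq_square)
qed

text \<open>A single constant for size and slope adds up along series and bounds the squared Sobolev
  norms by a multiple of \<open>L\<^sup>2\<close>.\<close>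

definition nice :: "('a::euclidean_space \<Rightarrow> real) \<Rightarrow> real \<Rightarrow> bool" where
  "nice f L \<longleftrightarrow> 0 \<le> L \<and> (\<forall>x. f differentiable (at x)) \<and> (\<forall>x. \<bar>f x\<bar> \<le> L) \<and>
     (\<forall>x y. \<bar>f x - f y\<bar> \<le> L * dist x y)"

text \<open>A sequence of quotients rather than a limit in \<open>t\<close>, as dominated
  convergence and measurability of limits are used for sequences.\<close>

lemma difference_quotient_tendsto:
  assumes "f differentiable (at x)"
  shows "(\<lambda>n. real (Suc n) * (f (x + (1 / real (Suc n)) *\<^sub>R v) - f x)) \<longlonglongrightarrow> frechet_derivative f (at x) v"
proof -
  define g where "g t = f (x + t *\<^sub>R v)" for t
  have "((\<lambda>t. x + t *\<^sub>R v) has_derivative (\<lambda>t. t *\<^sub>R v)) (at 0)"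
    by (auto intro!: derivative_eq_intros)
  moreover have "(f has_derivative frechet_derivative f (at x)) (at (x + 0 *\<^sub>R v))"
    using has_frechet_derivative[OF assms] by simp
  ultimately have "(g has_derivative (\<lambda>t. frechet_derivative f (at x) (t *\<^sub>R v))) (at 0)"
    unfolding g_def by (rule has_derivative_compose)
  moreover have "frechet_derivative f (at x) (t *\<^sub>R v) = frechet_derivative f (at x) v * t" for t
    using has_derivative_linear[OF has_frechet_derivative[OF assms]] by (simp add: linear_scale)
  ultimately have "(g has_real_derivative frechet_derivative f (at x) v) (at 0)"
    by (simp add: has_field_derivative_def)
  then have "((\<lambda>h. (g h - g 0) / h) \<longlongrightarrow> frechet_derivative f (at x) v) (at 0)"
    by (simp add: DERIV_def)
  moreover have "(\<lambda>n. 1 / real (Suc n)) \<longlonglongrightarrow> 0"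
    by (rule LIMSEQ_Suc[OF lim_const_over_n])
  then have "filterlim (\<lambda>n. 1 / real (Suc n)) (at 0) sequentially"
    by (rule filterlim_atI) simp
  ultimately have "(\<lambda>n. (g (1 / real (Suc n)) - g 0) / (1 / real (Suc n))) \<longlonglongrightarrow> frechet_derivative f (at x) v"
    by (rule filterlim_compose)
  then show ?thesis by (simp add: g_def mult.commute)
qed

lemma nice_continuous: "nice f L \<Longrightarrow> continuous_on A f"
  by (auto simp: nice_def intro!: continuous_at_imp_continuous_on differentiable_imp_continuous_within)

lemma nice_measurable: "nice f L \<Longrightarrow> f \<in> borel_measurable borel"
  by (rule borel_measurable_continuous_onI[OF nice_continuous])

lemma nice_derivative_bound:
  assumes f: "nice f L"
  shows "\<bar>frechet_derivative f (at x) v\<bar> \<le> L * norm v"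
proof -
  have d: "f differentiable (at x)" using f by (simp add: nice_def)
  show ?thesis
  proof (rule LIMSEQ_le_const2[OF tendsto_rabs[OF difference_quotient_tendsto[OF d, of v]]], intro exI allI impI)
    fix n
    have "\<bar>f (x + (1 / real (Suc n)) *\<^sub>R v) - f x\<bar> \<le> L * dist (x + (1 / real (Suc n)) *\<^sub>R v) x"
      using f by (simp add: nice_def)
    also have "\<dots> = L * norm v / real (Suc n)" by (simp add: dist_norm)
    finally show "\<bar>real (Suc n) * (f (x + (1 / real (Suc n)) *\<^sub>R v) - f x)\<bar> \<le> L * norm v"
      unfolding abs_mult by (simp add: pos_le_divide_eq mult.commute del: of_nat_Suc)
  qed
qed

lemma pderivative_measurable:
  fixes f :: "'a::euclidean_space \<Rightarrow> real"
  assumes f: "f \<in> borel_measurable borel" "\<And>x. f differentiable (at x)"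
  shows "(\<lambda>x. frechet_derivative f (at x) v) \<in> borel_measurable borel"
proof (rule borel_measurable_LIMSEQ_real[OF difference_quotient_tendsto[OF f(2)]])
  note f(1) [measurable]
  show "(\<lambda>x. real (Suc n) * (f (x + (1 / real (Suc n)) *\<^sub>R v) - f x)) \<in> borel_measurable borel" for n
    by measurable
qed

section \<open>Integration by parts from translation invariance\<close>

lemma integral_translate:
  fixes f :: "'a::euclidean_space \<Rightarrow> real"
  assumes [measurable]: "f \<in> borel_measurable borel"
  shows "(\<integral>x. f (x + h) \<partial>lborel) = (\<integral>x. f x \<partial>lborel)"
    and "integrable lborel (\<lambda>x. f (x + h)) \<longleftrightarrow> integrable lborel f"
proof -
  have "(\<integral>x. f x \<partial>lborel) = (\<integral>x. f x \<partial>distr lborel borel ((+) h))" by (simp add: lborel_distr_plus)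
  also have "\<dots> = (\<integral>x. f (x + h) \<partial>lborel)" by (subst integral_distr) (auto simp: add.commute)
  finally show "(\<integral>x. f (x + h) \<partial>lborel) = (\<integral>x. f x \<partial>lborel)" by simp
  have "integrable lborel f \<longleftrightarrow> integrable (distr lborel borel ((+) h)) f" by (simp add: lborel_distr_plus)
  also have "\<dots> \<longleftrightarrow> integrable lborel (\<lambda>x. f (x + h))" by (subst integrable_distr_eq) (auto simp: add.commute)
  finally show "integrable lborel (\<lambda>x. f (x + h)) \<longleftrightarrow> integrable lborel f" by simp
qed

lemma nn_integral_translate:
  fixes f :: "'a::euclidean_space \<Rightarrow> ennreal"
  assumes [measurable]: "f \<in> borel_measurable borel"
  shows "(\<integral>\<^sup>+x. f (h + x) \<partial>lborel) = (\<integral>\<^sup>+x. f x \<partial>lborel)"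
proof -
  have "(\<integral>\<^sup>+x. f x \<partial>lborel) = (\<integral>\<^sup>+x. f x \<partial>distr lborel borel ((+) h))" by (simp add: lborel_distr_plus)
  also have "\<dots> = (\<integral>\<^sup>+x. f (h + x) \<partial>lborel)" by (subst nn_integral_distr) auto
  finally show ?thesis by simp
qed

lemma bounded_support_integrable:
  fixes f :: "'a::euclidean_space \<Rightarrow> real"
  assumes "f \<in> borel_measurable borel" "\<And>x. \<bar>f x\<bar> \<le> B" "\<And>x. x \<notin> cball 0 R \<Longrightarrow> f x = 0"
  shows "integrable lborel f"
proof (rule Bochner_Integration.integrable_bound)
  show "integrable lborel (\<lambda>x. B * indicator (cball 0 R) x)"
    by (intro integrable_mult_right integrable_real_indicator) (auto simp: emeasure_bounded_finite[unfolded infinity_ennreal_def])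
  show "AE x in lborel. norm (f x) \<le> norm (B * indicator (cball 0 R) x)"
    using assms(3) order_trans[OF assms(2) abs_ge_self] by (intro AE_I2) (auto simp: indicator_def)
qed (use assms in simp)

text \<open>Difference quotients have integral 0 by translation invariance, and dominated
  convergence passes this on to the derivative.\<close>

lemma integral_pderivative_eq_0:
  fixes f :: "'a::euclidean_space \<Rightarrow> real"
  assumes f: "nice f L" and supp: "\<And>x. x \<notin> cball 0 R \<Longrightarrow> f x = 0"
  shows "integrable lborel (\<lambda>x. frechet_derivative f (at x) v)"
    and "(\<integral>x. frechet_derivative f (at x) v \<partial>lborel) = 0"
proof -
  have d: "f differentiable (at x)" for x using f by (simp add: nice_def)
  note [measurable] = nice_measurable[OF f]
  define q where "q n x = real (Suc n) * (f (x + (1 / real (Suc n)) *\<^sub>R v) - f x)" for n x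
  \<comment> \<open>The shifts have length at most \<open>norm v\<close>, so all quotients vanish
    outside the enlarged ball.\<close>
  define w where "w x = L * norm v * indicator (cball 0 (R + norm v)) x" for x :: 'a
  have L: "0 \<le> L" using f by (simp add: nice_def)
  have wi: "integrable lborel w" unfolding w_def
    by (intro integrable_mult_right integrable_real_indicator) (auto simp: emeasure_bounded_finite[unfolded infinity_ennreal_def])
  have lim: "(\<lambda>n. q n x) \<longlonglongrightarrow> frechet_derivative f (at x) v" for x
    unfolding q_def by (rule difference_quotient_tendsto[OF d])
  have bound: "\<bar>q n x\<bar> \<le> w x" for n x
  proof (cases "x \<in> cball 0 (R + norm v)")
    case True
    have "\<bar>f (x + (1 / real (Suc n)) *\<^sub>R v) - f x\<bar> \<le> L * dist (x + (1 / real (Suc n)) *\<^sub>R v) x"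
      using f by (simp add: nice_def)
    also have "\<dots> = L * norm v / real (Suc n)" by (simp add: dist_norm)
    finally have "\<bar>q n x\<bar> \<le> L * norm v"
      unfolding q_def abs_mult by (simp add: pos_le_divide_eq mult.commute del: of_nat_Suc)
    then show ?thesis using True by (simp add: w_def)
  next
    case False
    have "norm x \<le> norm (x + (1 / real (Suc n)) *\<^sub>R v) + norm ((1 / real (Suc n)) *\<^sub>R v)"
      using norm_triangle_ineq4[of "x + (1 / real (Suc n)) *\<^sub>R v" "(1 / real (Suc n)) *\<^sub>R v"] by simp
    moreover have "norm ((1 / real (Suc n)) *\<^sub>R v) \<le> norm v"
      by (simp add: divide_le_eq mult_le_cancel_left1)
    moreover have "R + norm v < norm x" using False by simp
    ultimately have "R < norm x" "R < norm (x + (1 / real (Suc n)) *\<^sub>R v)"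
      using norm_ge_zero[of v] by linarith+
    then have "x \<notin> cball 0 R" "x + (1 / real (Suc n)) *\<^sub>R v \<notin> cball 0 R" by simp_all
    then show ?thesis using supp False by (simp add: q_def w_def)
  qed
  have fi: "integrable lborel f"
    by (rule bounded_support_integrable[of _ L R]) (use f supp in \<open>auto simp: nice_def\<close>)
  have q0: "(\<integral>x. q n x \<partial>lborel) = 0" for n
  proof -
    have "(\<integral>x. q n x \<partial>lborel) = real (Suc n) * ((\<integral>x. f (x + (1 / real (Suc n)) *\<^sub>R v) \<partial>lborel) - (\<integral>x. f x \<partial>lborel))"
      unfolding q_def using fi by (simp add: integral_translate)
    then show ?thesis by (simp add: integral_translate)
  qed
  have dm: "(\<lambda>x. frechet_derivative f (at x) v) \<in> borel_measurable lborel"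
    using pderivative_measurable[OF _ d] by simp
  have qm: "q n \<in> borel_measurable lborel" for n unfolding q_def by measurable
  show "integrable lborel (\<lambda>x. frechet_derivative f (at x) v)"
    by (rule integrable_dominated_convergence[where s = q, OF dm qm wi]) (use lim bound in auto)
  have "(\<lambda>n. \<integral>x. q n x \<partial>lborel) \<longlonglongrightarrow> (\<integral>x. frechet_derivative f (at x) v \<partial>lborel)"
    by (rule integral_dominated_convergence[where s = q, OF dm qm wi]) (use lim bound in auto)
  then show "(\<integral>x. frechet_derivative f (at x) v \<partial>lborel) = 0"
    unfolding q0 by (simp add: LIMSEQ_const_iff)
qed

lemma test_function_basic:
  assumes "\<phi> \<in> test_functions \<Omega>"
  shows "\<phi> differentiable (at x)" "C_k k \<phi>" "compact (closure {x. \<phi> x \<noteq> 0})" "closure {x. \<phi> x \<noteq> 0} \<subseteq> \<Omega>"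
    "x \<notin> closure {x. \<phi> x \<noteq> 0} \<Longrightarrow> \<phi> x = 0"
proof -
  show C: "C_k k \<phi>" for k using assms by (simp add: test_functions_def)
  from C[of 1] show "\<phi> differentiable (at x)" by simp
  show "compact (closure {x. \<phi> x \<noteq> 0})" "closure {x. \<phi> x \<noteq> 0} \<subseteq> \<Omega>"
    using assms by (auto simp: test_functions_def)
  show "\<phi> x = 0" if "x \<notin> closure {x. \<phi> x \<noteq> 0}" using that closure_subset[of "{x. \<phi> x \<noteq> 0}"] by blast
qed

lemma test_function_derivative_outside:
  assumes "x \<notin> closure {x. \<phi> x \<noteq> 0}"
  shows "frechet_derivative \<phi> (at x) v = (0 :: real)"
proof -
  have "((\<lambda>x. 0) has_derivative (\<lambda>v. 0)) (at x)" by simp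
  then have "(\<phi> has_derivative (\<lambda>v. 0)) (at x)"
    by (rule has_derivative_transform_within_open[of _ _ _ _ "- closure {x. \<phi> x \<noteq> 0}"])
      (use assms closure_subset[of "{x. \<phi> x \<noteq> 0}"] in auto)
  from frechet_derivative_at[OF this] show ?thesis by metis
qed

lemma test_function_pderivative:
  assumes \<phi>: "\<phi> \<in> test_functions \<Omega>" and i: "i \<in> Basis"
  shows "pderivative \<phi> i \<in> test_functions \<Omega>"
proof (rule test_functions_support[OF \<phi>])
  show "{x. pderivative \<phi> i x \<noteq> 0} \<subseteq> closure {x. \<phi> x \<noteq> 0}"
    using test_function_derivative_outside[of _ \<phi> i] by blast
  show "C_k k (pderivative \<phi> i)" for k
    using test_function_basic(2)[OF \<phi>, of "Suc k"] i by simp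
qed

lemma compact_support_bounded:
  fixes f :: "'a::euclidean_space \<Rightarrow> real"
  assumes "continuous_on UNIV f" "compact S" "\<And>x. x \<notin> S \<Longrightarrow> f x = 0"
  shows "\<exists>B>0. \<forall>x. \<bar>f x\<bar> \<le> B"
proof -
  have "compact (f ` S)" by (rule compact_continuous_image[OF continuous_on_subset[OF assms(1)] assms(2)]) simp
  then obtain B where B: "0 < B" "\<And>y. y \<in> f ` S \<Longrightarrow> norm y \<le> B"
    using compact_imp_bounded bounded_pos by metis
  have "\<bar>f x\<bar> \<le> B" for x using B assms(3)[of x] by (cases "x \<in> S") auto
  then show ?thesis using B(1) by blast
qed

text \<open>Compact support bounds the values and the partial derivatives; the mean value inequality
  on the whole space, which is convex, turns the latter into a slope.\<close>

lemma test_function_nice: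
  assumes \<phi>: "\<phi> \<in> test_functions \<Omega>"
  obtains L where "0 < L" "nice \<phi> L"
proof -
  note b = test_function_basic[OF \<phi>]
  let ?S = "closure {x. \<phi> x \<noteq> 0}"
  have "continuous_on UNIV \<phi>" using b(2)[of 0] by simp
  then have "\<exists>B>0. \<forall>x. \<bar>\<phi> x\<bar> \<le> B"
    by (rule compact_support_bounded[OF _ b(3)]) (rule b(5))
  then obtain B where B: "0 < B" "\<And>x. \<bar>\<phi> x\<bar> \<le> B" by blast
  have "\<forall>i\<in>Basis. \<exists>B. 0 < B \<and> (\<forall>x. \<bar>pderivative \<phi> i x\<bar> \<le> B)"
  proof
    fix i :: 'a assume "i \<in> Basis"
    then have "continuous_on UNIV (pderivative \<phi> i)" using b(2)[of 1] by simp
    then show "\<exists>B>0. \<forall>x. \<bar>pderivative \<phi> i x\<bar> \<le> B"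
      by (rule compact_support_bounded[OF _ b(3)]) (rule test_function_derivative_outside)
  qed
  from bchoice[OF this] obtain D
    where "\<forall>i\<in>Basis. 0 < D i \<and> (\<forall>x. \<bar>pderivative \<phi> i x\<bar> \<le> D i)" by (elim exE)
  then have D: "0 < D i" "\<bar>pderivative \<phi> i x\<bar> \<le> D i" if "i \<in> Basis" for i x using that by blast+
  define K where "K = (\<Sum>i\<in>Basis. D i)"
  have K: "0 \<le> K" unfolding K_def using D(1) by (intro sum_nonneg less_imp_le)
  have bnd: "\<bar>frechet_derivative \<phi> (at x) v\<bar> \<le> K * norm v" for x v
  proof -
    have "norm (gradient \<phi> x) \<le> (\<Sum>i\<in>Basis. norm (pderivative \<phi> i x *\<^sub>R i))"
      unfolding gradient_def by (rule norm_sum)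
    also have "\<dots> \<le> K" unfolding K_def using D(2) by (intro sum_mono) simp
    finally have "norm (gradient \<phi> x) * norm v \<le> K * norm v" by (rule mult_right_mono) simp
    then show ?thesis
      using Cauchy_Schwarz_ineq2[of "gradient \<phi> x" v] by (simp add: frechet_derivative_inner[OF b(1)])
  qed
  have lip: "\<bar>\<phi> x - \<phi> y\<bar> \<le> K * dist x y" for x y
  proof -
    have "norm (\<phi> x - \<phi> y) \<le> K * norm (x - y)"
    proof (rule differentiable_bound[where f' = "\<lambda>x. frechet_derivative \<phi> (at x)" and S = UNIV])
      show "(\<phi> has_derivative frechet_derivative \<phi> (at z)) (at z within UNIV)" for z
        using has_frechet_derivative[OF b(1)] by simp
      show "onorm (frechet_derivative \<phi> (at z)) \<le> K" for z
        using bnd[of z] by (intro onorm_bound K) (simp add: mult.commute)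
    qed auto
    then show ?thesis by (simp add: dist_norm)
  qed
  have "nice \<phi> (B + K)"
    unfolding nice_def
  proof (intro conjI allI)
    show "\<bar>\<phi> x\<bar> \<le> B + K" for x using B(2)[of x] K by linarith
    show "\<bar>\<phi> x - \<phi> y\<bar> \<le> (B + K) * dist x y" for x y
      using lip[of x y] mult_nonneg_nonneg[OF less_imp_le[OF B(1)] zero_le_dist[of x y]]
      by (simp add: distrib_right)
  qed (use b(1) B(1) K in auto)
  then show ?thesis using that[of "B + K"] B(1) K by simp
qed

lemma compact_in_cball:
  fixes S :: "'a::euclidean_space set"
  assumes "compact S"
  obtains R where "0 < R" "S \<subseteq> cball 0 R"
  using compact_imp_bounded[OF assms] that by (auto simp: bounded_pos subset_iff)

lemma weak_gradientD:
  assumes "weak_gradient \<Omega> u g" "\<phi> \<in> test_functions \<Omega>" "i \<in> Basis"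
  shows "integrable (domain_measure \<Omega>) (\<lambda>x. u x * pderivative \<phi> i x)"
    and "integrable (domain_measure \<Omega>) (\<lambda>x. (g x \<bullet> i) * \<phi> x)"
    and "(\<integral>x. u x * pderivative \<phi> i x \<partial>domain_measure \<Omega>)
      = - (\<integral>x. (g x \<bullet> i) * \<phi> x \<partial>domain_measure \<Omega>)"
  using bspec[OF bspec[OF conjunct2[OF assms(1)[unfolded weak_gradient_def]] assms(2)] assms(3)]
  by simp_all

context
  fixes \<Omega> :: "'a::euclidean_space set"
  assumes op: "open \<Omega>"
begin

lemma space_domain_measure [simp]: "space (domain_measure \<Omega>) = \<Omega>"
  by (simp add: domain_measure_def space_restrict_space)

lemma measurable_domain: "f \<in> borel_measurable borel \<Longrightarrow> f \<in> borel_measurable (domain_measure \<Omega>)"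
  unfolding domain_measure_def by (rule measurable_restrict_space1) simp

lemma integral_domain:
  fixes f :: "'a \<Rightarrow> real"
  assumes "\<And>x. x \<notin> \<Omega> \<Longrightarrow> f x = 0"
  shows "integrable (domain_measure \<Omega>) f \<longleftrightarrow> integrable lborel f"
    and "(\<integral>x. f x \<partial>domain_measure \<Omega>) = (\<integral>x. f x \<partial>lborel)"
proof -
  have "indicator \<Omega> x *\<^sub>R f x = f x" for x using assms[of x] by (auto simp: indicator_def)
  moreover have "\<Omega> \<inter> space lborel \<in> sets lborel" using op by simp
  ultimately show "integrable (domain_measure \<Omega>) f \<longleftrightarrow> integrable lborel f"
    "(\<integral>x. f x \<partial>domain_measure \<Omega>) = (\<integral>x. f x \<partial>lborel)"
    using integrable_restrict_space[of \<Omega> lborel f] integral_restrict_space[of \<Omega> lborel f]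
    unfolding domain_measure_def by presburger+
qed

lemma nn_integral_domain:
  "(\<integral>\<^sup>+x. f x \<partial>domain_measure \<Omega>) = (\<integral>\<^sup>+x. f x * indicator \<Omega> x \<partial>lborel)"
  unfolding domain_measure_def using op by (simp add: nn_integral_restrict_space)

text \<open>The product \<open>P\<close> of \<open>f\<close> with a test function has compact
  support, so the integral of its partial derivative vanishes; the product rule then gives
  integration by parts.\<close>

lemma nice_weak_gradient:
  assumes f: "nice f L"
  shows "weak_gradient \<Omega> f (gradient f)"
  unfolding weak_gradient_def
proof (intro conjI ballI)
  have df: "f differentiable (at x)" for x using f by (simp add: nice_def)
  have fm [measurable]: "f \<in> borel_measurable borel" by (rule nice_measurable[OF f])
  have gm [measurable]: "pderivative f i \<in> borel_measurable borel" for i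
    by (rule pderivative_measurable[OF fm df])
  have "gradient f \<in> borel_measurable borel" unfolding gradient_def[abs_def] by measurable
  then show "gradient f \<in> borel_measurable (domain_measure \<Omega>)"
    unfolding domain_measure_def by (intro measurable_restrict_space1) simp
  fix \<phi> i assume \<phi>: "\<phi> \<in> test_functions \<Omega>" and i: "i \<in> (Basis :: 'a set)"
  note b = test_function_basic[OF \<phi>]
  let ?S = "closure {x. \<phi> x \<noteq> 0}"
  obtain K where K: "0 < K" "nice \<phi> K" by (rule test_function_nice[OF \<phi>])
  obtain R where R: "?S \<subseteq> cball 0 R" using compact_in_cball[OF b(3)] by blast
  have \<phi>m [measurable]: "\<phi> \<in> borel_measurable borel" by (rule nice_measurable[OF K(2)])
  have \<phi>dm [measurable]: "pderivative \<phi> i \<in> borel_measurable borel"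
    by (rule pderivative_measurable[OF \<phi>m b(1)])
  have out: "\<phi> x = 0" "pderivative \<phi> i x = 0" if "x \<notin> ?S" for x
    using b(5)[OF that] test_function_derivative_outside[OF that] by auto
  have outR: "\<phi> x = 0" "pderivative \<phi> i x = 0" if "x \<notin> cball 0 R" for x using out R that by blast+
  have outO: "\<phi> x = 0" "pderivative \<phi> i x = 0" if "x \<notin> \<Omega>" for x using out b(4) that by blast+
  have ne: "norm i = 1" using i by simp
  have fL: "\<bar>f x\<bar> \<le> L" "\<bar>pderivative f i x\<bar> \<le> L" for x
    using f nice_derivative_bound[OF f, of x i] ne by (auto simp: nice_def)
  have L0: "0 \<le> L" using f by (simp add: nice_def)
  have \<phi>K: "\<bar>\<phi> x\<bar> \<le> K" "\<bar>pderivative \<phi> i x\<bar> \<le> K" for x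
    using K(2) nice_derivative_bound[OF K(2), of x i] ne by (auto simp: nice_def)
  have prod: "\<bar>a * b\<bar> \<le> L * K" if "\<bar>a\<bar> \<le> L" "\<bar>b\<bar> \<le> K" for a b
    unfolding abs_mult using that L0 by (intro mult_mono) auto
  have i1: "integrable lborel (\<lambda>x. f x * pderivative \<phi> i x)"
    by (rule bounded_support_integrable[where B = "L * K" and R = R]) (use prod[OF fL(1) \<phi>K(2)] outR in auto)
  have i2: "integrable lborel (\<lambda>x. pderivative f i x * \<phi> x)"
    by (rule bounded_support_integrable[where B = "L * K" and R = R]) (use prod[OF fL(2) \<phi>K(1)] outR in auto)
  show "integrable (domain_measure \<Omega>) (\<lambda>x. f x * pderivative \<phi> i x)"
    using i1 outO by (subst integral_domain) auto
  show "integrable (domain_measure \<Omega>) (\<lambda>x. (gradient f x \<bullet> i) * \<phi> x)"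
    unfolding gradient_inner[OF i] using i2 outO by (subst integral_domain) auto
  define P where "P x = f x * \<phi> x" for x
  have dP: "(P has_derivative (\<lambda>v. f x * frechet_derivative \<phi> (at x) v + frechet_derivative f (at x) v * \<phi> x)) (at x)" for x
    unfolding P_def by (intro has_derivative_mult has_frechet_derivative df b(1))
  have pP: "pderivative P i x = f x * pderivative \<phi> i x + pderivative f i x * \<phi> x" for x
    using fun_cong[OF frechet_derivative_at[OF dP[of x]], of i] by simp
  \<comment> \<open>The slope is at most \<open>2 * L * K\<close> and the size at most
    \<open>L * K\<close>; the sum bounds both.\<close>
  have "nice P (2 * L * K + L * K)"
    unfolding nice_def
  proof (intro conjI allI)
    show "0 \<le> 2 * L * K + L * K" using L0 K(1) by simp
    show "P differentiable (at x)" for x using dP by (rule differentiableI)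
    show "\<bar>P x\<bar> \<le> 2 * L * K + L * K" for x
    proof -
      have "2 * L * K + L * K = 3 * (L * K)" by simp
      then show ?thesis unfolding P_def
        using prod[OF fL(1) \<phi>K(1), of x x] mult_nonneg_nonneg[OF L0 less_imp_le[OF K(1)]] by linarith
    qed
    show "\<bar>P x - P y\<bar> \<le> (2 * L * K + L * K) * dist x y" for x y
    proof -
      have "P x - P y = f x * (\<phi> x - \<phi> y) + (f x - f y) * \<phi> y" by (simp add: P_def algebra_simps)
      then have "\<bar>P x - P y\<bar> \<le> \<bar>f x\<bar> * \<bar>\<phi> x - \<phi> y\<bar> + \<bar>f x - f y\<bar> * \<bar>\<phi> y\<bar>"
        using abs_triangle_ineq[of "f x * (\<phi> x - \<phi> y)" "(f x - f y) * \<phi> y"] by (simp add: abs_mult)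
      also have "\<dots> \<le> L * (K * dist x y) + (L * dist x y) * K"
        using f K L0 by (intro add_mono mult_mono) (auto simp: nice_def)
      also have "\<dots> = 2 * (L * K * dist x y)" by simp
      also have "\<dots> \<le> 3 * (L * K * dist x y)"
        using mult_nonneg_nonneg[OF mult_nonneg_nonneg[OF L0 less_imp_le[OF K(1)]] zero_le_dist[of x y]]
        by linarith
      also have "\<dots> = (2 * L * K + L * K) * dist x y" by (simp add: distrib_right)
      finally show ?thesis .
    qed
  qed
  moreover have "P x = 0" if "x \<notin> cball 0 R" for x using outR(1)[OF that] by (simp add: P_def)
  ultimately have "(\<integral>x. pderivative P i x \<partial>lborel) = 0" by (rule integral_pderivative_eq_0(2))
  then have "(\<integral>x. f x * pderivative \<phi> i x \<partial>lborel) + (\<integral>x. pderivative f i x * \<phi> x \<partial>lborel) = 0"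
    unfolding pP using i1 i2 by simp
  then show "(\<integral>x. f x * pderivative \<phi> i x \<partial>domain_measure \<Omega>) = - (\<integral>x. (gradient f x \<bullet> i) * \<phi> x \<partial>domain_measure \<Omega>)"
    unfolding gradient_inner[OF i] using outO by (simp add: integral_domain)
qed

text \<open>Testing with \<open>\<partial>\<^sub>i \<phi>\<close> itself shows that the classical gradient of a test function has the
  smallest norm among all weak gradients.\<close>

lemma dirichlet_test_function:
  assumes \<phi>: "\<phi> \<in> test_functions \<Omega>"
  shows "(\<integral>\<^sup>+x. ennreal ((norm (gradient \<phi> x))\<^sup>2) \<partial>lborel) \<le> dirichlet_sq \<Omega> \<phi>"
  unfolding dirichlet_sq_def
proof (rule INF_greatest)
  fix g assume "g \<in> {g. weak_gradient \<Omega> \<phi> g}"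
  then have g: "weak_gradient \<Omega> \<phi> g" by simp
  let ?M = "domain_measure \<Omega>"
  have gm [measurable]: "g \<in> borel_measurable ?M" using g by (simp add: weak_gradient_def)
  obtain L where L: "0 < L" "nice \<phi> L" by (rule test_function_nice[OF \<phi>])
  have wg: "weak_gradient \<Omega> \<phi> (gradient \<phi>)" by (rule nice_weak_gradient[OF L(2)])
  have out: "pderivative \<phi> i x = 0" if "x \<notin> \<Omega>" for x i
    using test_function_derivative_outside[of x \<phi> i] test_function_basic(4)[OF \<phi>] that by blast
  show "(\<integral>\<^sup>+x. ennreal ((norm (gradient \<phi> x))\<^sup>2) \<partial>lborel) \<le> (\<integral>\<^sup>+x. ennreal ((norm (g x))\<^sup>2) \<partial>?M)"
  proof (cases "(\<integral>\<^sup>+x. ennreal ((norm (g x))\<^sup>2) \<partial>?M) = \<infinity>")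
    case False
    then have gi: "integrable ?M (\<lambda>x. (norm (g x))\<^sup>2)"
      by (intro integrableI_nonneg) (auto simp: less_top[symmetric])
    have comp: "integrable ?M (\<lambda>x. (pderivative \<phi> i x)\<^sup>2) \<and> integrable ?M (\<lambda>x. (g x \<bullet> i)\<^sup>2) \<and>
      (\<integral>x. (pderivative \<phi> i x)\<^sup>2 \<partial>?M) \<le> (\<integral>x. (g x \<bullet> i)\<^sup>2 \<partial>?M)" if i: "i \<in> Basis" for i
    proof -
      have t: "pderivative \<phi> i \<in> test_functions \<Omega>" by (rule test_function_pderivative[OF \<phi> i])
      have 1: "integrable ?M (\<lambda>x. (g x \<bullet> i) * pderivative \<phi> i x)"
        "(\<integral>x. \<phi> x * pderivative (pderivative \<phi> i) i x \<partial>?M) = - (\<integral>x. (g x \<bullet> i) * pderivative \<phi> i x \<partial>?M)"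
        by (rule weak_gradientD[OF g t i])+
      have 2: "integrable ?M (\<lambda>x. (pderivative \<phi> i x)\<^sup>2)"
        "(\<integral>x. \<phi> x * pderivative (pderivative \<phi> i) i x \<partial>?M) = - (\<integral>x. (pderivative \<phi> i x)\<^sup>2 \<partial>?M)"
      proof -
        show "integrable ?M (\<lambda>x. (pderivative \<phi> i x)\<^sup>2)"
          "(\<integral>x. \<phi> x * pderivative (pderivative \<phi> i) i x \<partial>?M) = - (\<integral>x. (pderivative \<phi> i x)\<^sup>2 \<partial>?M)"
          using weak_gradientD[OF wg t i] by (simp_all add: gradient_inner[OF i] power2_eq_square)
      qed
      have 3: "integrable ?M (\<lambda>x. (g x \<bullet> i)\<^sup>2)"
      proof (rule Bochner_Integration.integrable_bound[OF gi])
        show "AE x in ?M. norm ((g x \<bullet> i)\<^sup>2) \<le> norm ((norm (g x))\<^sup>2)"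
        proof (rule AE_I2)
          fix x
          have "\<bar>g x \<bullet> i\<bar>\<^sup>2 \<le> (norm (g x))\<^sup>2" using Basis_le_norm[OF i, of "g x"] by (intro power_mono) auto
          then show "norm ((g x \<bullet> i)\<^sup>2) \<le> norm ((norm (g x))\<^sup>2)" by simp
        qed
      qed measurable
      \<comment> \<open>Both gradients give the same value when tested; the arithmetic-geometric
        mean inequality then allows half of the left side to be absorbed.\<close>
      have "(\<integral>x. (pderivative \<phi> i x)\<^sup>2 \<partial>?M) = (\<integral>x. (g x \<bullet> i) * pderivative \<phi> i x \<partial>?M)" using 1 2 by simp
      also have "\<dots> \<le> (\<integral>x. ((g x \<bullet> i)\<^sup>2 + (pderivative \<phi> i x)\<^sup>2) / 2 \<partial>?M)"
      proof (rule integral_mono[OF 1(1)])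
        show "integrable ?M (\<lambda>x. ((g x \<bullet> i)\<^sup>2 + (pderivative \<phi> i x)\<^sup>2) / 2)" using 2 3 by simp
        show "(g x \<bullet> i) * pderivative \<phi> i x \<le> ((g x \<bullet> i)\<^sup>2 + (pderivative \<phi> i x)\<^sup>2) / 2" for x
          using sum_squares_bound[of "g x \<bullet> i" "pderivative \<phi> i x"] by simp
      qed
      also have "\<dots> = ((\<integral>x. (g x \<bullet> i)\<^sup>2 \<partial>?M) + (\<integral>x. (pderivative \<phi> i x)\<^sup>2 \<partial>?M)) / 2" using 2 3 by simp
      finally show ?thesis using 2 3 by simp
    qed
    have "(\<integral>\<^sup>+x. ennreal ((norm (gradient \<phi> x))\<^sup>2) \<partial>lborel) = (\<integral>\<^sup>+x. ennreal ((norm (gradient \<phi> x))\<^sup>2) \<partial>?M)"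
      unfolding nn_integral_domain using out by (intro nn_integral_cong) (auto simp: gradient_norm indicator_def)
    also have "\<dots> = ennreal (\<integral>x. (\<Sum>i\<in>Basis. (pderivative \<phi> i x)\<^sup>2) \<partial>?M)"
      unfolding gradient_norm using comp by (intro nn_integral_eq_integral) (auto intro!: sum_nonneg)
    also have "\<dots> \<le> ennreal (\<integral>x. (\<Sum>i\<in>Basis. (g x \<bullet> i)\<^sup>2) \<partial>?M)"
      using comp by (intro ennreal_leI) (simp add: Bochner_Integration.integral_sum sum_mono)
    also have "\<dots> = (\<integral>\<^sup>+x. ennreal (\<Sum>i\<in>Basis. (g x \<bullet> i)\<^sup>2) \<partial>?M)"
      using comp by (intro nn_integral_eq_integral[symmetric]) (auto intro!: sum_nonneg)
    also have "\<dots> = (\<integral>\<^sup>+x. ennreal ((norm (g x))\<^sup>2) \<partial>?M)"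
      by (intro nn_integral_cong, simp only: power2_norm_eq_inner)
        (simp add: power2_eq_square flip: euclidean_inner)
    finally show ?thesis .
  qed simp
qed

end

section \<open>Sobolev spaces on the domain\<close>

text \<open>The shift by \<open>h\<close> is divided into \<open>n + 1\<close> equal steps.
  Cauchy-Schwarz for the sum and translation invariance bound the left side by the integral of the
  squared difference quotient with step \<open>h / (n + 1)\<close>, which tends to that of the
  squared directional derivative.\<close>

lemma test_function_translation:
  fixes \<phi> :: "'a::euclidean_space \<Rightarrow> real"
  assumes \<phi>: "\<phi> \<in> test_functions \<Omega>"
  shows "(\<integral>\<^sup>+x. ennreal ((\<phi> (x + h) - \<phi> x)\<^sup>2) \<partial>lborel)
    \<le> ennreal ((norm h)\<^sup>2) * (\<integral>\<^sup>+x. ennreal ((norm (gradient \<phi> x))\<^sup>2) \<partial>lborel)"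
proof -
  note b = test_function_basic[OF \<phi>]
  obtain L where L: "0 < L" "nice \<phi> L" by (rule test_function_nice[OF \<phi>])
  obtain R where R: "closure {x. \<phi> x \<noteq> 0} \<subseteq> cball 0 R" using compact_in_cball[OF b(3)] by blast
  have out: "\<phi> x = 0" if "x \<notin> cball 0 R" for x using b(5) R that by blast
  have m [measurable]: "\<phi> \<in> borel_measurable borel" by (rule nice_measurable[OF L(2)])
  have dm [measurable]: "pderivative \<phi> i \<in> borel_measurable borel" for i
    by (rule pderivative_measurable[OF m b(1)])
  have [measurable]: "gradient \<phi> \<in> borel_measurable borel" unfolding gradient_def[abs_def] by measurable
  define q where "q n x = (real (Suc n) * (\<phi> (x + (1 / real (Suc n)) *\<^sub>R h) - \<phi> x))\<^sup>2" for n x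
  have qm [measurable]: "q n \<in> borel_measurable borel" for n unfolding q_def by measurable
  have step: "(\<integral>\<^sup>+x. ennreal ((\<phi> (x + h) - \<phi> x)\<^sup>2) \<partial>lborel) \<le> (\<integral>\<^sup>+x. ennreal (q n x) \<partial>lborel)" for n
  proof -
    define k where "k = (1 / real (Suc n)) *\<^sub>R h"
    define a where "a j x = \<phi> (x + real (Suc j) *\<^sub>R k) - \<phi> (x + real j *\<^sub>R k)" for j x
    have [measurable]: "a j \<in> borel_measurable borel" for j unfolding a_def by measurable
    have trans: "(\<integral>\<^sup>+x. ennreal ((a j x)\<^sup>2) \<partial>lborel) = (\<integral>\<^sup>+x. ennreal ((\<phi> (x + k) - \<phi> x)\<^sup>2) \<partial>lborel)" for j
    proof -
      have "a j x = \<phi> ((real j *\<^sub>R k + x) + k) - \<phi> (real j *\<^sub>R k + x)" for x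
        by (simp add: a_def algebra_simps)
      then show ?thesis
        using nn_integral_translate[of "\<lambda>x. ennreal ((\<phi> (x + k) - \<phi> x)\<^sup>2)" "real j *\<^sub>R k"] by simp
    qed
    have "(\<phi> (x + h) - \<phi> x)\<^sup>2 \<le> real (Suc n) * (\<Sum>j<Suc n. (a j x)\<^sup>2)" for x
    proof -
      have "(\<Sum>j<Suc n. a j x) = \<phi> (x + real (Suc n) *\<^sub>R k) - \<phi> (x + real 0 *\<^sub>R k)"
        unfolding a_def by (rule sum_lessThan_telescope)
      then have "\<phi> (x + h) - \<phi> x = (\<Sum>j<Suc n. a j x)" by (simp add: k_def)
      then show ?thesis
        using sum_squared_le_sum_of_squares[of "\<lambda>j. a j x" "{..<Suc n}"] by (simp add: mult.commute)
    qed
    then have "(\<integral>\<^sup>+x. ennreal ((\<phi> (x + h) - \<phi> x)\<^sup>2) \<partial>lborel)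
      \<le> (\<integral>\<^sup>+x. ennreal (real (Suc n) * (\<Sum>j<Suc n. (a j x)\<^sup>2)) \<partial>lborel)"
      by (intro nn_integral_mono ennreal_leI)
    also have "\<dots> = (\<integral>\<^sup>+x. ennreal (real (Suc n)) * (\<Sum>j<Suc n. ennreal ((a j x)\<^sup>2)) \<partial>lborel)"
      by (intro nn_integral_cong) (subst sum_ennreal, simp, rule ennreal_mult', simp)
    also have "\<dots> = ennreal (real (Suc n)) * (\<Sum>j<Suc n. \<integral>\<^sup>+x. ennreal ((a j x)\<^sup>2) \<partial>lborel)"
      by (subst nn_integral_cmult, measurable) (subst nn_integral_sum, measurable)
    also have "\<dots> = ennreal ((real (Suc n))\<^sup>2) * (\<integral>\<^sup>+x. ennreal ((\<phi> (x + k) - \<phi> x)\<^sup>2) \<partial>lborel)"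
      unfolding trans
      by (simp add: power2_eq_square ennreal_mult ennreal_of_nat_eq_real_of_nat mult.assoc del: of_nat_Suc)
    also have "\<dots> = (\<integral>\<^sup>+x. ennreal (q n x) \<partial>lborel)"
      by (subst nn_integral_cmult[symmetric], measurable)
        (simp add: q_def k_def power_mult_distrib ennreal_mult' del: of_nat_Suc)
    finally show ?thesis .
  qed
  have [measurable]: "cball (0 :: 'a) (R + norm h) \<in> sets borel" by simp
  define w where "w x = (L * norm h)\<^sup>2 * indicator (cball 0 (R + norm h)) x" for x :: 'a
  have bound: "q n x \<le> w x" for n x
  proof (cases "x \<in> cball 0 (R + norm h)")
    case True
    have "\<bar>\<phi> (x + (1 / real (Suc n)) *\<^sub>R h) - \<phi> x\<bar> \<le> L * dist (x + (1 / real (Suc n)) *\<^sub>R h) x"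
      using L(2) by (simp add: nice_def)
    also have "\<dots> = L * norm h / real (Suc n)" by (simp add: dist_norm)
    finally have "\<bar>real (Suc n) * (\<phi> (x + (1 / real (Suc n)) *\<^sub>R h) - \<phi> x)\<bar> \<le> L * norm h"
      unfolding abs_mult by (simp add: pos_le_divide_eq mult.commute del: of_nat_Suc)
    then have "\<bar>real (Suc n) * (\<phi> (x + (1 / real (Suc n)) *\<^sub>R h) - \<phi> x)\<bar>\<^sup>2 \<le> (L * norm h)\<^sup>2"
      by (intro power_mono) auto
    then show ?thesis using True by (simp add: q_def w_def)
  next
    case False
    have "norm x \<le> norm (x + (1 / real (Suc n)) *\<^sub>R h) + norm ((1 / real (Suc n)) *\<^sub>R h)"
      using norm_triangle_ineq4[of "x + (1 / real (Suc n)) *\<^sub>R h" "(1 / real (Suc n)) *\<^sub>R h"] by simp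
    moreover have "norm ((1 / real (Suc n)) *\<^sub>R h) \<le> norm h"
      by (simp add: divide_le_eq mult_le_cancel_left1)
    moreover have "R + norm h < norm x" using False by simp
    ultimately have "R < norm x" "R < norm (x + (1 / real (Suc n)) *\<^sub>R h)"
      using norm_ge_zero[of h] by linarith+
    then have "x \<notin> cball 0 R" "x + (1 / real (Suc n)) *\<^sub>R h \<notin> cball 0 R" by simp_all
    then show ?thesis using out False by (simp add: q_def w_def)
  qed
  have "(\<lambda>n. \<integral>\<^sup>+x. ennreal (q n x) \<partial>lborel) \<longlonglongrightarrow> (\<integral>\<^sup>+x. ennreal ((frechet_derivative \<phi> (at x) h)\<^sup>2) \<partial>lborel)"
  proof (rule nn_integral_dominated_convergence[where w = "\<lambda>x. ennreal (w x)"])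
    show "(\<lambda>x. ennreal ((frechet_derivative \<phi> (at x) h)\<^sup>2)) \<in> borel_measurable lborel" by measurable
    show "(\<lambda>x. ennreal (q n x)) \<in> borel_measurable lborel" for n by measurable
    show "(\<lambda>x. ennreal (w x)) \<in> borel_measurable lborel" unfolding w_def by measurable
    have "(\<integral>\<^sup>+x. ennreal (w x) \<partial>lborel) = ennreal ((L * norm h)\<^sup>2) * emeasure lborel (cball (0 :: 'a) (R + norm h))"
      unfolding w_def by (subst nn_integral_cmult_indicator[symmetric])
        (auto intro!: nn_integral_cong simp: indicator_def)
    also have "\<dots> < \<infinity>"
      using emeasure_bounded_finite[OF bounded_cball, of "0 :: 'a" "R + norm h"] by (simp add: ennreal_mult_less_top)
    finally show "(\<integral>\<^sup>+x. ennreal (w x) \<partial>lborel) < \<infinity>" .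
    show "AE x in lborel. ennreal (q n x) \<le> ennreal (w x)" for n using bound by (simp add: ennreal_leI)
    show "AE x in lborel. (\<lambda>n. ennreal (q n x)) \<longlonglongrightarrow> ennreal ((frechet_derivative \<phi> (at x) h)\<^sup>2)"
      unfolding q_def
      by (intro AE_I2 tendsto_ennrealI tendsto_power difference_quotient_tendsto b(1))
  qed
  then have "(\<integral>\<^sup>+x. ennreal ((\<phi> (x + h) - \<phi> x)\<^sup>2) \<partial>lborel)
    \<le> (\<integral>\<^sup>+x. ennreal ((frechet_derivative \<phi> (at x) h)\<^sup>2) \<partial>lborel)"
    by (rule LIMSEQ_le_const) (use step in blast)
  also have "\<dots> \<le> (\<integral>\<^sup>+x. ennreal ((norm h)\<^sup>2) * ennreal ((norm (gradient \<phi> x))\<^sup>2) \<partial>lborel)"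
  proof (rule nn_integral_mono)
    fix x
    have "\<bar>frechet_derivative \<phi> (at x) h\<bar>\<^sup>2 \<le> (norm (gradient \<phi> x) * norm h)\<^sup>2"
      unfolding frechet_derivative_inner[OF b(1)] by (intro power_mono Cauchy_Schwarz_ineq2) simp
    then show "ennreal ((frechet_derivative \<phi> (at x) h)\<^sup>2) \<le> ennreal ((norm h)\<^sup>2) * ennreal ((norm (gradient \<phi> x))\<^sup>2)"
      by (simp add: ennreal_mult'[symmetric] power_mult_distrib mult.commute ennreal_leI)
  qed
  also have "\<dots> = ennreal ((norm h)\<^sup>2) * (\<integral>\<^sup>+x. ennreal ((norm (gradient \<phi> x))\<^sup>2) \<partial>lborel)"
    by (rule nn_integral_cmult) measurable
  finally show ?thesis .
qed

context
  fixes \<Omega> :: "'a::euclidean_space set"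
  assumes op: "open \<Omega>" and bd: "bounded \<Omega>" and nonempty: "\<Omega> \<noteq> {}"
begin

lemma emeasure_domain: "A \<in> sets borel \<Longrightarrow> A \<subseteq> \<Omega> \<Longrightarrow> emeasure (domain_measure \<Omega>) A = emeasure lborel A"
  unfolding domain_measure_def using op by (subst emeasure_restrict_space) auto

lemma space_domain [simp]: "space (domain_measure \<Omega>) = \<Omega>"
  by (rule space_domain_measure[OF op])

lemma domain_growth: "growth_measure (domain_measure \<Omega>) DIM('a) (unit_ball_vol (real DIM('a)))"
proof -
  have fin: "finite_measure (domain_measure \<Omega>)"
  proof (rule finite_measureI)
    show "emeasure (domain_measure \<Omega>) (space (domain_measure \<Omega>)) \<noteq> \<infinity>"
      using emeasure_bounded_finite[OF bd] op by (simp add: emeasure_domain)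
  qed
  interpret finite_measure "domain_measure \<Omega>" by (rule fin)
  show ?thesis
  proof
    show "sets (domain_measure \<Omega>) = sets (restrict_space borel (space (domain_measure \<Omega>)))"
      unfolding space_domain by (simp add: domain_measure_def sets_restrict_space)
    fix x r assume r: "0 < (r :: real)"
    have "ennreal (measure (domain_measure \<Omega>) (ball x r \<inter> \<Omega>)) = emeasure lborel (ball x r \<inter> \<Omega>)"
      using op by (simp add: emeasure_domain emeasure_eq_measure[symmetric])
    also have "\<dots> \<le> emeasure lborel (ball x r)" by (intro emeasure_mono) auto
    also have "\<dots> = ennreal (unit_ball_vol (real DIM('a)) * r ^ DIM('a))" using r by (simp add: emeasure_lborel_ball)
    finally show "measure (domain_measure \<Omega>) (ball x r \<inter> space (domain_measure \<Omega>)) \<le> unit_ball_vol (real DIM('a)) * r ^ DIM('a)"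
      using r by (subst (asm) ennreal_le_iff) auto
  qed (use bd op in auto)
qed

interpretation growth_measure "domain_measure \<Omega>" "DIM('a)" "unit_ball_vol (real DIM('a))"
  by (rule domain_growth)

text \<open>The segment from \<open>x\<close> to \<open>y\<close> may leave \<Omega>, so both
  integrals are enlarged to the whole space. There the substitution \<open>y = x + h\<close> and
  Fubini reduce the claim to translations with \<open>norm h < d\<close>, and
  \<open>dirichlet_test_function\<close> returns from the whole space to \<Omega>.\<close>

lemma test_function_osc:
  assumes \<phi>: "\<phi> \<in> test_functions \<Omega>" and d: "0 < d"
  shows "(\<integral>\<^sup>+x. \<integral>\<^sup>+y. ennreal ((\<phi> x - \<phi> y)\<^sup>2) * indicator (ball x d) y \<partial>domain_measure \<Omega> \<partial>domain_measure \<Omega>)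
    \<le> ennreal (unit_ball_vol (real DIM('a)) * d ^ DIM('a) * d\<^sup>2) * dirichlet_sq \<Omega> \<phi>"
proof -
  obtain L where L: "0 < L" "nice \<phi> L" by (rule test_function_nice[OF \<phi>])
  have m [measurable]: "\<phi> \<in> borel_measurable borel" by (rule nice_measurable[OF L(2)])
  have [measurable]: "ball (0 :: 'a) d \<in> sets borel" by simp
  have tm: "(\<lambda>x. ennreal ((\<phi> (x + h) - \<phi> x)\<^sup>2)) \<in> borel_measurable borel" for h
    using measurable_compose[OF borel_measurable_add[OF measurable_ident measurable_const] m, of h] m
    by (auto intro!: measurable_compose[OF _ measurable_ennreal] borel_measurable_power borel_measurable_diff)
  define E where "E = (\<integral>\<^sup>+x. ennreal ((norm (gradient \<phi> x))\<^sup>2) \<partial>lborel)"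
  have "(\<integral>\<^sup>+x. \<integral>\<^sup>+y. ennreal ((\<phi> x - \<phi> y)\<^sup>2) * indicator (ball x d) y \<partial>domain_measure \<Omega> \<partial>domain_measure \<Omega>)
    \<le> (\<integral>\<^sup>+x. \<integral>\<^sup>+y. ennreal ((\<phi> x - \<phi> y)\<^sup>2) * indicator (ball x d) y \<partial>lborel \<partial>lborel)"
    unfolding nn_integral_domain[OF op]
    by (intro nn_integral_mono) (auto simp: indicator_def intro!: nn_integral_mono)
  also have "\<dots> = (\<integral>\<^sup>+x. \<integral>\<^sup>+h. ennreal ((\<phi> (x + h) - \<phi> x)\<^sup>2) * indicator (ball 0 d) h \<partial>lborel \<partial>lborel)"
  proof (rule nn_integral_cong)
    fix x :: 'a
    have [measurable]: "ball x d \<in> sets borel" by simp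
    have "(\<integral>\<^sup>+y. ennreal ((\<phi> x - \<phi> y)\<^sup>2) * indicator (ball x d) y \<partial>lborel)
      = (\<integral>\<^sup>+h. ennreal ((\<phi> x - \<phi> (x + h))\<^sup>2) * indicator (ball x d) (x + h) \<partial>lborel)"
      by (rule nn_integral_translate[symmetric, of "\<lambda>y. ennreal ((\<phi> x - \<phi> y)\<^sup>2) * indicator (ball x d) y"]) measurable
    also have "\<dots> = (\<integral>\<^sup>+h. ennreal ((\<phi> (x + h) - \<phi> x)\<^sup>2) * indicator (ball 0 d) h \<partial>lborel)"
      by (intro nn_integral_cong) (auto simp: indicator_def dist_norm power2_commute)
    finally show "(\<integral>\<^sup>+y. ennreal ((\<phi> x - \<phi> y)\<^sup>2) * indicator (ball x d) y \<partial>lborel)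
      = (\<integral>\<^sup>+h. ennreal ((\<phi> (x + h) - \<phi> x)\<^sup>2) * indicator (ball 0 d) h \<partial>lborel)" .
  qed
  also have "\<dots> = (\<integral>\<^sup>+h. \<integral>\<^sup>+x. ennreal ((\<phi> (x + h) - \<phi> x)\<^sup>2) * indicator (ball 0 d) h \<partial>lborel \<partial>lborel)"
    by (rule lborel_pair.Fubini') measurable
  also have "\<dots> \<le> (\<integral>\<^sup>+h. ennreal (d\<^sup>2) * E * indicator (ball (0 :: 'a) d) h \<partial>lborel)"
  proof (rule nn_integral_mono)
    fix h :: 'a
    have "(\<integral>\<^sup>+x. ennreal ((\<phi> (x + h) - \<phi> x)\<^sup>2) * indicator (ball 0 d) h \<partial>lborel)
      = (\<integral>\<^sup>+x. ennreal ((\<phi> (x + h) - \<phi> x)\<^sup>2) \<partial>lborel) * indicator (ball 0 d) h"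
      by (rule nn_integral_multc) (use tm in simp)
    also have "\<dots> \<le> ennreal (d\<^sup>2) * E * indicator (ball 0 d) h"
    proof (cases "h \<in> ball 0 d")
      case True
      have "(\<integral>\<^sup>+x. ennreal ((\<phi> (x + h) - \<phi> x)\<^sup>2) \<partial>lborel) \<le> ennreal ((norm h)\<^sup>2) * E"
        unfolding E_def by (rule test_function_translation[OF \<phi>])
      also have "\<dots> \<le> ennreal (d\<^sup>2) * E"
        using True by (intro mult_right_mono ennreal_leI power_mono) auto
      finally show ?thesis using True by simp
    qed simp
    finally show "(\<integral>\<^sup>+x. ennreal ((\<phi> (x + h) - \<phi> x)\<^sup>2) * indicator (ball 0 d) h \<partial>lborel)
      \<le> ennreal (d\<^sup>2) * E * indicator (ball 0 d) h" .
  qed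
  also have "\<dots> = ennreal (d\<^sup>2) * E * emeasure lborel (ball (0 :: 'a) d)"
    by (rule nn_integral_cmult_indicator) simp
  also have "\<dots> = ennreal (unit_ball_vol (real DIM('a)) * d ^ DIM('a) * d\<^sup>2) * E"
    using d by (simp add: emeasure_lborel_ball ennreal_mult ac_simps)
  also have "\<dots> \<le> ennreal (unit_ball_vol (real DIM('a)) * d ^ DIM('a) * d\<^sup>2) * dirichlet_sq \<Omega> \<phi>"
    unfolding E_def by (intro mult_left_mono dirichlet_test_function[OF op \<phi>]) simp
  finally show ?thesis .
qed

section \<open>Algebra of weak gradients and of the Dirichlet energy\<close>

lemma weak_gradient_measurable:
  "weak_gradient \<Omega> u g \<Longrightarrow> g \<in> borel_measurable (domain_measure \<Omega>)"
  by (simp add: weak_gradient_def)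

lemma weak_gradient_scale:
  assumes "weak_gradient \<Omega> u g"
  shows "weak_gradient \<Omega> (c *\<^sub>R u) (\<lambda>x. c *\<^sub>R g x)"
  unfolding weak_gradient_def
proof (intro conjI ballI)
  show "(\<lambda>x. c *\<^sub>R g x) \<in> borel_measurable (domain_measure \<Omega>)"
    by (intro borel_measurable_scaleR borel_measurable_const weak_gradient_measurable[OF assms])
  fix \<phi> i assume *: "\<phi> \<in> test_functions \<Omega>" "i \<in> (Basis :: 'a set)"
  note D = weak_gradientD[OF assms *]
  show "integrable (domain_measure \<Omega>) (\<lambda>x. (c *\<^sub>R u) x * pderivative \<phi> i x)"
    "integrable (domain_measure \<Omega>) (\<lambda>x. (c *\<^sub>R g x \<bullet> i) * \<phi> x)"
    using integrable_mult_right[OF D(1), of c] integrable_mult_right[OF D(2), of c] by (simp_all add: mult.assoc)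
  show "(\<integral>x. (c *\<^sub>R u) x * pderivative \<phi> i x \<partial>domain_measure \<Omega>)
      = - (\<integral>x. (c *\<^sub>R g x \<bullet> i) * \<phi> x \<partial>domain_measure \<Omega>)"
    using D(3) by (simp add: mult.assoc)
qed

lemma weak_gradient_add:
  assumes "weak_gradient \<Omega> u g" "weak_gradient \<Omega> v k"
  shows "weak_gradient \<Omega> (u + v) (\<lambda>x. g x + k x)"
  unfolding weak_gradient_def
proof (intro conjI ballI)
  show "(\<lambda>x. g x + k x) \<in> borel_measurable (domain_measure \<Omega>)"
    by (intro borel_measurable_add weak_gradient_measurable[OF assms(1)] weak_gradient_measurable[OF assms(2)])
  fix \<phi> i assume *: "\<phi> \<in> test_functions \<Omega>" "i \<in> (Basis :: 'a set)"
  note D = weak_gradientD[OF assms(1) *] and E = weak_gradientD[OF assms(2) *]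
  show "integrable (domain_measure \<Omega>) (\<lambda>x. (u + v) x * pderivative \<phi> i x)"
    "integrable (domain_measure \<Omega>) (\<lambda>x. ((g x + k x) \<bullet> i) * \<phi> x)"
    using D E by (simp_all add: distrib_right inner_add_left)
  show "(\<integral>x. (u + v) x * pderivative \<phi> i x \<partial>domain_measure \<Omega>)
      = - (\<integral>x. ((g x + k x) \<bullet> i) * \<phi> x \<partial>domain_measure \<Omega>)"
    using D E by (simp add: distrib_right inner_add_left)
qed

lemma dirichlet_le: "weak_gradient \<Omega> u g \<Longrightarrow> dirichlet_sq \<Omega> u \<le> (\<integral>\<^sup>+x. ennreal ((norm (g x))\<^sup>2) \<partial>domain_measure \<Omega>)"
  unfolding dirichlet_sq_def by (rule INF_lower) simp

lemma dirichlet_scale_le: "dirichlet_sq \<Omega> (c *\<^sub>R u) \<le> ennreal (c\<^sup>2) * dirichlet_sq \<Omega> u" if "c \<noteq> 0"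
proof -
  have "dirichlet_sq \<Omega> (c *\<^sub>R u) / ennreal (c\<^sup>2) \<le> dirichlet_sq \<Omega> u"
    unfolding dirichlet_sq_def[of \<Omega> u]
  proof (rule INF_greatest)
    fix g assume "g \<in> {g. weak_gradient \<Omega> u g}"
    then have g: "weak_gradient \<Omega> u g" by simp
    then have [measurable]: "g \<in> borel_measurable (domain_measure \<Omega>)" by (simp add: weak_gradient_def)
    have "dirichlet_sq \<Omega> (c *\<^sub>R u) \<le> (\<integral>\<^sup>+x. ennreal ((norm (c *\<^sub>R g x))\<^sup>2) \<partial>domain_measure \<Omega>)"
      by (rule dirichlet_le[OF weak_gradient_scale[OF g]])
    also have "\<dots> = ennreal (c\<^sup>2) * (\<integral>\<^sup>+x. ennreal ((norm (g x))\<^sup>2) \<partial>domain_measure \<Omega>)"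
      by (subst nn_integral_cmult[symmetric]) (auto simp: power_mult_distrib ennreal_mult')
    finally show "dirichlet_sq \<Omega> (c *\<^sub>R u) / ennreal (c\<^sup>2) \<le> (\<integral>\<^sup>+x. ennreal ((norm (g x))\<^sup>2) \<partial>domain_measure \<Omega>)"
      using that by (intro divide_le_posI_ennreal) (auto simp: mult.commute)
  qed
  then have "ennreal (c\<^sup>2) * (dirichlet_sq \<Omega> (c *\<^sub>R u) / ennreal (c\<^sup>2)) \<le> ennreal (c\<^sup>2) * dirichlet_sq \<Omega> u"
    by (rule mult_left_mono) simp
  moreover have "ennreal (c\<^sup>2) * (dirichlet_sq \<Omega> (c *\<^sub>R u) / ennreal (c\<^sup>2)) = dirichlet_sq \<Omega> (c *\<^sub>R u)"
    using that mult_divide_eq_ennreal[of "ennreal (c\<^sup>2)" "dirichlet_sq \<Omega> (c *\<^sub>R u)"]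
    by (simp add: ennreal_times_divide mult.commute)
  ultimately show ?thesis by simp
qed

text \<open>The inequality for \<open>c\<close> and for \<open>1 / c\<close> gives equality. At
  \<open>c = 0\<close> the zero field is exhibited as a weak gradient, so that the left side is 0
  even if \<open>u\<close> has infinite energy.\<close>

lemma dirichlet_scale: "dirichlet_sq \<Omega> (c *\<^sub>R u) = ennreal (c\<^sup>2) * dirichlet_sq \<Omega> u"
proof (cases "c = 0")
  case True
  have "nice (\<lambda>x :: 'a. 0 :: real) 0" by (simp add: nice_def)
  from nice_weak_gradient[OF op this]
  have "weak_gradient \<Omega> (c *\<^sub>R u) (\<lambda>x. 0)"
    using True by (simp add: gradient_def[abs_def] frechet_derivative_const zero_fun_def)
  from dirichlet_le[OF this] show ?thesis using True by simp
next
  case False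
  show ?thesis
  proof (rule antisym[OF dirichlet_scale_le[OF False]])
    have "ennreal (c\<^sup>2) * dirichlet_sq \<Omega> ((1 / c) *\<^sub>R (c *\<^sub>R u))
      \<le> ennreal (c\<^sup>2) * (ennreal ((1 / c)\<^sup>2) * dirichlet_sq \<Omega> (c *\<^sub>R u))"
      using False by (intro mult_left_mono dirichlet_scale_le) auto
    also have "\<dots> = dirichlet_sq \<Omega> (c *\<^sub>R u)"
      using False by (simp add: mult.assoc[symmetric] ennreal_mult'[symmetric] power_divide)
    finally show "ennreal (c\<^sup>2) * dirichlet_sq \<Omega> u \<le> dirichlet_sq \<Omega> (c *\<^sub>R u)" using False by simp
  qed
qed

text \<open>Near-minimal gradients of \<open>u\<close> and \<open>v\<close>, each with excess
  \<open>e / 4\<close>, add up to a competitor for the sum; the factors 2 raise the total excess to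
  \<open>e\<close>.\<close>

lemma dirichlet_add: "dirichlet_sq \<Omega> (u + v) \<le> 2 * dirichlet_sq \<Omega> u + 2 * dirichlet_sq \<Omega> v"
proof (rule ennreal_le_epsilon)
  fix e :: real assume fin: "2 * dirichlet_sq \<Omega> u + 2 * dirichlet_sq \<Omega> v < top" and e: "0 < e"
  have "dirichlet_sq \<Omega> u \<noteq> \<infinity>" "dirichlet_sq \<Omega> v \<noteq> \<infinity>"
    using fin by (auto simp: ennreal_mult_less_top)
  then obtain g k where g: "weak_gradient \<Omega> u g" "(\<integral>\<^sup>+x. ennreal ((norm (g x))\<^sup>2) \<partial>domain_measure \<Omega>) < dirichlet_sq \<Omega> u + ennreal (e / 4)"
    and k: "weak_gradient \<Omega> v k" "(\<integral>\<^sup>+x. ennreal ((norm (k x))\<^sup>2) \<partial>domain_measure \<Omega>) < dirichlet_sq \<Omega> v + ennreal (e / 4)"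
    using INF_approx_ennreal[OF _ dirichlet_sq_def, of "e / 4" \<Omega> u] INF_approx_ennreal[OF _ dirichlet_sq_def, of "e / 4" \<Omega> v] e
    by auto
  have [measurable]: "g \<in> borel_measurable (domain_measure \<Omega>)" "k \<in> borel_measurable (domain_measure \<Omega>)"
    using g k by (auto simp: weak_gradient_def)
  have "dirichlet_sq \<Omega> (u + v) \<le> (\<integral>\<^sup>+x. ennreal ((norm (g x + k x))\<^sup>2) \<partial>domain_measure \<Omega>)"
    by (rule dirichlet_le[OF weak_gradient_add[OF g(1) k(1)]])
  also have "\<dots> \<le> (\<integral>\<^sup>+x. 2 * ennreal ((norm (g x))\<^sup>2) + 2 * ennreal ((norm (k x))\<^sup>2) \<partial>domain_measure \<Omega>)"
  proof (rule nn_integral_mono)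
    fix x
    have "ennreal ((norm (g x + k x))\<^sup>2) \<le> ennreal ((norm (g x) + norm (k x))\<^sup>2)"
      by (intro ennreal_leI power_mono norm_triangle_ineq) simp
    also have "\<dots> \<le> 2 * ennreal ((norm (g x))\<^sup>2) + 2 * ennreal ((norm (k x))\<^sup>2)"
      using ennreal_square_add_le[of 1] by simp
    finally show "ennreal ((norm (g x + k x))\<^sup>2) \<le> 2 * ennreal ((norm (g x))\<^sup>2) + 2 * ennreal ((norm (k x))\<^sup>2)" .
  qed
  also have "\<dots> = 2 * (\<integral>\<^sup>+x. ennreal ((norm (g x))\<^sup>2) \<partial>domain_measure \<Omega>) + 2 * (\<integral>\<^sup>+x. ennreal ((norm (k x))\<^sup>2) \<partial>domain_measure \<Omega>)"
    by (simp add: nn_integral_add nn_integral_cmult)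
  also have "\<dots> \<le> 2 * (dirichlet_sq \<Omega> u + ennreal (e / 4)) + 2 * (dirichlet_sq \<Omega> v + ennreal (e / 4))"
    using g k by (intro add_mono mult_left_mono less_imp_le) auto
  also have "\<dots> = 2 * dirichlet_sq \<Omega> u + 2 * dirichlet_sq \<Omega> v + (2 * ennreal (e / 4) + 2 * ennreal (e / 4))"
    by (simp add: distrib_left ac_simps)
  also have "2 * ennreal (e / 4) = ennreal (e / 2)" using ennreal_mult'[of 2 "e / 4"] by simp
  also have "ennreal (e / 2) + ennreal (e / 2) = ennreal e"
    using e ennreal_plus[of "e / 2" "e / 2"] by simp
  finally show "dirichlet_sq \<Omega> (u + v) \<le> 2 * dirichlet_sq \<Omega> u + 2 * dirichlet_sq \<Omega> v + ennreal e" .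
qed

end

section \<open>Nonnegative functions with a prescribed zero set\<close>

lemma nice_scale: "nice f L \<Longrightarrow> nice (\<lambda>x. c * f x) (\<bar>c\<bar> * L)"
  by (auto simp: nice_def abs_mult right_diff_distrib[symmetric] mult.assoc
      intro!: mult_left_mono differentiable_mult)

text \<open>A Weierstrass test: \<open>a k\<close> dominates values, slopes and derivatives alike,
  so the series of derivatives converges uniformly and the sum may be differentiated
  termwise.\<close>

lemma nice_suminf:
  fixes \<psi> :: "nat \<Rightarrow> 'a::euclidean_space \<Rightarrow> real"
  assumes n: "\<And>k. nice (\<psi> k) (a k)" and a: "summable a"
  shows "nice (\<lambda>x. \<Sum>k. \<psi> k x) (\<Sum>k. a k)" and "summable (\<lambda>k. \<psi> k x)"
proof -
  have a0: "0 \<le> a k" and d: "\<psi> k differentiable (at x)" and b: "\<bar>\<psi> k x\<bar> \<le> a k"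
    and l: "\<bar>\<psi> k x - \<psi> k y\<bar> \<le> a k * dist x y" for k x y
    using n[of k] by (auto simp: nice_def)
  have s: "summable (\<lambda>k. \<psi> k x)" for x
    by (rule summable_rabs_comparison_test[THEN summable_rabs_cancel, OF _ a]) (use b in auto)
  then show "summable (\<lambda>k. \<psi> k x)" .
  let ?D = "\<lambda>k x. frechet_derivative (\<psi> k) (at x)"
  have db: "\<bar>?D k x h\<bar> \<le> a k * norm h" for k x h by (rule nice_derivative_bound[OF n])
  have sd: "summable (\<lambda>k. ?D k x h)" for x h
    by (rule summable_rabs_comparison_test[THEN summable_rabs_cancel, OF _ summable_mult2[OF a]]) (use db in auto)
  have diff: "(\<lambda>x. \<Sum>k. \<psi> k x) differentiable (at x)" for x
  proof -
    have "\<exists>g. \<forall>x\<in>UNIV. (\<lambda>n. \<psi> n x) sums (g x) \<and> (g has_derivative (\<lambda>h. \<Sum>k. ?D k x h)) (at x within UNIV)"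
    proof (rule has_derivative_series)
      show "(\<psi> n has_derivative ?D n x) (at x within UNIV)" for n x
        using has_frechet_derivative[OF d] by simp
      show "(\<lambda>n. \<psi> n 0) sums (\<Sum>k. \<psi> k 0)" by (rule summable_sums[OF s])
      fix e :: real assume "0 < e"
      then obtain N where N: "\<forall>n\<ge>N. norm (\<Sum>i. a (i + n)) < e" using suminf_exist_split[OF _ a] by blast
      show "\<forall>\<^sub>F n in sequentially. \<forall>x\<in>UNIV. \<forall>h. norm ((\<Sum>i<n. ?D i x h) - (\<Sum>k. ?D k x h)) \<le> e * norm h"
      proof (rule eventually_sequentiallyI[of N], intro ballI allI)
        fix n and x h :: 'a assume "N \<le> n"
        then have "(\<Sum>i. a (i + n)) \<le> e" using N by force
        then have e: "(\<Sum>i. a (i + n)) * norm h \<le> e * norm h" by (rule mult_right_mono) simp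
        have an: "summable (\<lambda>i. a (i + n) * norm h)"
          using a by (intro summable_mult2) (simp add: summable_iff_shift)
        have "norm ((\<Sum>i<n. ?D i x h) - (\<Sum>k. ?D k x h)) = \<bar>\<Sum>i. ?D (i + n) x h\<bar>"
          using suminf_split_initial_segment[OF sd, of x h n] by simp
        also have "\<dots> \<le> (\<Sum>i. \<bar>?D (i + n) x h\<bar>)"
          by (rule summable_rabs, rule summable_rabs_comparison_test[OF _ an]) (use db in auto)
        also have "\<dots> \<le> (\<Sum>i. a (i + n) * norm h)"
        proof (rule suminf_le[OF db _ an])
          show "summable (\<lambda>i. \<bar>?D (i + n) x h\<bar>)"
            by (rule summable_rabs_comparison_test[OF _ an]) (use db in auto)
        qed
        also have "\<dots> = (\<Sum>i. a (i + n)) * norm h"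
          using a by (intro suminf_mult2[symmetric]) (simp add: summable_iff_shift)
        finally show "norm ((\<Sum>i<n. ?D i x h) - (\<Sum>k. ?D k x h)) \<le> e * norm h" using e by linarith
      qed
    qed auto
    then obtain g where g: "\<And>x. (\<lambda>n. \<psi> n x) sums (g x)"
      "\<And>x. (g has_derivative (\<lambda>h. \<Sum>k. ?D k x h)) (at x)" by auto
    have "g = (\<lambda>x. \<Sum>k. \<psi> k x)" using g(1) by (auto simp: sums_iff)
    then show ?thesis using differentiableI[OF g(2)] by simp
  qed
  have bound: "\<bar>\<Sum>k. f k\<bar> \<le> (\<Sum>k. a k) * t" if f: "\<And>k. \<bar>f k\<bar> \<le> a k * t" for f t
  proof -
    have at: "summable (\<lambda>k. a k * t)" by (rule summable_mult2[OF a])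
    have sf: "summable (\<lambda>k. \<bar>f k\<bar>)" by (rule summable_rabs_comparison_test[OF _ at]) (use f in auto)
    have "\<bar>\<Sum>k. f k\<bar> \<le> (\<Sum>k. \<bar>f k\<bar>)" by (rule summable_rabs[OF sf])
    also have "\<dots> \<le> (\<Sum>k. a k * t)" by (rule suminf_le[OF f sf at])
    also have "\<dots> = (\<Sum>k. a k) * t" by (rule suminf_mult2[symmetric, OF a])
    finally show ?thesis .
  qed
  show "nice (\<lambda>x. \<Sum>k. \<psi> k x) (\<Sum>k. a k)"
    unfolding nice_def
  proof (intro conjI allI diff)
    show "0 \<le> (\<Sum>k. a k)" by (rule suminf_nonneg[OF a a0])
    show "\<bar>\<Sum>k. \<psi> k x\<bar> \<le> (\<Sum>k. a k)" for x using bound[of "\<lambda>k. \<psi> k x" 1] b by simp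
    show "\<bar>(\<Sum>k. \<psi> k x) - (\<Sum>k. \<psi> k y)\<bar> \<le> (\<Sum>k. a k) * dist x y" for x y
      unfolding suminf_diff[OF s s] by (rule bound[OF l])
  qed
qed

lemma test_functions_zero: "(\<lambda>x. 0) \<in> test_functions \<Omega>"
  by (simp add: test_functions_def C_k_zero)

lemma test_functions_scale:
  assumes "f \<in> test_functions \<Omega>"
  shows "(\<lambda>x. c * f x) \<in> test_functions \<Omega>"
proof (rule test_functions_support[OF assms])
  have "{x. c * f x \<noteq> 0} \<subseteq> {x. f x \<noteq> 0}" by auto
  then show "{x. c * f x \<noteq> 0} \<subseteq> closure {x. f x \<noteq> 0}" using closure_subset by (rule subset_trans)
  show "C_k k (\<lambda>x. c * f x)" for k by (rule C_k_scale[OF test_function_basic(2)[OF assms]])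
qed

lemma test_functions_add:
  assumes f: "f \<in> test_functions \<Omega>" and g: "g \<in> test_functions \<Omega>"
  shows "(\<lambda>x. f x + g x) \<in> test_functions \<Omega>"
proof -
  note bf = test_function_basic[OF f] and bg = test_function_basic[OF g]
  let ?S = "closure {x. f x \<noteq> 0} \<union> closure {x. g x \<noteq> 0}"
  have "{x. f x + g x \<noteq> 0} \<subseteq> {x. f x \<noteq> 0} \<union> {x. g x \<noteq> 0}" by auto
  also have "\<dots> \<subseteq> ?S" by (intro Un_mono closure_subset)
  finally have "{x. f x + g x \<noteq> 0} \<subseteq> ?S" .
  then have sub: "closure {x. f x + g x \<noteq> 0} \<subseteq> ?S" by (rule closure_minimal) (intro closed_Un closed_closure)
  have "compact ?S" using bf(3) bg(3) by (rule compact_Un)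
  then have "compact (?S \<inter> closure {x. f x + g x \<noteq> 0})" by (intro compact_Int_closed closed_closure)
  then have "compact (closure {x. f x + g x \<noteq> 0})" unfolding Int_absorb1[OF sub] .
  moreover have "closure {x. f x + g x \<noteq> 0} \<subseteq> \<Omega>" using sub bf(4) bg(4) by blast
  moreover have "C_k k (\<lambda>x. f x + g x)" for k by (rule C_k_add[OF bf(2) bg(2)])
  ultimately show ?thesis by (simp add: test_functions_def)
qed

lemma test_functions_sum:
  fixes \<psi> :: "nat \<Rightarrow> 'a::euclidean_space \<Rightarrow> real"
  assumes "\<And>k. \<psi> k \<in> test_functions \<Omega>"
  shows "(\<lambda>x. \<Sum>k<n. \<psi> k x) \<in> test_functions \<Omega>"
proof (induction n)
  case (Suc n)
  show ?case using test_functions_add[OF Suc assms[of n]] by simp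
qed (simp add: test_functions_zero)

lemma small_bump:
  assumes "0 < r" "cball a r \<subseteq> \<Omega>" "0 < (e :: real)"
  shows "\<exists>\<psi>\<in>test_functions \<Omega>. nice \<psi> e \<and> (\<forall>x. 0 \<le> \<psi> x) \<and> (\<forall>x. \<psi> x = 0 \<longleftrightarrow> x \<notin> ball a r)"
proof -
  have t: "bump a r \<in> test_functions \<Omega>" by (rule bump_test_function[OF assms(1,2)])
  obtain L where L: "0 < L" "nice (bump a r) L" by (rule test_function_nice[OF t])
  have "nice (\<lambda>x. (e / L) * bump a r x) (\<bar>e / L\<bar> * L)" by (rule nice_scale[OF L(2)])
  then have "nice (\<lambda>x. (e / L) * bump a r x) e" using L assms(3) by simp
  moreover have "(e / L) * bump a r x = 0 \<longleftrightarrow> x \<notin> ball a r" for x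
    using bump_eq_0_iff[OF assms(1), of a x] L assms(3) by simp
  moreover have "0 \<le> (e / L) * bump a r x" for x using bump_nonneg[of a r x] L assms(3) by simp
  ultimately show ?thesis using test_functions_scale[OF t, of "e / L"]
    by (intro bexI[of _ "\<lambda>x. (e / L) * bump a r x"] conjI allI)
qed

text \<open>Countably many balls exhaust \<open>\<Omega> - F\<close>; summing sufficiently small bumps on them gives a
  function with zero set \<open>F\<close> that is approximated by its partial sums.\<close>

lemma zero_set_function:
  fixes \<Omega> :: "'a::euclidean_space set"
  assumes op: "open \<Omega>" and F: "compact F"
  obtains u S where "\<And>n. S n \<in> test_functions \<Omega>" "\<And>n. nice (\<lambda>x. u x - S n x) (2 * (1/2) ^ n)"
    "\<And>x. 0 \<le> u x" "\<And>x. x \<in> \<Omega> \<Longrightarrow> u x = 0 \<longleftrightarrow> x \<in> F"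
proof -
  \<comment> \<open>Closed balls inside \<open>\<Omega> - F\<close>, so that bumps on them have
    compact support in \<Omega> and vanish on \<open>F\<close>.\<close>
  define P where "P B \<longleftrightarrow> (\<exists>c r. B = ball c r \<and> 0 < r \<and> cball c r \<subseteq> \<Omega> - F)" for B :: "'a set"
  have open_diff: "open (\<Omega> - F)" using op compact_imp_closed[OF F] by (rule open_Diff)
  have UnP: "\<Union>{B. P B} = \<Omega> - F"
  proof
    show "\<Union>{B. P B} \<subseteq> \<Omega> - F"
    proof
      fix x assume "x \<in> \<Union>{B. P B}"
      then obtain c r where "x \<in> ball c r" "cball c r \<subseteq> \<Omega> - F" by (auto simp: P_def)
      then show "x \<in> \<Omega> - F" using ball_subset_cball[of c r] by blast
    qed
    show "\<Omega> - F \<subseteq> \<Union>{B. P B}"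
    proof
      fix x assume "x \<in> \<Omega> - F"
      then obtain r where r: "0 < r" "cball x r \<subseteq> \<Omega> - F"
        using open_diff open_contains_cball by blast
      then have "P (ball x r)" "x \<in> ball x r" by (auto simp: P_def)
      then show "x \<in> \<Union>{B. P B}" by blast
    qed
  qed
  obtain \<B> where \<B>: "\<B> \<subseteq> {B. P B}" "countable \<B>" "\<Union>\<B> = \<Union>{B. P B}"
    by (rule Lindelof[of "{B. P B}"]) (auto simp: P_def)
  have cover: "\<Union>\<B> = \<Omega> - F" using \<B>(3) UnP by simp
  \<comment> \<open>\<open>from_nat_into\<close> may list a ball repeatedly, which is harmless for
    sums of nonnegative bumps. If there is no ball, all summands are 0.\<close>
  have "\<forall>k :: nat. \<exists>\<psi>. \<psi> \<in> test_functions \<Omega> \<and> nice \<psi> ((1/2) ^ k) \<and> (\<forall>x. 0 \<le> \<psi> x) \<and>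
    (\<forall>x. \<psi> x \<noteq> 0 \<longleftrightarrow> \<B> \<noteq> {} \<and> x \<in> from_nat_into \<B> k)"
  proof
    fix k :: nat
    show "\<exists>\<psi>. \<psi> \<in> test_functions \<Omega> \<and> nice \<psi> ((1/2) ^ k) \<and> (\<forall>x. 0 \<le> \<psi> x) \<and>
      (\<forall>x. \<psi> x \<noteq> 0 \<longleftrightarrow> \<B> \<noteq> {} \<and> x \<in> from_nat_into \<B> k)"
    proof (cases "\<B> = {}")
      case True
      then show ?thesis
        by (intro exI[of _ "\<lambda>x. 0"]) (simp add: test_functions_zero nice_def)
    next
      case False
      then have "P (from_nat_into \<B> k)" using from_nat_into[OF False, of k] \<B>(1) by blast
      then obtain c r where cr: "from_nat_into \<B> k = ball c r" "0 < r" "cball c r \<subseteq> \<Omega> - F"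
        by (auto simp: P_def)
      have "cball c r \<subseteq> \<Omega>" using cr(3) by blast
      from small_bump[OF cr(2) this, of "(1/2) ^ k"] obtain \<psi>
        where "\<psi> \<in> test_functions \<Omega>" "nice \<psi> ((1/2) ^ k)" "\<forall>x. 0 \<le> \<psi> x"
          "\<forall>x. \<psi> x = 0 \<longleftrightarrow> x \<notin> ball c r" by auto
      then show ?thesis using False by (intro exI[of _ \<psi>]) (simp add: cr(1))
    qed
  qed
  from choice[OF this] obtain \<psi> where \<psi>': "\<forall>k :: nat. \<psi> k \<in> test_functions \<Omega> \<and> nice (\<psi> k) ((1/2) ^ k) \<and>
    (\<forall>x. 0 \<le> \<psi> k x) \<and> (\<forall>x. \<psi> k x \<noteq> 0 \<longleftrightarrow> \<B> \<noteq> {} \<and> x \<in> from_nat_into \<B> k)" by (elim exE)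
  then have \<psi>: "\<psi> k \<in> test_functions \<Omega>" "nice (\<psi> k) ((1/2) ^ k)" "0 \<le> \<psi> k x"
    "\<psi> k x \<noteq> 0 \<longleftrightarrow> \<B> \<noteq> {} \<and> x \<in> from_nat_into \<B> k" for k x by blast+
  have geo: "(\<lambda>k. (1/2 :: real) ^ (k + n)) sums (2 * (1/2) ^ n)" for n
    using sums_mult2[OF geometric_sums[of "1/2 :: real"], of "(1/2) ^ n"] by (simp add: power_add)
  define u where "u x = (\<Sum>k. \<psi> k x)" for x
  define S where "S n x = (\<Sum>k<n. \<psi> k x)" for n x
  have sm: "summable (\<lambda>k. \<psi> k x)" for x
    by (rule nice_suminf(2)[where a = "\<lambda>k. (1/2) ^ k"]) (use \<psi>(2) in \<open>auto intro: summable_geometric\<close>)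
  have tail: "nice (\<lambda>x. u x - S n x) (2 * (1/2) ^ n)" for n
  proof -
    have "nice (\<lambda>x. \<Sum>k. \<psi> (k + n) x) (\<Sum>k. (1/2) ^ (k + n))"
      by (rule nice_suminf(1)) (use \<psi>(2) geo[of n] in \<open>auto simp: sums_iff\<close>)
    moreover have "(\<Sum>k. \<psi> (k + n) x) = u x - S n x" for x
      using suminf_split_initial_segment[OF sm, of x n] by (simp add: u_def S_def)
    ultimately show ?thesis using geo[of n] by (simp add: sums_iff)
  qed
  have u0: "0 \<le> u x" for x unfolding u_def by (rule suminf_nonneg[OF sm \<psi>(3)])
  have "u x = 0 \<longleftrightarrow> x \<in> F" if x: "x \<in> \<Omega>" for x
  proof -
    have "u x = 0 \<longleftrightarrow> (\<forall>k. \<psi> k x = 0)" unfolding u_def by (rule suminf_eq_zero_iff[OF sm \<psi>(3)])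
    also have "\<dots> \<longleftrightarrow> x \<notin> \<Union>\<B>"
    proof (cases "\<B> = {}")
      case False
      then have "range (from_nat_into \<B>) = \<B>" using \<B>(2) by (rule range_from_nat_into)
      then show ?thesis using \<psi>(4)[of _ x] False by blast
    qed (use \<psi>(4) in auto)
    also have "\<dots> \<longleftrightarrow> x \<in> F" using cover x by blast
    finally show ?thesis .
  qed
  moreover have "S n \<in> test_functions \<Omega>" for n
    using test_functions_sum[OF \<psi>(1), where n = n] by (simp add: S_def[abs_def])
  ultimately show ?thesis using that tail u0 by blast
qed

section \<open>The domain case\<close>

context
  fixes \<Omega> :: "'a::euclidean_space set"
  assumes op: "open \<Omega>" and bd: "bounded \<Omega>" and nonempty: "\<Omega> \<noteq> {}"
begin

interpretation growth_measure "domain_measure \<Omega>" "DIM('a)" "unit_ball_vol (real DIM('a))"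
  by (rule domain_growth[OF op bd nonempty])

lemma Hs_energy: "energy (Hs_sq s \<Omega>) (borel_measurable (domain_measure \<Omega>))"
proof
  show "Hs_sq s \<Omega> (c *\<^sub>R u) = ennreal (c\<^sup>2) * Hs_sq s \<Omega> u"
    if "u \<in> borel_measurable (domain_measure \<Omega>)" for c u
    using that unfolding Hs_sq_def
    by (simp add: L2_sq_scale slobodeckij_scale dirichlet_scale[OF op bd nonempty] distrib_left)
  fix u v :: "'a \<Rightarrow> real"
  assume uv: "u \<in> borel_measurable (domain_measure \<Omega>)" "v \<in> borel_measurable (domain_measure \<Omega>)"
  define T where "T u = (if s = 1 then dirichlet_sq \<Omega> u
      else slobodeckij_sq (real DIM('a)) s (domain_measure \<Omega>) u)" for u
  have "T (u + v) \<le> 2 * T u + 2 * T v"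
    using uv by (simp add: T_def slobodeckij_add dirichlet_add[OF op bd nonempty])
  then have "Hs_sq s \<Omega> (u + v) \<le> (2 * L2_sq (domain_measure \<Omega>) u + 2 * L2_sq (domain_measure \<Omega>) v) + (2 * T u + 2 * T v)"
    unfolding Hs_sq_def T_def[symmetric] by (intro add_mono L2_sq_add uv)
  also have "\<dots> = 2 * Hs_sq s \<Omega> u + 2 * Hs_sq s \<Omega> v"
    unfolding Hs_sq_def T_def[symmetric] by (simp add: distrib_left ac_simps)
  finally show "Hs_sq s \<Omega> (u + v) \<le> 2 * Hs_sq s \<Omega> u + 2 * Hs_sq s \<Omega> v" .
qed (fact measurable_space_subspace)+

text \<open>For \<open>s < 1\<close> this is the Lipschitz bound on the Slobodeckij energy, for
  \<open>s = 1\<close> the classical gradient is a competitor. One \<open>K\<close> for all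
  \<open>f\<close> converts \<open>nice\<close> estimates into convergence in the Sobolev
  norm.\<close>

lemma nice_Hs_bound:
  assumes s: "s \<le> 1"
  shows "\<exists>K\<ge>0. \<forall>f L. nice f L \<longrightarrow> Hs_sq s \<Omega> f \<le> ennreal (K * L\<^sup>2)"
proof -
  let ?M = "domain_measure \<Omega>"
  have "\<exists>K\<ge>0. \<forall>f L. nice f L \<longrightarrow> (if s = 1 then dirichlet_sq \<Omega> f
      else slobodeckij_sq (real DIM('a)) s ?M f) \<le> ennreal (K * L\<^sup>2)"
  proof (cases "s = 1")
    case False
    then obtain K where "0 \<le> K" "\<forall>L u. 0 \<le> L \<longrightarrow> (\<forall>x\<in>space ?M. \<forall>y\<in>space ?M. \<bar>u x - u y\<bar> \<le> L * dist x y) \<longrightarrow>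
      slobodeckij_sq (real DIM('a)) s ?M u \<le> ennreal (K * L\<^sup>2)"
      using slobodeckij_lipschitz[of s] s by auto
    then show ?thesis using False by (intro exI[of _ K]) (simp add: nice_def)
  next
    case True
    have "dirichlet_sq \<Omega> f \<le> ennreal (real DIM('a) * measure ?M \<Omega> * L\<^sup>2)" if f: "nice f L" for f L
    proof -
      have "dirichlet_sq \<Omega> f \<le> (\<integral>\<^sup>+x. ennreal ((norm (gradient f x))\<^sup>2) \<partial>?M)"
        by (rule dirichlet_le[OF op bd nonempty nice_weak_gradient[OF op f]])
      also have "\<dots> \<le> (\<integral>\<^sup>+x. ennreal (real DIM('a) * L\<^sup>2) \<partial>?M)"
      proof (intro nn_integral_mono ennreal_leI)
        fix x
        have "(pderivative f i x)\<^sup>2 \<le> L\<^sup>2" if "i \<in> Basis" for i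
        proof -
          have "\<bar>pderivative f i x\<bar>\<^sup>2 \<le> L\<^sup>2"
            using nice_derivative_bound[OF f, of x i] that by (intro power_mono) auto
          then show ?thesis by simp
        qed
        then have "(\<Sum>i\<in>Basis. (pderivative f i x)\<^sup>2) \<le> (\<Sum>i\<in>(Basis :: 'a set). L\<^sup>2)" by (rule sum_mono)
        then show "(norm (gradient f x))\<^sup>2 \<le> real DIM('a) * L\<^sup>2" by (simp add: gradient_norm)
      qed
      also have "\<dots> = ennreal (real DIM('a) * measure ?M \<Omega> * L\<^sup>2)"
        by (simp add: space_domain_measure[OF op] emeasure_eq_measure ennreal_mult'[symmetric] ac_simps)
      finally show ?thesis .
    qed
    then show ?thesis using True by (intro exI[of _ "real DIM('a) * measure ?M \<Omega>"]) simp
  qed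
  then obtain K where K: "0 \<le> K" "\<And>f L. nice f L \<Longrightarrow> (if s = 1 then dirichlet_sq \<Omega> f
      else slobodeckij_sq (real DIM('a)) s ?M f) \<le> ennreal (K * L\<^sup>2)" by blast
  have "Hs_sq s \<Omega> f \<le> ennreal ((measure ?M \<Omega> + K) * L\<^sup>2)" if f: "nice f L" for f L
  proof -
    have "L2_sq ?M f \<le> ennreal (measure ?M \<Omega> * L\<^sup>2)"
      using L2_sq_bounded[of L f] f unfolding space_domain_measure[OF op] by (auto simp: nice_def)
    then have "Hs_sq s \<Omega> f \<le> ennreal (measure ?M \<Omega> * L\<^sup>2) + ennreal (K * L\<^sup>2)"
      unfolding Hs_sq_def by (intro add_mono K(2)[OF f])
    also have "\<dots> = ennreal ((measure ?M \<Omega> + K) * L\<^sup>2)"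
      using K(1) by (simp add: ennreal_plus[symmetric] distrib_right del: ennreal_plus)
    finally show ?thesis .
  qed
  then show ?thesis using K(1) by (intro exI[of _ "measure ?M \<Omega> + K"]) simp
qed

text \<open>For \<open>s = 1\<close> the oscillation estimate passes from test functions to their closure.\<close>

lemma osc_closure:
  assumes z: "z \<in> borel_measurable (domain_measure \<Omega>)" and \<phi>: "\<phi> \<in> test_functions \<Omega>" and d: "0 < d"
  shows "(\<integral>\<^sup>+x. \<integral>\<^sup>+y. ennreal ((z x - z y)\<^sup>2) * indicator (ball x d) y \<partial>domain_measure \<Omega> \<partial>domain_measure \<Omega>)
    \<le> 2 * (ennreal (unit_ball_vol (real DIM('a)) * d ^ DIM('a) * d\<^sup>2) * dirichlet_sq \<Omega> \<phi>)
      + ennreal (8 * measure (domain_measure \<Omega>) \<Omega>) * L2_sq (domain_measure \<Omega>) (z - \<phi>)"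
proof -
  let ?M = "domain_measure \<Omega>"
  obtain L where L: "0 < L" "nice \<phi> L" by (rule test_function_nice[OF \<phi>])
  have [measurable]: "\<phi> \<in> borel_measurable ?M"
    by (rule measurable_domain[OF op nice_measurable[OF L(2)]])
  note z [measurable]
  \<comment> \<open>The error enters through its L2 norm only, since its integral over the small
    ball is bounded crudely by one over \<Omega>. The estimate is meant for fixed \<open>d\<close>,
    with the error tending to 0.\<close>
  define w where "w x = z x - \<phi> x" for x
  have [measurable]: "w \<in> borel_measurable ?M" unfolding w_def by measurable
  have ind: "indicator (ball x d) y = (indicator {w. dist (fst w) (snd w) < d} (x, y) :: ennreal)" for x y
    by (auto simp: indicator_def)
  have [measurable]: "(\<lambda>w. indicator {w. dist (fst w) (snd w) < d} (w :: 'a \<times> 'a) :: ennreal)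
      \<in> borel_measurable (?M \<Otimes>\<^sub>M ?M)"
    by (rule borel_measurable_indicator') measurable
  have "(\<integral>\<^sup>+x. \<integral>\<^sup>+y. ennreal ((z x - z y)\<^sup>2) * indicator (ball x d) y \<partial>?M \<partial>?M)
    \<le> (\<integral>\<^sup>+x. \<integral>\<^sup>+y. 2 * (ennreal ((\<phi> x - \<phi> y)\<^sup>2) * indicator (ball x d) y)
        + (4 * ennreal ((w x)\<^sup>2) + 4 * ennreal ((w y)\<^sup>2)) \<partial>?M \<partial>?M)"
  proof (intro nn_integral_mono)
    fix x y
    have "(z x - z y)\<^sup>2 = ((\<phi> x - \<phi> y) + (w x - w y))\<^sup>2" by (simp add: w_def)
    also have "\<dots> \<le> 2 * (\<phi> x - \<phi> y)\<^sup>2 + 2 * (w x - w y)\<^sup>2" by (rule square_add_le)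
    also have "\<dots> \<le> 2 * (\<phi> x - \<phi> y)\<^sup>2 + (4 * (w x)\<^sup>2 + 4 * (w y)\<^sup>2)"
      using square_add_le[of "w x" "- w y"] by simp
    finally have "ennreal ((z x - z y)\<^sup>2) \<le> ennreal (2 * (\<phi> x - \<phi> y)\<^sup>2 + (4 * (w x)\<^sup>2 + 4 * (w y)\<^sup>2))"
      by (rule ennreal_leI)
    also have "\<dots> = 2 * ennreal ((\<phi> x - \<phi> y)\<^sup>2) + (4 * ennreal ((w x)\<^sup>2) + 4 * ennreal ((w y)\<^sup>2))"
      by (simp add: ennreal_mult')
    finally show "ennreal ((z x - z y)\<^sup>2) * indicator (ball x d) y
      \<le> 2 * (ennreal ((\<phi> x - \<phi> y)\<^sup>2) * indicator (ball x d) y) + (4 * ennreal ((w x)\<^sup>2) + 4 * ennreal ((w y)\<^sup>2))"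
      by (auto simp: indicator_def)
  qed
  also have "\<dots> = 2 * (\<integral>\<^sup>+x. \<integral>\<^sup>+y. ennreal ((\<phi> x - \<phi> y)\<^sup>2) * indicator (ball x d) y \<partial>?M \<partial>?M)
    + (4 * (L2_sq ?M w * emeasure ?M \<Omega>) + 4 * (L2_sq ?M w * emeasure ?M \<Omega>))"
    unfolding ind L2_sq_def
    by (simp add: nn_integral_add nn_integral_cmult nn_integral_multc space_domain_measure[OF op] mult.assoc)
  also have "4 * (L2_sq ?M w * emeasure ?M \<Omega>) + 4 * (L2_sq ?M w * emeasure ?M \<Omega>)
    = ennreal (8 * measure ?M \<Omega>) * L2_sq ?M w"
  proof -
    have 1: "ennreal (8 * measure ?M \<Omega>) = 8 * emeasure ?M \<Omega>"
      by (simp add: emeasure_eq_measure ennreal_mult')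
    have "4 * (L2_sq ?M w * emeasure ?M \<Omega>) + 4 * (L2_sq ?M w * emeasure ?M \<Omega>)
        = 8 * (L2_sq ?M w * emeasure ?M \<Omega>)"
      by (simp add: distrib_right[symmetric])
    also have "\<dots> = 8 * emeasure ?M \<Omega> * L2_sq ?M w" by (simp only: ac_simps)
    finally show ?thesis unfolding 1 .
  qed
  also have "2 * (\<integral>\<^sup>+x. \<integral>\<^sup>+y. ennreal ((\<phi> x - \<phi> y)\<^sup>2) * indicator (ball x d) y \<partial>?M \<partial>?M)
      + ennreal (8 * measure ?M \<Omega>) * L2_sq ?M w
    \<le> 2 * (ennreal (unit_ball_vol (real DIM('a)) * d ^ DIM('a) * d\<^sup>2) * dirichlet_sq \<Omega> \<phi>)
      + ennreal (8 * measure ?M \<Omega>) * L2_sq ?M w"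
    by (intro add_right_mono mult_left_mono test_function_osc[OF op bd nonempty \<phi> d]) simp
  also have "w = z - \<phi>" by (simp add: w_def fun_eq_iff)
  finally show ?thesis .
qed

text \<open>Mass is condensed inside a closed ball \<open>F0\<close> in \<Omega>, where balls have
  full volume. For \<open>s = 1\<close> the oscillation bound comes from \<open>osc_closure\<close>
  with test functions tending to \<open>z\<close>. The series from \<open>zero_set_function\<close>
  lies in \<open>Hs0\<close> because its partial sums are test functions.\<close>

lemma domain_non_polyhedric:
  assumes s: "0 < s" "s \<le> 1"
  shows "non_polyhedric
    (dual_space (Hs0 s \<Omega>) (Hs_norm s \<Omega>))
    (dual_norm (Hs0 s \<Omega>) (Hs_norm s \<Omega>))
    (functional_of (domain_measure \<Omega>) (Hs0 s \<Omega>) ` bounded_by_one (domain_measure \<Omega>))"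
proof -
  define M where "M = domain_measure \<Omega>"
  define m where "m = DIM('a)"
  define \<kappa> where "\<kappa> = unit_ball_vol (real DIM('a))"
  have \<kappa>: "0 < \<kappa>" by (simp add: \<kappa>_def)
  interpret G: growth_measure M m \<kappa>
    unfolding M_def m_def \<kappa>_def by (rule domain_growth[OF op bd nonempty])
  have spM: "space M = \<Omega>" by (simp add: M_def space_domain_measure[OF op])
  interpret E: energy "Hs_sq s \<Omega>" "borel_measurable M" unfolding M_def by (rule Hs_energy)
  define N where "N = Hs_norm s \<Omega>"
  define V where "V = Hs0 s \<Omega>"
  have HsE: "Hs s \<Omega> = E.carrier" unfolding Hs_def E.carrier_def by (simp add: M_def)
  have N: "N = E.norm_of" unfolding N_def Hs_norm_def E.norm_of_def fun_eq_iff by simp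
  have V: "V = norm_closure E.carrier E.norm_of (test_functions \<Omega>)"
    unfolding V_def Hs0_def HsE using N unfolding N_def by simp
  obtain K where K: "0 \<le> K" "\<And>f L. nice f L \<Longrightarrow> Hs_sq s \<Omega> f \<le> ennreal (K * L\<^sup>2)"
    using nice_Hs_bound[OF s(2)] by blast
  have niceE: "f \<in> E.carrier" if "nice f L" for f L
  proof -
    have "Hs_sq s \<Omega> f < \<infinity>" using K(2)[OF that] by (rule le_less_trans) simp
    then show ?thesis
      unfolding E.carrier_def using measurable_domain[OF op nice_measurable[OF that]] by (simp add: M_def)
  qed
  have testE: "test_functions \<Omega> \<subseteq> E.carrier"
  proof
    fix \<phi> assume "\<phi> \<in> test_functions \<Omega>"
    then obtain L where "nice \<phi> L" by (rule test_function_nice)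
    then show "\<phi> \<in> E.carrier" by (rule niceE)
  qed
  have zero: "0 \<in> test_functions \<Omega>" using test_functions_zero by (simp add: zero_fun_def)
  have add: "f + g \<in> test_functions \<Omega>" if "f \<in> test_functions \<Omega>" "g \<in> test_functions \<Omega>" for f g
    using test_functions_add[OF that] by (simp add: plus_fun_def)
  have scale: "c *\<^sub>R f \<in> test_functions \<Omega>" if "f \<in> test_functions \<Omega>" for c f
    using test_functions_scale[OF that, of c] by (simp add: scaleR_fun_def)
  interpret seminormed_carrier V N
    unfolding V N by (rule E.closure_seminormed(1)[OF testE zero add scale])
  have testV: "test_functions \<Omega> \<subseteq> V"
    unfolding V by (rule E.closure_seminormed(2)[OF testE zero add scale])
  have VE: "z \<in> E.carrier" if "z \<in> V" for z using that unfolding V norm_closure_def by simp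
  have Vm: "z \<in> borel_measurable M" if "z \<in> V" for z using VE[OF that] by (simp add: E.carrier_def)
  have QN: "ennreal ((N z)\<^sup>2) = Hs_sq s \<Omega> z" if "z \<in> E.carrier" for z
    using that unfolding N by (rule E.norm_of_square)
  have L2N: "L2_sq M z \<le> ennreal ((N z)\<^sup>2)" if "z \<in> E.carrier" for z
    unfolding QN[OF that] Hs_sq_def M_def by simp
  \<comment> \<open>Three demands: \<kappa> for the growth bound, 1 for the oscillation when
    \<open>s < 1\<close>, and \<open>4 * \<kappa>\<close> for it when \<open>s = 1\<close>.\<close>
  define C where "C = 4 * \<kappa> + 1"
  have C: "\<kappa> \<le> C" "1 \<le> C" "4 * \<kappa> \<le> C" "0 < C" using \<kappa> by (simp_all add: C_def)
  have osc: "(\<integral>\<^sup>+x. \<integral>\<^sup>+y. ennreal ((z x - z y)\<^sup>2) * indicator (ball x d) y \<partial>M \<partial>M)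
    \<le> ennreal (C * d ^ m * d powr (2 * s) * (N z)\<^sup>2)" if z: "z \<in> V" and d: "0 < d" for z d
  proof (cases "s = 1")
    case False
    have "(\<integral>\<^sup>+x. \<integral>\<^sup>+y. ennreal ((z x - z y)\<^sup>2) * indicator (ball x d) y \<partial>M \<partial>M)
      \<le> ennreal (d powr (real m + 2 * s)) * slobodeckij_sq (real m) s M z"
      using s d Vm[OF z] by (intro G.slobodeckij_osc) auto
    also have "\<dots> \<le> ennreal (d powr (real m + 2 * s)) * ennreal ((N z)\<^sup>2)"
      unfolding QN[OF VE[OF z]] Hs_sq_def m_def M_def using False by (intro mult_left_mono) auto
    also have "\<dots> = ennreal (1 * d ^ m * d powr (2 * s) * (N z)\<^sup>2)"
      using d by (simp add: ennreal_mult'[symmetric] powr_add powr_realpow)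
    also have "\<dots> \<le> ennreal (C * d ^ m * d powr (2 * s) * (N z)\<^sup>2)"
      using C d by (intro ennreal_leI mult_right_mono) auto
    finally show ?thesis .
  next
    case True
    define A where "A = \<kappa> * d ^ m * d\<^sup>2"
    have A: "0 \<le> A" using \<kappa> d by (simp add: A_def)
    \<comment> \<open>Collects what multiplies \<open>e\<^sup>2\<close>: one factor 2 from splitting
      \<open>z\<close> and another from the bound on \<open>N \<phi>\<close> give
      \<open>4 * A\<close>, and the L2 error gives the rest.\<close>
    define B where "B = 4 * A + 8 * measure M \<Omega>"
    have B: "0 \<le> B" using A by (simp add: B_def)
    have est: "(\<integral>\<^sup>+x. \<integral>\<^sup>+y. ennreal ((z x - z y)\<^sup>2) * indicator (ball x d) y \<partial>M \<partial>M)
      \<le> ennreal (4 * A * (N z)\<^sup>2 + B * e\<^sup>2)" if e: "0 < e" for e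
    proof -
      obtain \<phi> where \<phi>: "\<phi> \<in> test_functions \<Omega>" "N (z - \<phi>) < e"
        using z e unfolding V N norm_closure_def by blast
      have \<phi>E: "\<phi> \<in> E.carrier" using \<phi>(1) testE by blast
      have wE: "z - \<phi> \<in> E.carrier" by (rule E.carrier_diff[OF VE[OF z] \<phi>E])
      have we: "(N (z - \<phi>))\<^sup>2 \<le> e\<^sup>2"
        using less_imp_le[OF \<phi>(2)] E.norm_of_nonneg unfolding N by (rule power_mono)
      have "N (\<phi> - z) = N (z - \<phi>)"
        using E.norm_of_scale[of "z - \<phi>" "-1"] wE unfolding N E.carrier_def by simp
      then have "(N \<phi>)\<^sup>2 \<le> 2 * (N z)\<^sup>2 + 2 * (N (z - \<phi>))\<^sup>2"
        using E.norm_of_add[OF VE[OF z] E.carrier_diff[OF \<phi>E VE[OF z]]] unfolding N by simp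
      then have \<phi>N: "(N \<phi>)\<^sup>2 \<le> 2 * (N z)\<^sup>2 + 2 * e\<^sup>2" using we by linarith
      have "dirichlet_sq \<Omega> \<phi> \<le> ennreal ((N \<phi>)\<^sup>2)"
        unfolding QN[OF \<phi>E] Hs_sq_def using True by simp
      also have "\<dots> \<le> ennreal (2 * (N z)\<^sup>2 + 2 * e\<^sup>2)" by (rule ennreal_leI[OF \<phi>N])
      finally have 1: "dirichlet_sq \<Omega> \<phi> \<le> ennreal (2 * (N z)\<^sup>2 + 2 * e\<^sup>2)" .
      have 2: "L2_sq M (z - \<phi>) \<le> ennreal (e\<^sup>2)"
        using L2N[OF wE] we by (meson ennreal_leI order_trans)
      have "(\<integral>\<^sup>+x. \<integral>\<^sup>+y. ennreal ((z x - z y)\<^sup>2) * indicator (ball x d) y \<partial>M \<partial>M)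
        \<le> 2 * (ennreal A * dirichlet_sq \<Omega> \<phi>) + ennreal (8 * measure M \<Omega>) * L2_sq M (z - \<phi>)"
        unfolding A_def \<kappa>_def m_def M_def using Vm[OF z] \<phi>(1) d by (intro osc_closure) (auto simp: M_def)
      also have "\<dots> \<le> 2 * (ennreal A * ennreal (2 * (N z)\<^sup>2 + 2 * e\<^sup>2)) + ennreal (8 * measure M \<Omega>) * ennreal (e\<^sup>2)"
        using 1 2 by (intro add_mono mult_left_mono) auto
      also have "ennreal A * ennreal (2 * (N z)\<^sup>2 + 2 * e\<^sup>2) = ennreal (A * (2 * (N z)\<^sup>2 + 2 * e\<^sup>2))"
        using A by (rule ennreal_mult'[symmetric])
      also have "2 * ennreal (A * (2 * (N z)\<^sup>2 + 2 * e\<^sup>2)) = ennreal (2 * (A * (2 * (N z)\<^sup>2 + 2 * e\<^sup>2)))"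
        using ennreal_mult'[of 2 "A * (2 * (N z)\<^sup>2 + 2 * e\<^sup>2)"] by simp
      also have "ennreal (8 * measure M \<Omega>) * ennreal (e\<^sup>2) = ennreal (8 * measure M \<Omega> * e\<^sup>2)"
        by (rule ennreal_mult'[symmetric]) simp
      also have "ennreal (2 * (A * (2 * (N z)\<^sup>2 + 2 * e\<^sup>2))) + ennreal (8 * measure M \<Omega> * e\<^sup>2)
        = ennreal (2 * (A * (2 * (N z)\<^sup>2 + 2 * e\<^sup>2)) + 8 * measure M \<Omega> * e\<^sup>2)"
        using A by (intro ennreal_plus[symmetric]) auto
      also have "2 * (A * (2 * (N z)\<^sup>2 + 2 * e\<^sup>2)) + 8 * measure M \<Omega> * e\<^sup>2 = 4 * A * (N z)\<^sup>2 + B * e\<^sup>2"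
        by (simp add: B_def algebra_simps)
      finally show ?thesis .
    qed
    have "(\<integral>\<^sup>+x. \<integral>\<^sup>+y. ennreal ((z x - z y)\<^sup>2) * indicator (ball x d) y \<partial>M \<partial>M) \<le> ennreal (4 * A * (N z)\<^sup>2)"
    proof (rule ennreal_le_epsilon)
      fix k :: real assume k: "0 < k"
      define e where "e = sqrt (k / (B + 1))"
      have "0 < k / (B + 1)" using k B by simp
      then have e: "0 < e" "e\<^sup>2 = k / (B + 1)" by (simp_all add: e_def)
      have "B * (k / (B + 1)) \<le> k" using k B by (simp add: field_simps)
      then have "ennreal (4 * A * (N z)\<^sup>2 + B * e\<^sup>2) \<le> ennreal (4 * A * (N z)\<^sup>2 + k)"
        unfolding e(2) by (intro ennreal_leI) simp
      also have "\<dots> = ennreal (4 * A * (N z)\<^sup>2) + ennreal k" using A k by (intro ennreal_plus) auto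
      finally show "(\<integral>\<^sup>+x. \<integral>\<^sup>+y. ennreal ((z x - z y)\<^sup>2) * indicator (ball x d) y \<partial>M \<partial>M)
        \<le> ennreal (4 * A * (N z)\<^sup>2) + ennreal k" using est[OF e(1)] by simp
    qed
    also have "\<dots> \<le> ennreal (C * d ^ m * d powr (2 * s) * (N z)\<^sup>2)"
    proof (rule ennreal_leI)
      have "d powr (2 * s) = d\<^sup>2" using d True powr_realpow[of d 2] by simp
      then have *: "C * d ^ m * d powr (2 * s) * (N z)\<^sup>2 = C * (d ^ m * d\<^sup>2 * (N z)\<^sup>2)" by (simp add: mult.assoc)
      have "4 * A * (N z)\<^sup>2 = (4 * \<kappa>) * (d ^ m * d\<^sup>2 * (N z)\<^sup>2)" by (simp add: A_def)
      also have "\<dots> \<le> C * (d ^ m * d\<^sup>2 * (N z)\<^sup>2)" using C(3) d by (intro mult_right_mono) auto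
      finally show "4 * A * (N z)\<^sup>2 \<le> C * d ^ m * d powr (2 * s) * (N z)\<^sup>2" unfolding * .
    qed
    finally show ?thesis .
  qed
  obtain a where a: "a \<in> \<Omega>" using nonempty by blast
  obtain r' where r': "0 < r'" "cball a r' \<subseteq> \<Omega>" using op a open_contains_cball by blast
  \<comment> \<open>Balls of radius at most \<open>r\<close> around points of
    \<open>cball a r\<close> remain in \<open>cball a r'\<close>.\<close>
  define r where "r = r' / 2"
  have r: "0 < r" "r + r = r'" using r'(1) by (simp_all add: r_def)
  define F0 where "F0 = cball a r"
  have F0sub: "F0 \<subseteq> ball a r'" using r by (auto simp: F0_def)
  have F0: "compact F0" "F0 \<subseteq> space M"
  proof -
    show "compact F0" by (simp add: F0_def)
    show "F0 \<subseteq> space M" using F0sub r'(2) ball_subset_cball[of a r'] unfolding spM by blast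
  qed
  have em: "ennreal (measure M A) = emeasure lborel A" if "A \<in> sets borel" "A \<subseteq> \<Omega>" for A
    using emeasure_domain[OF op bd nonempty that] unfolding M_def[symmetric] G.emeasure_eq_measure .
  have lower: "\<kappa> * R ^ m \<le> measure M (ball x R \<inter> space M)" if x: "x \<in> F0" and R: "0 < R" "R \<le> r" for x R
  proof -
    have "ball x R \<subseteq> cball a r'"
    proof
      fix y assume y: "y \<in> ball x R"
      have "dist a y \<le> dist a x + dist x y" by (rule dist_triangle)
      then show "y \<in> cball a r'" using x y R r by (simp add: F0_def)
    qed
    then have sub: "ball x R \<subseteq> \<Omega>" using r'(2) by blast
    have "ennreal (measure M (ball x R)) = ennreal (\<kappa> * R ^ m)"
      using em[OF _ sub] R by (simp add: emeasure_lborel_ball \<kappa>_def m_def)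
    then have "measure M (ball x R) = \<kappa> * R ^ m" using \<kappa> R by (subst (asm) ennreal_inj) auto
    then show ?thesis using sub by (simp add: spM Int_absorb2)
  qed
  have F0pos: "0 < measure M F0"
  proof -
    have "0 < \<kappa> * r ^ m" using \<kappa> r by simp
    also have "\<dots> \<le> measure M (ball a r \<inter> space M)" using r by (intro lower) (auto simp: F0_def)
    also have "\<dots> \<le> measure M F0"
      using G.compact_sets[OF F0] by (intro G.finite_measure_mono) (auto simp: F0_def)
    finally show ?thesis .
  qed
  \<comment> \<open>Positive on the open ball of radius \<open>r'\<close>, hence bounded below on
    the smaller compact ball \<open>F0\<close>.\<close>
  define p where "p = bump a r'"
  have pV: "p \<in> V" using bump_test_function[OF r'] testV unfolding p_def by blast
  have cont: "continuous_on F0 p"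
  proof -
    obtain L where "nice p L" unfolding p_def by (rule test_function_nice[OF bump_test_function[OF r']])
    then show ?thesis by (rule nice_continuous)
  qed
  have "F0 \<noteq> {}" using r by (simp add: F0_def)
  then obtain x0 where x0: "x0 \<in> F0" "\<And>x. x \<in> F0 \<Longrightarrow> p x0 \<le> p x"
    using continuous_attains_inf[OF F0(1) _ cont] by blast
  have px0: "0 < p x0"
  proof -
    have "x0 \<in> ball a r'" using x0(1) F0sub by blast
    then have "p x0 \<noteq> 0" using bump_eq_0_iff[OF r'(1), of a x0] unfolding p_def by blast
    then show ?thesis using bump_nonneg[of a r' x0] unfolding p_def by linarith
  qed
  have zs: "\<exists>u\<in>V. continuous_on (space M) u \<and> (\<forall>x\<in>space M. 0 \<le> u x \<and> (u x = 0 \<longleftrightarrow> x \<in> F))"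
    if F: "compact F" for F
  proof -
    obtain u S where S: "\<And>n. S n \<in> test_functions \<Omega>" "\<And>n. nice (\<lambda>x. u x - S n x) (2 * (1/2) ^ n)"
      and u: "\<And>x. 0 \<le> u x" "\<And>x. x \<in> \<Omega> \<Longrightarrow> u x = 0 \<longleftrightarrow> x \<in> F"
      using zero_set_function[OF op F] by metis
    have eq: "(\<lambda>x. u x - S n x) = u - S n" for n by (simp add: fun_eq_iff)
    have SE: "S n \<in> E.carrier" for n using S(1) testE by blast
    have dE: "u - S n \<in> E.carrier" for n using niceE[OF S(2)[of n]] unfolding eq .
    have "u = (u - S 0) + S 0" by simp
    then have uE: "u \<in> E.carrier" using E.carrier_add[OF dE SE, of 0 0] by simp
    have "u \<in> V" unfolding V norm_closure_def
    proof (intro CollectI conjI allI impI uE)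
      fix e :: real assume e: "0 < e"
      \<comment> \<open>\<open>K\<close> may be 0, so the bound \<open>4 * K * (1/4) ^ n\<close> is
        compared with \<open>e\<^sup>2\<close> through \<open>4 * K + 1\<close>.\<close>
      define q where "q = e\<^sup>2 / (4 * K + 1)"
      have q: "0 < q" using e K(1) by (simp add: q_def)
      obtain n where n: "(1/4) ^ n < q" using real_arch_pow_inv[OF q, of "1/4"] by auto
      have "ennreal ((N (u - S n))\<^sup>2) \<le> ennreal (K * (2 * (1/2) ^ n)\<^sup>2)"
        unfolding QN[OF dE] using K(2)[OF S(2)[of n]] unfolding eq .
      then have "(N (u - S n))\<^sup>2 \<le> K * (2 * (1/2) ^ n)\<^sup>2"
        using K(1) by (subst (asm) ennreal_le_iff) auto
      also have "\<dots> = 4 * K * (1/4) ^ n"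
        by (simp add: power_mult_distrib power2_eq_square flip: power_mult_distrib)
      also have "\<dots> \<le> 4 * K * q" using n K(1) by (intro mult_left_mono) auto
      also have "\<dots> < (4 * K + 1) * q" using q by (simp add: distrib_right)
      also have "\<dots> = e\<^sup>2" using K(1) by (simp add: q_def)
      finally have "N (u - S n) < e" using e by (intro power_less_imp_less_base[of _ 2 e]) auto
      then show "\<exists>a\<in>test_functions \<Omega>. E.norm_of (u - a) < e" using S(1) unfolding N by blast
    qed
    moreover have "continuous_on (space M) u"
    proof -
      obtain L where L: "nice (S 0) L" by (rule test_function_nice[OF S(1)])
      have "continuous_on (space M) (\<lambda>x. (u x - S 0 x) + S 0 x)"
        by (intro continuous_on_add nice_continuous[OF S(2)] nice_continuous[OF L])
      then show ?thesis by simp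
    qed
    ultimately show ?thesis using u by (intro bexI[of _ u]) (auto simp: spM)
  qed
  interpret regular_pivot V N M m C s \<kappa> r F0 p "p x0"
  proof
    show "measure M (ball x R \<inter> space M) \<le> C * R ^ m" if "x \<in> space M" "0 < R" for x R
    proof -
      have "\<kappa> * R ^ m \<le> C * R ^ m" using that(2) C(1) by (intro mult_right_mono) auto
      then show ?thesis using G.upper[OF that] by linarith
    qed
  qed (use G.sets_M G.space_borel G.space_bounded G.m_pos Vm L2N VE C s \<kappa> r F0 F0pos lower osc zs pV px0 x0 in auto)
  show ?thesis using non_polyhedric_unit_ball unfolding V_def N_def M_def .
qed

end

theorem corollary3p3:
  fixes \<Omega> :: "'a::euclidean_space set"
  assumes "\<Omega> \<noteq> {}" and "open \<Omega>" and "connected \<Omega>" and "bounded \<Omega>"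
    and "lipschitz_boundary \<Omega>"
  shows "(\<forall>s. 0 < s \<and> s \<le> 1 \<longrightarrow>
            non_polyhedric
              (dual_space (Hs0 s \<Omega>) (Hs_norm s \<Omega>))
              (dual_norm (Hs0 s \<Omega>) (Hs_norm s \<Omega>))
              (functional_of (domain_measure \<Omega>) (Hs0 s \<Omega>) ` bounded_by_one (domain_measure \<Omega>)))
       \<and> (DIM('a) \<ge> 2 \<longrightarrow>
            non_polyhedric
              (dual_space (H_half_boundary \<Omega>) (H_half_boundary_norm \<Omega>))
              (dual_norm (H_half_boundary \<Omega>) (H_half_boundary_norm \<Omega>))
              (functional_of (surface_measure \<Omega>) (H_half_boundary \<Omega>)
                 ` bounded_by_one (surface_measure \<Omega>)))"
proof (intro conjI allI impI)
  fix s :: real assume "0 < s \<and> s \<le> 1"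
  then show "non_polyhedric (dual_space (Hs0 s \<Omega>) (Hs_norm s \<Omega>))
      (dual_norm (Hs0 s \<Omega>) (Hs_norm s \<Omega>))
      (functional_of (domain_measure \<Omega>) (Hs0 s \<Omega>) ` bounded_by_one (domain_measure \<Omega>))"
    by (intro domain_non_polyhedric[OF assms(2,4,1)]) auto
qed (rule boundary_non_polyhedric[OF assms(1,2,4,5)])

end
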